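(* Let $M(\omega)$, $\omega\in\Omega$, be a random reduced dynamics operator on $\mathbb{C}^d$ with probability space $(\Omega,\mathcal{F},\mathrm{p})$, and suppose that $\mathrm{p}(M(\omega)\in\mathcal{M}_{(E)})>0$. For $\overline\omega=(\omega_j)_{j\ge1}\in\Omega^{\mathbb{N}^*}$ let $\Phi_n(\overline\omega)=M(\omega_n)M(\omega_{n-1})\cdots M(\omega_1)$. Then there exist $\alpha>0$, a random vector $\eta_\infty(\overline\omega)\in\mathbb{C}^d$ and a set $\Omega_0\subset\Omega^{\mathbb{N}^*}$ with $\mathbb{P}(\Omega_0)=1$ such that for any $\overline\omega\in\Omega_0$ there is a constant $C_{\overline\omega}$ with $$\big\|\Phi_n(\overline\omega)-|\psi_{\mathcal S}\rangle\langle\eta_\infty(\overline\omega)|\big\|\le C_{\overline\omega}e^{-\alpha n}\qquad\text{for all } n\in\mathbb{N}^*.$$ As a consequence, for any $\overline\omega\in\Omega_0$, the top Lyapunov exponent $\gamma_1(\overline\omega)$ is of multiplicity one.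
   Context: Inner products on $\mathbb{C}^d$ are linear in the second factor; $\|\cdot\|$ is the Euclidean norm and the induced operator norm; $|\psi\rangle\langle\phi|$ denotes $\chi\mapsto\langle\phi,\chi\rangle\psi$. $\mathbb{N}^*=\{1,2,\dots\}$. A random reduced dynamics operator (RRDO) is a measurable map $\omega\mapsto M(\omega)\in M_d(\mathbb{C})$ on a probability space $(\Omega,\mathcal{F},\mathrm{p})$ such that: (1) there is a norm $|||\cdot|||$ on $\mathbb{C}^d$ (independent of $\omega$) for which every $M(\omega)$ is a contraction; (2) there is a vector $\psi_{\mathcal S}$, independent of $\omega$, normalized by $\|\psi_{\mathcal S}\|=1$, with $M(\omega)\psi_{\mathcal S}=\psi_{\mathcal S}$ for all $\omega$. $\mathcal{M}_{(E)}$ is the set of matrices $M$ with $|||M|||\le1$ and $M\psi_{\mathcal S}=\psi_{\mathcal S}$ whose spectrum on the complex unit circle consists only of the simple eigenvalue $1$. $\mathbb{P}=\prod_{j\ge1}\mathrm{p}$ is the product probability measure on $\Omega^{\mathbb{N}^*}$. Lyapunov exponents: by the Multiplicative Ergodic Theorem the limit $\Lambda_\Phi(\overline\omega)=\lim_{n\to\infty}(\Phi_n(\overline\omega)^*\Phi_n(\overline\omega))^{1/2n}$ exists almost surely; $\gamma_1(\overline\omega)$ is the top Lyapunov exponent, i.e. the logarithm of the largest eigenvalue of $\Lambda_\Phi(\overline\omega)$, and its multiplicity is the multiplicity of that eigenvalue. ($\gamma_1$ and its multiplicity are almost surely constant.) *)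

theory Defs
  imports "HOL-Probability.Probability" "HOL-Computational_Algebra.Polynomial"
begin

section \<open>Hermitian structure and matrices on complex n-space\<close>

text \<open>The inner product of class \<open>real_inner\<close> on \<^typ>\<open>complex ^ 'n\<close> is the real part of the
  sesquilinear one below, which is linear in its second argument.\<close>

definition cinner :: "complex ^ 'n \<Rightarrow> complex ^ 'n \<Rightarrow> complex" where
  "cinner x y = (\<Sum>i\<in>UNIV. cnj (x $ i) * y $ i)"

definition ketbra :: "complex ^ 'n \<Rightarrow> complex ^ 'n \<Rightarrow> complex ^ 'n ^ 'n" where
  "ketbra \<psi> \<phi> = matrix (\<lambda>v. cinner \<phi> v *s \<psi>)"

definition adjoint_mat :: "complex ^ 'n ^ 'n \<Rightarrow> complex ^ 'n ^ 'n" where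
  "adjoint_mat A = (\<chi> i j. cnj (A $ j $ i))"

text \<open>The type class power \<open>A ^ k\<close> on matrices is entrywise, hence this definition.\<close>

definition mat_power :: "complex ^ 'n ^ 'n \<Rightarrow> nat \<Rightarrow> complex ^ 'n ^ 'n" where
  "mat_power A k = (((**) A) ^^ k) (mat 1)"

definition op_norm :: "complex ^ 'n ^ 'n \<Rightarrow> real" where
  "op_norm A = onorm (\<lambda>x. A *v x)"

definition eigenvalues :: "complex ^ 'n ^ 'n \<Rightarrow> complex set" where
  "eigenvalues A = {l. \<exists>x. x \<noteq> 0 \<and> A *v x = l *s x}"

definition charpoly :: "complex ^ 'n ^ 'n \<Rightarrow> complex poly" where
  "charpoly A = det (mat [:0, 1:] - map_matrix (\<lambda>a. [:a:]) A)"

definition alg_mult :: "complex ^ 'n ^ 'n \<Rightarrow> complex \<Rightarrow> nat" where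
  "alg_mult A l = order l (charpoly A)"

definition psd :: "complex ^ 'n ^ 'n \<Rightarrow> bool" where
  "psd A \<longleftrightarrow> adjoint_mat A = A \<and> (\<forall>x. 0 \<le> Re (cinner x (A *v x)))"

text \<open>For positive semidefinite \<open>A\<close> and \<open>k \<ge> 1\<close> this is \<open>A\<close> to the power \<open>1/k\<close>.\<close>

definition psd_root :: "nat \<Rightarrow> complex ^ 'n ^ 'n \<Rightarrow> complex ^ 'n ^ 'n" where
  "psd_root k A = (THE B. psd B \<and> mat_power B k = A)"


section \<open>Random reduced dynamics operators\<close>

definition is_norm :: "(complex ^ 'n \<Rightarrow> real) \<Rightarrow> bool" where
  "is_norm N \<longleftrightarrow>
     (\<forall>x. N x = 0 \<longleftrightarrow> x = 0) \<and>
     (\<forall>x y. N (x + y) \<le> N x + N y) \<and>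
     (\<forall>c x. N (c *s x) = cmod c * N x)"

definition induced_norm :: "(complex ^ 'n \<Rightarrow> real) \<Rightarrow> complex ^ 'n ^ 'n \<Rightarrow> real" where
  "induced_norm N A = (SUP x. N (A *v x) / N x)"

definition rrdo ::
  "'w measure \<Rightarrow> (complex ^ 'n \<Rightarrow> real) \<Rightarrow> complex ^ 'n \<Rightarrow> ('w \<Rightarrow> complex ^ 'n ^ 'n) \<Rightarrow> bool" where
  "rrdo p N \<psi> M \<longleftrightarrow>
     prob_space p \<and> M \<in> borel_measurable p \<and>
     is_norm N \<and> (\<forall>w\<in>space p. \<forall>x. N (M w *v x) \<le> N x) \<and>
     norm \<psi> = 1 \<and> (\<forall>w\<in>space p. M w *v \<psi> = \<psi>)"

definition M_E :: "(complex ^ 'n \<Rightarrow> real) \<Rightarrow> complex ^ 'n \<Rightarrow> (complex ^ 'n ^ 'n) set" where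
  "M_E N \<psi> = {A. induced_norm N A \<le> 1 \<and> A *v \<psi> = \<psi> \<and>
     eigenvalues A \<inter> {z. cmod z = 1} = {1} \<and> alg_mult A 1 = 1}"

definition path_measure :: "'w measure \<Rightarrow> (nat \<Rightarrow> 'w) measure" where
  "path_measure p = Pi\<^sub>M {1..} (\<lambda>_. p)"

primrec Phi ::
  "('w \<Rightarrow> complex ^ 'n ^ 'n) \<Rightarrow> nat \<Rightarrow> (nat \<Rightarrow> 'w) \<Rightarrow> complex ^ 'n ^ 'n" where
  "Phi M 0 w = mat 1"
| "Phi M (Suc n) w = M (w (Suc n)) ** Phi M n w"


section \<open>Lyapunov exponents\<close>

text \<open>\<open>lyapunov_seq A\<close> is the sequence of matrices \<open>(A_n^* A_n)^(1/2n)\<close>. Its entry at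
  \<open>n = 0\<close> carries no meaning; only its limit is used.\<close>

definition lyapunov_seq ::
  "(nat \<Rightarrow> complex ^ 'n ^ 'n) \<Rightarrow> nat \<Rightarrow> complex ^ 'n ^ 'n" where
  "lyapunov_seq A n = psd_root (2 * n) (adjoint_mat (A n) ** A n)"

definition lyapunov_matrix :: "(nat \<Rightarrow> complex ^ 'n ^ 'n) \<Rightarrow> complex ^ 'n ^ 'n" where
  "lyapunov_matrix A = lim (lyapunov_seq A)"

text \<open>The Lyapunov exponents are the logarithms in \<open>[-\<infinity>, \<infinity>)\<close> of the eigenvalues of the
  (positive semidefinite) matrix \<open>L = lyapunov_matrix A\<close>.\<close>

definition top_lyapunov_exponent :: "complex ^ 'n ^ 'n \<Rightarrow> ereal" where
  "top_lyapunov_exponent L =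
     (let r = Max {r :: real. complex_of_real r \<in> eigenvalues L}
      in if r = 0 then -\<infinity> else ereal (ln r))"

text \<open>The multiplicity of the exponent \<open>g\<close> is that of the eigenvalue \<open>exp g\<close>.\<close>

definition lyapunov_multiplicity :: "complex ^ 'n ^ 'n \<Rightarrow> ereal \<Rightarrow> nat" where
  "lyapunov_multiplicity L g =
     alg_mult L (complex_of_real (if g = -\<infinity> then 0 else exp (real_of_ereal g)))"

end

theory Submission
  imports Defs "HOL-Computational_Algebra.Fundamental_Theorem_Algebra"
begin

text \<open>
  \<^emph>\<open>Exponential decay.\<close> The quotient of the given norm by the line through \<open>\<psi>\<close> is contracted by
  every \<open>M \<omega>\<close>. Some value \<open>A \<in> M_E\<close> of \<open>M\<close> lies in the support of its distribution; since \<open>A\<close>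
  acts on the quotient with spectral radius below 1, products of \<open>k\<close> factors close to \<open>A\<close> contract
  the quotient norm by a factor 1/2, and by independence such products occupy a positive fraction of
  the disjoint blocks of length \<open>k\<close>. So \<open>\<Phi>\<^sub>n\<close> decays exponentially modulo \<open>\<psi>\<close>, and
  \<open>\<Phi>\<^sub>n\<^sup>* \<psi>\<close> is a Cauchy sequence with limit \<open>\<eta>\<^sub>\<infinity>\<close>.

  \<^emph>\<open>Existence of the Lyapunov exponents.\<close> The sum \<open>F A\<close> of the absolute values of all minors of
  order \<open>q\<close> is submultiplicative by Cauchy--Binet, and comparable to the product of the \<open>q\<close> largest
  singular values. The event that \<open>F \<Phi>\<^sub>n < r\<^sup>n\<close> infinitely often for some \<open>r < c\<close> has
  probability 0 or 1; if it is 1, cutting almost every path greedily into blocks on which \<open>F\<close> decays at rate \<open>c\<close> gives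
  \<open>F \<Phi>\<^sub>n \<le> c'\<^sup>n\<close> eventually, for every \<open>c' > c\<close>. Hence \<open>(F \<Phi>\<^sub>n)\<^sup>1\<^sup>/\<^sup>n\<close> converges without any
  integrability of \<open>ln F\<close>, and so do the \<open>n\<close>-th roots of the singular values.
  At a gap between their limits the spectral projections of \<open>\<Phi>\<^sub>n\<^sup>* \<Phi>\<^sub>n\<close> form a Cauchy sequence,
  because a right singular vector of \<open>\<Phi>\<^sub>n\<close> with small singular value is almost orthogonal to one of
  \<open>\<Phi>\<^sub>n\<^sub>+\<^sub>1\<close> with large singular value.

  \<^emph>\<open>Simplicity.\<close> The largest singular value of \<open>\<Phi>\<^sub>n\<close> stays between two positive constants and the second
  one is \<open>O(e\<^sup>-\<^sup>\<alpha>\<^sup>n)\<close>, as \<open>\<Phi>\<^sub>n\<close> is that close to a matrix of rank one.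
\<close>

section \<open>Orthonormal families and the spectral theorem\<close>

text \<open>The factors \<open>M w\<close> may be singular, so exponents can be -\<infinity>; growth
  is therefore measured by \<open>n\<close>-th roots instead of logarithms, and single factors are
  bounded from above only. Convergence of \<open>lyapunov_seq\<close> has to be proved along with
  simplicity, because \<open>lyapunov_matrix\<close> is a \<open>lim\<close>, which says nothing
  about a divergent sequence. The matrices \<open>M w\<close> share the fixed vector \<psi> but in
  general no invariant complement of its line, hence the quotient. Membership in \<open>M_E\<close>
  gives no contraction rate uniform over that set; one support point \<open>A\<close> provides one
  block length \<open>k\<close> and one neighbourhood, whose elements need not lie in
  \<open>M_E\<close>. The rank-one limit arises because \<open>M w - 1\<close> kills \<psi>: the
  increments of \<Phi> see only the part of the image transversal to \<psi>, which decays.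
  Eigenvectors of \<Phi>* \<Phi> are chosen separately for each \<open>n\<close> and need not
  converge. Summation by parts writes a spectral sum through projections onto the leading
  eigenvectors, weighted by differences of successive eigenvalues, so only projections at gaps
  matter.\<close>

lemma cinner_add_right: "cinner x (y + z) = cinner x y + cinner x z"
  by (simp add: cinner_def algebra_simps sum.distrib)

lemma cinner_diff_right: "cinner x (y - z) = cinner x y - cinner x z"
  by (simp add: cinner_def algebra_simps sum_subtractf)

lemma cinner_diff_left: "cinner (x - y) z = cinner x z - cinner y z"
  by (simp add: cinner_def algebra_simps sum_subtractf)

lemma cinner_scale_right [simp]: "cinner x (c *s y) = c * cinner x y"
  by (simp add: cinner_def algebra_simps sum_distrib_left)

lemma cinner_scale_left [simp]: "cinner (c *s x) y = cnj c * cinner x y"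
  by (simp add: cinner_def algebra_simps sum_distrib_left)

lemma cinner_zero_right [simp]: "cinner x 0 = 0"
  and cinner_zero_left [simp]: "cinner 0 x = 0"
  by (simp_all add: cinner_def)

lemma cinner_sum_right: "cinner x (\<Sum>i\<in>I. f i) = (\<Sum>i\<in>I. cinner x (f i))"
  by (induction I rule: infinite_finite_induct) (simp_all add: cinner_add_right)

lemma cinner_commute: "cinner y x = cnj (cinner x y)"
  by (simp add: cinner_def mult.commute)

lemma Re_cinner: "Re (cinner x y) = x \<bullet> y"
  by (simp add: cinner_def inner_vec_def inner_complex_def)

lemma cinner_self: "cinner x x = complex_of_real ((norm x)\<^sup>2)"
proof (rule complex_eqI)
  show "Re (cinner x x) = Re (complex_of_real ((norm x)\<^sup>2))"
    by (simp add: Re_cinner power2_norm_eq_inner)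
  have "cinner x x = cnj (cinner x x)" by (rule cinner_commute)
  then show "Im (cinner x x) = Im (complex_of_real ((norm x)\<^sup>2))"
    by (simp add: complex_eq_iff)
qed

lemma norm_eq_1_if_cinner:
  assumes "cinner x x = 1"
  shows "norm x = 1"
proof (rule power2_eq_imp_eq)
  show "(norm x)\<^sup>2 = 1\<^sup>2" using assms by (metis cinner_self of_real_eq_1_iff one_power2)
qed simp_all

lemma norm_vector_smult: "norm (c *s x) = cmod c * norm x" for x :: "complex ^ 'n"
  by (simp add: norm_vec_def L2_set_def norm_mult power_mult_distrib real_sqrt_mult
      flip: sum_distrib_left)

lemma norm_cinner_le: "cmod (cinner x y) \<le> norm x * norm y"
proof (cases "cinner x y = 0")
  case False
  define c where "c = cnj (sgn (cinner x y))"
  have c: "cmod c = 1" using False by (simp add: c_def norm_sgn)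
  have "cinner x (c *s y) = complex_of_real (cmod (cinner x y))"
    using False by (simp add: c_def sgn_eq complex_norm_square[symmetric] power2_eq_square
        field_simps)
  then have "cmod (cinner x y) = x \<bullet> (c *s y)" by (simp flip: Re_cinner)
  also have "\<dots> \<le> norm x * norm (c *s y)" by (rule norm_cauchy_schwarz)
  finally show ?thesis by (simp add: norm_vector_smult c)
qed simp

lemma scaleR_eq_vector_smult: "r *\<^sub>R x = complex_of_real r *s x" for x :: "complex ^ 'n"
  by (simp add: vec_eq_iff) (simp add: scaleR_conv_of_real)

section \<open>Adjoints, rank-one matrices and the action of matrices on vectors\<close>

lemma cinner_adjoint: "cinner (adjoint_mat A *v x) y = cinner x (A *v y)"
proof -
  have "cinner (adjoint_mat A *v x) y = (\<Sum>i\<in>UNIV. \<Sum>j\<in>UNIV. A $ j $ i * cnj (x $ j) * y $ i)"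
    by (simp add: cinner_def adjoint_mat_def matrix_vector_mult_def sum_distrib_right)
  also have "\<dots> = (\<Sum>j\<in>UNIV. \<Sum>i\<in>UNIV. A $ j $ i * cnj (x $ j) * y $ i)"
    by (rule sum.swap)
  also have "\<dots> = cinner x (A *v y)"
    by (simp add: cinner_def matrix_vector_mult_def sum_distrib_left mult_ac)
  finally show ?thesis .
qed

lemma adjoint_adjoint [simp]: "adjoint_mat (adjoint_mat A) = A"
  by (simp add: adjoint_mat_def vec_eq_iff)

lemma adjoint_mult: "adjoint_mat (A ** B) = adjoint_mat B ** adjoint_mat A"
  by (simp add: adjoint_mat_def matrix_matrix_mult_def vec_eq_iff mult.commute)

lemma cinner_adjoint_right: "cinner x (adjoint_mat A *v y) = cinner (A *v x) y"
  using cinner_adjoint[of "adjoint_mat A" x y] by simp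

lemma ketbra_nth: "ketbra \<psi> \<phi> $ i $ j = \<psi> $ i * cnj (\<phi> $ j)"
proof -
  have "cinner \<phi> (axis j 1) = (\<Sum>k\<in>UNIV. if k = j then cnj (\<phi> $ k) else 0)"
    unfolding cinner_def by (rule sum.cong) (auto simp: axis_def)
  then show ?thesis by (simp add: ketbra_def matrix_def)
qed

lemma ketbra_mult_vec: "ketbra \<psi> \<phi> *v x = cinner \<phi> x *s \<psi>"
  by (simp add: vec_eq_iff matrix_vector_mult_def ketbra_nth cinner_def sum_distrib_left mult_ac)

lemma matrix_eq_if_vec: "(\<And>x. A *v x = B *v x) \<Longrightarrow> A = B" for A B :: "complex ^ 'n ^ 'm"
  by (simp add: matrix_eq)

lemma mat_mult_vec: "mat c *v x = c *s x" for x :: "complex ^ 'n"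
  by (simp add: vec_eq_iff matrix_vector_mult_def mat_def if_distrib[where f="\<lambda>t. t * _"] cong: if_cong)

lemma matrix_vec_axis_nth: "(A *v axis j 1) $ i = A $ i $ j" for A :: "complex ^ 'n ^ 'm"
  by (simp add: matrix_vector_mult_def axis_def if_distrib[where f="\<lambda>t. _ * t"] cong: if_cong)

lemma sum_matrix_vec_mult: "(\<Sum>i\<in>I. F i) *v x = (\<Sum>i\<in>I. F i *v x)" for F :: "_ \<Rightarrow> complex ^ 'n ^ 'm"
  by (induction I rule: infinite_finite_induct) (simp_all add: matrix_vector_mult_add_rdistrib)

lemma matrix_vec_mult_sum: "A *v (\<Sum>i\<in>I. f i) = (\<Sum>i\<in>I. A *v f i)" for A :: "complex ^ 'n ^ 'm"
  by (induction I rule: infinite_finite_induct) (simp_all add: matrix_vector_right_distrib)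

lemma scaleR_matrix_vec_mult: "(r *\<^sub>R A) *v x = complex_of_real r *s (A *v x)"
  for A :: "complex ^ 'n ^ 'm"
  by (simp add: vec_eq_iff matrix_vector_mult_def sum_distrib_left)
    (simp add: scaleR_conv_of_real mult_ac)

lemma norm_matrix_vec_le: "norm (A *v x) \<le> norm A * norm x" for A :: "complex ^ 'n ^ 'm"
proof -
  have row: "cmod ((A *v x) $ i) \<le> norm (A $ i) * norm x" for i
  proof -
    have "cmod ((A *v x) $ i) \<le> (\<Sum>j\<in>UNIV. cmod (A $ i $ j) * cmod (x $ j))"
      unfolding matrix_vector_mult_def
      by (simp add: norm_mult[symmetric] norm_sum)
    also have "\<dots> \<le> norm (A $ i) * norm x"
      using L2_set_mult_ineq[of "\<lambda>j. cmod (A $ i $ j)" "\<lambda>j. cmod (x $ j)" UNIV]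
      by (simp add: norm_vec_def)
    finally show ?thesis .
  qed
  have "norm (A *v x) = L2_set (\<lambda>i. cmod ((A *v x) $ i)) UNIV" by (simp add: norm_vec_def)
  also have "\<dots> \<le> L2_set (\<lambda>i. norm (A $ i) * norm x) UNIV"
    by (rule L2_set_mono) (use row in auto)
  also have "\<dots> = norm A * norm x"
    by (simp add: L2_set_left_distrib norm_vec_def[of A])
  finally show ?thesis .
qed

lemma bounded_linear_matrix_vec: "bounded_linear (\<lambda>x. A *v x)" for A :: "complex ^ 'n ^ 'm"
proof (rule bounded_linear_intro[of _ "norm A"])
  show "norm (A *v x) \<le> norm x * norm A" for x
    using norm_matrix_vec_le[of A x] by (simp add: mult.commute)
  show "A *v r *\<^sub>R x = r *\<^sub>R (A *v x)" for r x
    by (simp add: scaleR_eq_vector_smult vec.scale)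
qed (simp add: matrix_vector_right_distrib)

lemma op_norm_le: "(\<And>x. norm (A *v x) \<le> b * norm x) \<Longrightarrow> op_norm A \<le> b"
  unfolding op_norm_def by (rule onorm_le)

text \<open>Indexing by an initial segment of the naturals lets a family grow one vector at a time
  and lets eigenvalues be listed in decreasing order. Values from index \<open>k\<close> on are
  arbitrary.\<close>

definition onfam :: "nat \<Rightarrow> (nat \<Rightarrow> complex ^ 'n) \<Rightarrow> bool" where
  "onfam k v \<longleftrightarrow> (\<forall>i<k. \<forall>j<k. cinner (v i) (v j) = (if i = j then 1 else 0))"

lemma exists_unit_orthogonal:
  fixes v :: "nat \<Rightarrow> complex ^ 'n"
  assumes "k < CARD('n)"
  obtains x where "norm x = 1" "\<And>i. i < k \<Longrightarrow> cinner (v i) x = 0"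
proof -
  \<comment> \<open>Real orthogonality to both \<open>v i\<close> and \<open>\<i> *s v i\<close> is
    complex orthogonality to \<open>v i\<close>. These are at most \<open>2 * k\<close> vectors in a
    real space of dimension \<open>2 * CARD('n)\<close>.\<close>
  define S where "S = v ` {..<k} \<union> (\<lambda>i. \<i> *s v i) ` {..<k}"
  have "card S \<le> k + k"
    unfolding S_def by (rule order.trans[OF card_Un_le add_mono]) (auto intro: order.trans[OF card_image_le])
  moreover have "dim S \<le> card S" by (rule dim_le_card') (simp add: S_def)
  ultimately have "dim S < DIM(complex ^ 'n)" using assms by simp
  then obtain x where x: "x \<noteq> 0" "\<And>y. y \<in> span S \<Longrightarrow> orthogonal x y"
    using orthogonal_to_subspace_exists by blast
  have "cinner (v i) x = 0" if "i < k" for i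
  proof (rule complex_eqI)
    have "v i \<in> span S" "\<i> *s v i \<in> span S" using that by (auto simp: S_def intro!: span_base)
    then have "v i \<bullet> x = 0" "(\<i> *s v i) \<bullet> x = 0"
      using x(2) by (auto simp: orthogonal_def inner_commute[of _ x])
    then show "Re (cinner (v i) x) = Re 0" "Im (cinner (v i) x) = Im 0"
      by (simp_all flip: Re_cinner)
  qed
  then show ?thesis
    by (intro that[of "(1 / norm x) *\<^sub>R x"]) (use x(1) in \<open>auto simp: scaleR_eq_vector_smult norm_vector_smult norm_divide\<close>)
qed

lemma onfam_Suc:
  assumes "onfam k v" "norm x = 1" "\<And>i. i < k \<Longrightarrow> cinner (v i) x = 0"
  shows "onfam (Suc k) (v(k := x))"
proof -
  have "cinner x (v i) = 0" if "i < k" for i using assms(3)[OF that] by (subst cinner_commute) simp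
  then show ?thesis using assms by (auto simp: onfam_def less_Suc_eq cinner_self)
qed

lemma onfam_extend:
  fixes v :: "nat \<Rightarrow> complex ^ 'n"
  assumes "onfam k v" "k \<le> CARD('n)"
  obtains u where "onfam CARD('n) u" "\<And>i. i < k \<Longrightarrow> u i = v i"
proof -
  have "\<exists>u. onfam (k + m) u \<and> (\<forall>i<k. u i = v i)" if "k + m \<le> CARD('n)" for m
    using that
  proof (induction m)
    case 0
    then show ?case using assms by auto
  next
    case (Suc m)
    then obtain u where u: "onfam (k + m) u" "\<forall>i<k. u i = v i" by auto
    obtain x where "norm x = 1" "\<And>i. i < k + m \<Longrightarrow> cinner (u i) x = 0"
      using exists_unit_orthogonal[of "k + m" u] Suc.prems by auto
    then have "onfam (Suc (k + m)) (u(k + m := x))" by (intro onfam_Suc u)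
    moreover have "\<forall>i<k. (u(k + m := x)) i = v i" using u(2) by simp
    ultimately show ?case unfolding add_Suc_right by blast
  qed
  from this[of "CARD('n) - k"] show ?thesis using assms(2) that by auto
qed

text \<open>With the vectors as columns of a square matrix \<open>V\<close>, orthonormality is
  \<open>V* V = 1\<close>. A left inverse of a square matrix is a right inverse, and
  \<open>V V* = 1\<close> is completeness. \<open>f\<close> enumerates the index type.\<close>

lemma onfam_unitary:
  fixes v :: "nat \<Rightarrow> complex ^ 'n"
  assumes on: "onfam CARD('n) v"
  obtains f :: "'n \<Rightarrow> nat" and V where "bij_betw f UNIV {..<CARD('n)}"
    "adjoint_mat V ** V = mat 1" "V ** adjoint_mat V = mat 1" "\<And>k. column k V = v (f k)"
proof -
  obtain f where f: "bij_betw f (UNIV :: 'n set) {..<CARD('n)}"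
    using ex_bij_betw_finite_nat[of "UNIV :: 'n set"] by (auto simp: atLeast0LessThan)
  have f_less: "f k < CARD('n)" and f_inj: "f k = f k' \<longleftrightarrow> k = k'" for k k'
    using f by (auto simp: bij_betw_def inj_on_eq_iff)
  define V :: "complex ^ 'n ^ 'n" where "V = (\<chi> i k. v (f k) $ i)"
  have "(adjoint_mat V ** V) $ i $ k = cinner (v (f i)) (v (f k))" for i k
    by (simp add: matrix_matrix_mult_def adjoint_mat_def V_def cinner_def)
  then have "adjoint_mat V ** V = mat 1"
    using on f_less f_inj by (simp add: vec_eq_iff mat_def onfam_def)
  moreover have "column k V = v (f k)" for k by (simp add: column_def V_def)
  ultimately show ?thesis using that f matrix_left_right_inverse by blast
qed

lemma onfam_expand:
  fixes v :: "nat \<Rightarrow> complex ^ 'n"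
  assumes "onfam CARD('n) v"
  shows "(\<Sum>i<CARD('n). cinner (v i) x *s v i) = x"
proof -
  obtain f :: "'n \<Rightarrow> nat" and V where f: "bij_betw f UNIV {..<CARD('n)}"
    and VV: "V ** adjoint_mat V = mat 1" and col: "\<And>k. column k V = v (f k)"
    using onfam_unitary[OF assms] by metis
  have "(\<Sum>i<CARD('n). cinner (v i) x *s v i) = (\<Sum>k\<in>UNIV. cinner (v (f k)) x *s v (f k))"
    by (rule sum.reindex_bij_betw[OF f, symmetric])
  also have "\<dots> = (\<Sum>k\<in>UNIV. (adjoint_mat V *v x) $ k *s column k V)"
    by (simp flip: col add: cinner_def adjoint_mat_def matrix_vector_mult_def column_def)
  also have "\<dots> = V *v (adjoint_mat V *v x)" by (rule matrix_mult_sum[symmetric])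
  also have "\<dots> = x" by (simp add: matrix_vector_mul_assoc VV)
  finally show ?thesis .
qed

lemma onfam_parseval:
  fixes v :: "nat \<Rightarrow> complex ^ 'n"
  assumes "onfam CARD('n) v"
  shows "(\<Sum>i<CARD('n). (cmod (cinner (v i) x))\<^sup>2) = (norm x)\<^sup>2"
proof -
  have "complex_of_real ((norm x)\<^sup>2) = cinner x (\<Sum>i<CARD('n). cinner (v i) x *s v i)"
    by (simp add: onfam_expand[OF assms] cinner_self)
  also have "\<dots> = (\<Sum>i<CARD('n). cinner (v i) x * cnj (cinner (v i) x))"
    unfolding cinner_sum_right cinner_scale_right
    by (rule sum.cong[OF refl]) (metis cinner_commute)
  also have "\<dots> = complex_of_real (\<Sum>i<CARD('n). (cmod (cinner (v i) x))\<^sup>2)"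
    by (simp flip: complex_norm_square)
  finally show ?thesis by (metis of_real_eq_iff)
qed

definition eigbasis :: "complex ^ 'n ^ 'n \<Rightarrow> (nat \<Rightarrow> complex ^ 'n) \<Rightarrow> (nat \<Rightarrow> real) \<Rightarrow> bool" where
  "eigbasis A v l \<longleftrightarrow> onfam CARD('n) v \<and> (\<forall>i<CARD('n). A *v v i = complex_of_real (l i) *s v i) \<and>
     (\<forall>i j. i \<le> j \<longrightarrow> j < CARD('n) \<longrightarrow> l j \<le> l i)"

text \<open>A maximiser of the quadratic form on the unit sphere of an invariant orthogonal
  complement is an eigenvector, by differentiating the Rayleigh quotient.\<close>

lemma maximiser_is_eigenvector:
  fixes A :: "complex ^ 'n ^ 'n"
  assumes A: "adjoint_mat A = A"
    and v: "\<And>i. i < k \<Longrightarrow> A *v v i = complex_of_real (l i) *s v i"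
    and x: "norm x = 1" "\<And>i. i < k \<Longrightarrow> cinner (v i) x = 0"
    and mx: "\<And>y. (\<And>i. i < k \<Longrightarrow> cinner (v i) y = 0) \<Longrightarrow> Re (cinner y (A *v y)) \<le> m * (norm y)\<^sup>2"
    and m: "m = Re (cinner x (A *v x))"
  shows "A *v x = complex_of_real m *s x"
proof (rule ccontr)
  define y where "y = A *v x - complex_of_real m *s x"
  assume "A *v x \<noteq> complex_of_real m *s x"
  then have y0: "norm y > 0" by (simp add: y_def)
  have sa: "cinner (A *v a) b = cinner a (A *v b)" for a b
    using cinner_adjoint[of A a b] A by simp
  have orth: "cinner (v i) (x + t *\<^sub>R y) = 0" if "i < k" for i t
  proof -
    have "cinner (v i) (A *v x) = 0"
      using that v[OF that] x(2)[OF that] by (simp flip: sa)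
    then show ?thesis
      using x(2)[OF that] by (simp add: y_def cinner_add_right cinner_diff_right scaleR_eq_vector_smult)
  qed
  \<comment> \<open>Maximality is tested on the line through \<open>x\<close> in the direction
    \<open>y\<close>, half the gradient of the Rayleigh quotient at \<open>x\<close>. The
    first-order term is positive for small \<open>t > 0\<close>, the remainder is quadratic.\<close>
  have key: "2 * t * (norm y)\<^sup>2 \<le> t\<^sup>2 * (m * (norm y)\<^sup>2 - y \<bullet> (A *v y))" for t :: real
  proof -
    have "(x + t *\<^sub>R y) \<bullet> (A *v (x + t *\<^sub>R y)) \<le> m * (norm (x + t *\<^sub>R y))\<^sup>2"
      using mx[of "x + t *\<^sub>R y"] orth by (simp add: Re_cinner)
    moreover have "(norm (x + t *\<^sub>R y))\<^sup>2 = 1 + 2 * t * (x \<bullet> y) + t\<^sup>2 * (norm y)\<^sup>2"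
    proof -
      have "x \<bullet> x = 1" using x(1) by (simp add: norm_eq_1)
      then show ?thesis unfolding power2_norm_eq_inner
        by (simp add: inner_add_left inner_add_right inner_commute[of y x]
            power2_eq_square algebra_simps)
    qed
    moreover have "(x + t *\<^sub>R y) \<bullet> (A *v (x + t *\<^sub>R y))
        = m + 2 * t * (y \<bullet> (A *v x)) + t\<^sup>2 * (y \<bullet> (A *v y))"
    proof -
      have "A *v (t *\<^sub>R y) = t *\<^sub>R (A *v y)" by (simp add: scaleR_eq_vector_smult vec.scale)
      moreover have "x \<bullet> (A *v y) = y \<bullet> (A *v x)"
        using sa[of x y] by (metis Re_cinner inner_commute)
      ultimately show ?thesis
        by (simp add: m Re_cinner matrix_vector_right_distrib inner_add_left inner_add_right
            power2_eq_square algebra_simps)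
    qed
    moreover have "y \<bullet> (A *v x) = (norm y)\<^sup>2 + m * (x \<bullet> y)"
    proof -
      have "A *v x = y + m *\<^sub>R x" by (simp add: y_def scaleR_eq_vector_smult)
      then show ?thesis by (simp add: inner_add_right power2_norm_eq_inner inner_commute)
    qed
    ultimately show ?thesis by (simp add: algebra_simps)
  qed
  \<comment> \<open>\<open>K\<close> dominates the quadratic coefficient and is positive; at
    \<open>t = (norm y)\<^sup>2 / K\<close> the linear term is then twice the largest possible
    quadratic one.\<close>
  define K where "K = \<bar>m * (norm y)\<^sup>2 - y \<bullet> (A *v y)\<bar> + 1"
  have K: "K > 0" by (simp add: K_def)
  have "2 * ((norm y)\<^sup>2 / K) * (norm y)\<^sup>2 \<le> ((norm y)\<^sup>2 / K)\<^sup>2 * K"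
    using key[of "(norm y)\<^sup>2 / K"]
    by (rule order.trans) (auto intro!: mult_left_mono simp: K_def)
  also have "\<dots> = ((norm y)\<^sup>2 / K) * (norm y)\<^sup>2" using K by (simp add: power2_eq_square)
  finally have "(norm y)\<^sup>2 / K * (norm y)\<^sup>2 \<le> 0" unfolding mult.assoc[of 2] by linarith
  moreover have "(norm y)\<^sup>2 / K * (norm y)\<^sup>2 > 0" using K y0 by simp
  ultimately show False by simp
qed

lemma eigbasis_exists:
  fixes A :: "complex ^ 'n ^ 'n"
  assumes A: "adjoint_mat A = A"
  obtains v l where "eigbasis A v l"
proof -
  \<comment> \<open>The last conjunct bounds the form on the remaining complement by every
    eigenvalue found so far; it makes the next maximum no larger and so keeps the list
    decreasing.\<close>
  have "\<exists>v l. onfam k v \<and> (\<forall>i<k. A *v v i = complex_of_real (l i) *s v i) \<and>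
      (\<forall>i j. i \<le> j \<longrightarrow> j < k \<longrightarrow> l j \<le> l i) \<and>
      (\<forall>i<k. \<forall>y. (\<forall>j<k. cinner (v j) y = 0) \<longrightarrow> Re (cinner y (A *v y)) \<le> l i * (norm y)\<^sup>2)"
    if "k \<le> CARD('n)" for k
    using that
  proof (induction k)
    case 0
    show ?case by (auto simp: onfam_def)
  next
    case (Suc k)
    from Suc.IH Suc.prems obtain v l where on: "onfam k v" and ev: "\<And>i. i < k \<Longrightarrow> A *v v i = complex_of_real (l i) *s v i"
      and srt: "\<And>i j. i \<le> j \<Longrightarrow> j < k \<Longrightarrow> l j \<le> l i"
      and bd: "\<And>i y. i < k \<Longrightarrow> (\<And>j. j < k \<Longrightarrow> cinner (v j) y = 0) \<Longrightarrow>
          Re (cinner y (A *v y)) \<le> l i * (norm y)\<^sup>2"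
      by (metis Suc_leD)
    define S where "S = {x. norm x = 1 \<and> (\<forall>i<k. cinner (v i) x = 0)}"
    have cont: "continuous_on UNIV (\<lambda>x. cinner a x)" for a :: "complex ^ 'n"
      unfolding cinner_def by (intro continuous_intros)
    have Seq: "S = sphere 0 1 \<inter> (\<Inter>i\<in>{..<k}. (\<lambda>x. cinner (v i) x) -` {0})"
      by (auto simp: S_def)
    have "compact S"
      unfolding Seq using cont
      by (intro compact_Int_closed closed_INT ballI closed_vimage) (auto simp: continuous_on_eq_continuous_at)
    moreover have "S \<noteq> {}"
      using exists_unit_orthogonal[of k v] Suc.prems by (auto simp: S_def)
    moreover have "continuous_on S (\<lambda>x. x \<bullet> (A *v x))"
      by (intro continuous_intros linear_continuous_on bounded_linear_matrix_vec)
    ultimately obtain x where xS: "x \<in> S" and xm: "\<And>y. y \<in> S \<Longrightarrow> y \<bullet> (A *v y) \<le> x \<bullet> (A *v x)"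
      using continuous_attains_sup[of S "\<lambda>x. x \<bullet> (A *v x)"] by auto
    define m where "m = x \<bullet> (A *v x)"
    have mx: "Re (cinner y (A *v y)) \<le> m * (norm y)\<^sup>2" if "\<And>i. i < k \<Longrightarrow> cinner (v i) y = 0" for y
    proof (cases "y = 0")
      case False
      define z where "z = (1 / norm y) *\<^sub>R y"
      have "z \<in> S" using that False
        by (auto simp: S_def z_def scaleR_eq_vector_smult norm_vector_smult norm_divide)
      then have "z \<bullet> (A *v z) \<le> m" using xm by (simp add: m_def)
      moreover have "A *v z = (1 / norm y) *\<^sub>R (A *v y)"
        by (simp add: z_def scaleR_eq_vector_smult vec.scale)
      ultimately show ?thesis using False
        by (simp add: z_def Re_cinner field_simps power2_eq_square)
    qed simp
    have evx: "A *v x = complex_of_real m *s x"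
      by (rule maximiser_is_eigenvector[OF A ev _ _ mx]) (use xS in \<open>auto simp: S_def m_def Re_cinner\<close>)
    have ml: "m \<le> l i" if "i < k" for i
      using bd[OF that, of x] xS by (auto simp: S_def m_def Re_cinner)
    define v' where "v' = v(k := x)"
    define l' where "l' = l(k := m)"
    have "onfam (Suc k) v'" unfolding v'_def
      by (rule onfam_Suc[OF on]) (use xS in \<open>auto simp: S_def\<close>)
    moreover have "\<forall>i<Suc k. A *v v' i = complex_of_real (l' i) *s v' i"
      using ev evx by (auto simp: v'_def l'_def less_Suc_eq)
    moreover have "\<forall>i j. i \<le> j \<longrightarrow> j < Suc k \<longrightarrow> l' j \<le> l' i"
      using srt ml by (auto simp: l'_def less_Suc_eq)
    moreover have "\<forall>i<Suc k. \<forall>y. (\<forall>j<Suc k. cinner (v' j) y = 0) \<longrightarrow>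
        Re (cinner y (A *v y)) \<le> l' i * (norm y)\<^sup>2"
    proof (intro allI impI)
      fix i y assume i: "i < Suc k" and "\<forall>j<Suc k. cinner (v' j) y = 0"
      then have "\<And>j. j < k \<Longrightarrow> cinner (v j) y = 0" by (auto simp: v'_def less_Suc_eq split: if_splits)
      then show "Re (cinner y (A *v y)) \<le> l' i * (norm y)\<^sup>2"
        using i bd mx by (auto simp: l'_def)
    qed
    ultimately show ?case by blast
  qed
  from this[OF order_refl] that show ?thesis by (auto simp: eigbasis_def)
qed


section \<open>Roots and characteristic polynomials of positive semidefinite matrices\<close>

lemma adjoint_ketbra: "adjoint_mat (ketbra a b) = ketbra b a"
  by (simp add: vec_eq_iff adjoint_mat_def ketbra_nth)

lemma adjoint_sum: "adjoint_mat (\<Sum>i\<in>I. F i) = (\<Sum>i\<in>I. adjoint_mat (F i))"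
  by (simp add: vec_eq_iff adjoint_mat_def)

lemma adjoint_scaleR: "adjoint_mat (r *\<^sub>R A) = r *\<^sub>R adjoint_mat A"
  by (simp add: vec_eq_iff adjoint_mat_def)

lemma psd_adjoint_mult: "psd (adjoint_mat A ** A)"
  by (simp add: psd_def adjoint_mult cinner_adjoint_right cinner_self
      flip: matrix_vector_mul_assoc)

text \<open>The spectral sum with eigenvalues \<open>l\<close> in the basis \<open>v\<close>. Powers
  and roots of a Hermitian matrix become operations on \<open>l\<close> alone.\<close>

definition specmat :: "(nat \<Rightarrow> complex ^ 'n) \<Rightarrow> (nat \<Rightarrow> real) \<Rightarrow> complex ^ 'n ^ 'n" where
  "specmat v l = (\<Sum>i<CARD('n). l i *\<^sub>R ketbra (v i) (v i))"

lemma specmat_mult_vec: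
  "specmat v l *v x = (\<Sum>i<CARD('n). (complex_of_real (l i) * cinner (v i) x) *s v i)"
  for v :: "nat \<Rightarrow> complex ^ 'n"
  by (simp add: specmat_def sum_matrix_vec_mult scaleR_matrix_vec_mult ketbra_mult_vec)

lemma onfam_sum:
  assumes "onfam k v" "j < k"
  shows "(\<Sum>i<k. (f i * cinner (v i) (v j)) *s v i) = f j *s v j"
proof -
  have "(\<Sum>i<k. (f i * cinner (v i) (v j)) *s v i) = (\<Sum>i<k. if i = j then f i *s v i else 0)"
    by (rule sum.cong) (use assms in \<open>auto simp: onfam_def\<close>)
  then show ?thesis using assms(2) by simp
qed

lemma specmat_eigenvector:
  fixes v :: "nat \<Rightarrow> complex ^ 'n"
  assumes "onfam CARD('n) v" "j < CARD('n)"
  shows "specmat v l *v v j = complex_of_real (l j) *s v j"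
  unfolding specmat_mult_vec by (rule onfam_sum[OF assms])

lemma matrix_eq_on_onfam:
  fixes A B :: "complex ^ 'n ^ 'n"
  assumes v: "onfam CARD('n) v" and eq: "\<And>j. j < CARD('n) \<Longrightarrow> A *v v j = B *v v j"
  shows "A = B"
proof (rule matrix_eq_if_vec)
  fix x
  have "C *v x = (\<Sum>i<CARD('n). cinner (v i) x *s (C *v v i))" for C :: "complex ^ 'n ^ 'n"
    by (subst (1) onfam_expand[OF v, symmetric]) (simp add: matrix_vec_mult_sum vec.scale)
  then show "A *v x = B *v x" using eq by simp
qed

lemma eigbasis_eq_specmat:
  fixes A :: "complex ^ 'n ^ 'n"
  assumes "eigbasis A v l"
  shows "A = specmat v l"
  by (rule matrix_eq_on_onfam[of v])
    (use assms in \<open>auto simp: eigbasis_def specmat_eigenvector\<close>)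

lemma cinner_specmat:
  fixes v :: "nat \<Rightarrow> complex ^ 'n"
  shows "cinner x (specmat v l *v x) = complex_of_real (\<Sum>i<CARD('n). l i * (cmod (cinner (v i) x))\<^sup>2)"
proof -
  have "cinner x (specmat v l *v x)
      = (\<Sum>i<CARD('n). complex_of_real (l i * (cmod (cinner (v i) x))\<^sup>2))"
    unfolding specmat_mult_vec cinner_sum_right
    by (rule sum.cong[OF refl])
      (simp add: cinner_commute[of x] complex_norm_square del: of_real_power)
  then show ?thesis by simp
qed

lemma psd_specmat:
  assumes "\<And>i. i < CARD('n) \<Longrightarrow> 0 \<le> l i"
  shows "psd (specmat (v :: nat \<Rightarrow> complex ^ 'n) l)"
proof -
  have "0 \<le> Re (cinner x (specmat v l *v x))" for x
    using assms by (auto simp: cinner_specmat intro!: sum_nonneg)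
  moreover have "adjoint_mat (specmat v l) = specmat v l"
    by (simp add: specmat_def adjoint_sum adjoint_scaleR adjoint_ketbra)
  ultimately show ?thesis by (simp add: psd_def)
qed

lemma eigbasis_nonneg:
  fixes A :: "complex ^ 'n ^ 'n"
  assumes "eigbasis A v l" "psd A" "i < CARD('n)"
  shows "0 \<le> l i"
proof -
  have "cinner (v i) (A *v v i) = complex_of_real (l i)"
    using assms by (simp add: eigbasis_def onfam_def)
  then show ?thesis using assms(2) by (metis Re_complex_of_real psd_def)
qed

lemma mat_power_Suc: "mat_power A (Suc k) = A ** mat_power A k"
  by (simp add: mat_power_def)

lemma mat_power_eigenvector:
  assumes "A *v x = c *s x"
  shows "mat_power A k *v x = c ^ k *s x"
proof (induction k)
  case 0
  then show ?case by (simp add: mat_power_def)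
next
  case (Suc k)
  then show ?case
    using assms by (simp add: mat_power_Suc vec.scale mult.commute flip: matrix_vector_mul_assoc)
qed

lemma mat_power_specmat:
  fixes v :: "nat \<Rightarrow> complex ^ 'n"
  assumes "onfam CARD('n) v"
  shows "mat_power (specmat v l) k = specmat v (\<lambda>i. l i ^ k)"
  by (rule matrix_eq_on_onfam[OF assms])
    (simp add: mat_power_eigenvector[OF specmat_eigenvector[OF assms]] specmat_eigenvector[OF assms])

text \<open>The description by \<open>THE\<close> requires uniqueness: an eigenvector of
  \<open>A\<close> can have components only along those eigenvectors of a root \<open>B\<close>
  whose eigenvalue has the right \<open>k\<close>-th power, and a nonnegative number is determined
  by its \<open>k\<close>-th power.\<close>

lemma psd_root_eq:
  fixes A :: "complex ^ 'n ^ 'n"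
  assumes A: "psd A" and eb: "eigbasis A v l" and k: "k > 0"
  shows "psd_root k A = specmat v (\<lambda>i. root k (l i))"
  unfolding psd_root_def
proof (rule the_equality)
  have on: "onfam CARD('n) v" using eb by (simp add: eigbasis_def)
  have nn: "0 \<le> l i" if "i < CARD('n)" for i using eigbasis_nonneg[OF eb A that] .
  have "specmat v (\<lambda>i. root k (l i) ^ k) = specmat v l"
    unfolding specmat_def by (rule sum.cong) (use nn k in auto)
  then show "psd (specmat v (\<lambda>i. root k (l i))) \<and> mat_power (specmat v (\<lambda>i. root k (l i))) k = A"
    using nn k eigbasis_eq_specmat[OF eb] by (auto simp: mat_power_specmat[OF on] intro!: psd_specmat)
  fix B assume B: "psd B \<and> mat_power B k = A"
  then obtain w m where wm: "eigbasis B w m" using eigbasis_exists by (metis psd_def)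
  have onw: "onfam CARD('n) w" using wm by (simp add: eigbasis_def)
  have m0: "0 \<le> m i" if "i < CARD('n)" for i using eigbasis_nonneg[OF wm _ that] B by simp
  have Aw: "A = specmat w (\<lambda>i. m i ^ k)"
    using B eigbasis_eq_specmat[OF wm] mat_power_specmat[OF onw] by metis
  show "B = specmat v (\<lambda>i. root k (l i))"
  proof (rule matrix_eq_on_onfam[OF on])
    fix j assume j: "j < CARD('n)"
    define c where "c i = cinner (w i) (v j)" for i
    have c: "complex_of_real (m i) * c i = complex_of_real (root k (l j)) * c i" if i: "i < CARD('n)" for i
    proof -
      have Ai: "A *v w i = complex_of_real (m i ^ k) *s w i"
        using i by (subst Aw) (rule specmat_eigenvector[OF onw])
      have "cinner (A *v w i) (v j) = cinner (w i) (A *v v j)"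
        using A by (metis cinner_adjoint psd_def)
      then have "complex_of_real (m i ^ k) * c i = complex_of_real (l j) * c i"
        using eb j by (simp add: Ai eigbasis_def c_def)
      then have "c i = 0 \<or> m i ^ k = l j" by (metis mult_cancel_right of_real_eq_iff)
      then show ?thesis using real_root_power_cancel[OF k m0[OF i]] by auto
    qed
    have "B *v v j = (\<Sum>i<CARD('n). (complex_of_real (m i) * c i) *s w i)"
      by (subst eigbasis_eq_specmat[OF wm]) (simp add: specmat_mult_vec c_def)
    also have "\<dots> = complex_of_real (root k (l j)) *s (\<Sum>i<CARD('n). c i *s w i)"
      unfolding vec.scale_sum_right vec.scale_scale by (rule sum.cong) (simp_all add: c)
    also have "\<dots> = complex_of_real (root k (l j)) *s v j"
      unfolding c_def by (simp add: onfam_expand[OF onw])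
    also have "\<dots> = specmat v (\<lambda>i. root k (l i)) *v v j"
      by (simp add: specmat_eigenvector[OF on j])
    finally show "B *v v j = specmat v (\<lambda>i. root k (l i)) *v v j" .
  qed
qed

section \<open>Characteristic polynomials, their limits and the multiplicity of the top
  exponent\<close>

lemma poly_charpoly: "poly (charpoly A) z = det (mat z - A)"
proof -
  have *: "poly (mat [:0, 1:] $ i $ j) z = mat z $ i $ j" for i j :: 'a
    by (simp add: mat_def)
  have "poly (of_int (sign p)) z = of_int (sign p)" for p :: "'a \<Rightarrow> 'a"
    by (simp add: sign_def)
  then show ?thesis
    unfolding charpoly_def det_def by (simp add: poly_sum poly_prod *)
qed

lemma eigenvalues_eq_roots: "eigenvalues A = {z. poly (charpoly A) z = 0}"
proof -
  have "(\<exists>x. x \<noteq> 0 \<and> A *v x = z *s x) \<longleftrightarrow> det (mat z - A) = 0" for z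
  proof -
    have "det (mat z - A) = 0 \<longleftrightarrow> \<not> (\<forall>x. (mat z - A) *v x = 0 \<longrightarrow> x = 0)"
      by (simp flip: matrix_left_invertible_ker add: invertible_left_inverse[symmetric] invertible_det_nz)
    then show ?thesis by (auto simp: matrix_vector_mult_diff_rdistrib mat_mult_vec)
  qed
  then show ?thesis by (simp add: eigenvalues_def poly_charpoly)
qed

definition diagmat :: "('n \<Rightarrow> complex) \<Rightarrow> complex ^ 'n ^ 'n" where
  "diagmat c = (\<chi> i k. if i = k then c k else 0)"

lemma onfam_diagonalization:
  fixes v :: "nat \<Rightarrow> complex ^ 'n"
  assumes on: "onfam CARD('n) v"
  obtains f :: "'n \<Rightarrow> nat" and V where "bij_betw f UNIV {..<CARD('n)}"
    "adjoint_mat V ** V = mat 1" "V ** adjoint_mat V = mat 1"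
    "\<And>l. specmat v l ** V = V ** diagmat (\<lambda>k. complex_of_real (l (f k)))"
proof -
  obtain f :: "'n \<Rightarrow> nat" and V where f: "bij_betw f UNIV {..<CARD('n)}"
    and VV: "adjoint_mat V ** V = mat 1" "V ** adjoint_mat V = mat 1"
    and col: "\<And>k. column k V = v (f k)"
    using onfam_unitary[OF on] by metis
  have "(specmat v l ** V) $ i $ k = (V ** diagmat (\<lambda>k. complex_of_real (l (f k)))) $ i $ k" for l i k
  proof -
    have "f k < CARD('n)" using f by (auto simp: bij_betw_def)
    have "(specmat v l ** V) $ i $ k = (specmat v l *v column k V) $ i"
      by (simp add: matrix_matrix_mult_def matrix_vector_mult_def column_def)
    also have "\<dots> = complex_of_real (l (f k)) * column k V $ i"
      using \<open>f k < CARD('n)\<close> by (simp add: col specmat_eigenvector[OF on])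
    also have "\<dots> = (V ** diagmat (\<lambda>k. complex_of_real (l (f k)))) $ i $ k"
      by (simp add: matrix_matrix_mult_def column_def diagmat_def if_distrib[where f="\<lambda>t. _ * t"] cong: if_cong)
    finally show ?thesis .
  qed
  then show ?thesis by (intro that[OF f VV]) (simp add: vec_eq_iff)
qed

lemma matrix_diff_mult: "(A - B) ** C = A ** C - B ** C" for A :: "complex ^ 'n ^ 'm"
  by (simp add: vec_eq_iff matrix_matrix_mult_def algebra_simps sum_subtractf)

lemma matrix_mult_diff: "C ** (A - B) = C ** A - C ** B" for A :: "complex ^ 'n ^ 'm"
  by (simp add: vec_eq_iff matrix_matrix_mult_def algebra_simps sum_subtractf)

lemma det_mat_minus_specmat:
  fixes v :: "nat \<Rightarrow> complex ^ 'n"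
  assumes on: "onfam CARD('n) v"
  shows "det (mat z - specmat v l) = (\<Prod>i<CARD('n). z - complex_of_real (l i))"
proof -
  obtain f :: "'n \<Rightarrow> nat" and V where f: "bij_betw f UNIV {..<CARD('n)}"
    and VV: "adjoint_mat V ** V = mat 1"
    and V: "\<And>l. specmat v l ** V = V ** diagmat (\<lambda>k. complex_of_real (l (f k)))"
    using onfam_diagonalization[OF on] by metis
  define D where "D = diagmat (\<lambda>k. z - complex_of_real (l (f k)))"
  have D: "D = mat z - diagmat (\<lambda>k. complex_of_real (l (f k)))"
    by (simp add: D_def vec_eq_iff mat_def diagmat_def)
  have "mat z ** V = V ** mat z"
    by (simp add: vec_eq_iff matrix_matrix_mult_def mat_def mult.commute
        if_distrib[where f="\<lambda>t. _ * t"] cong: if_cong)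
  then have "(mat z - specmat v l) ** V = V ** D"
    unfolding D by (simp add: V matrix_diff_mult matrix_mult_diff)
  moreover have "det V \<noteq> 0" using VV by (metis det_I det_mul mult_zero_right zero_neq_one)
  ultimately have "det (mat z - specmat v l) = det D"
    by (metis det_mul mult.commute mult_left_cancel)
  also have "det D = (\<Prod>k\<in>UNIV. D $ k $ k)"
    by (rule det_diagonal) (simp add: D_def diagmat_def)
  also have "\<dots> = (\<Prod>k\<in>UNIV. z - complex_of_real (l (f k)))" by (simp add: D_def diagmat_def)
  also have "\<dots> = (\<Prod>i<CARD('n). z - complex_of_real (l i))"
    by (rule prod.reindex_bij_betw[OF f])
  finally show ?thesis .
qed

lemma tendsto_det:
  fixes F :: "nat \<Rightarrow> complex ^ 'n ^ 'n"
  assumes "F \<longlonglongrightarrow> L"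
  shows "(\<lambda>n. det (F n)) \<longlonglongrightarrow> det L"
  unfolding det_def by (intro tendsto_intros assms)

text \<open>The bases \<open>v n\<close> need not converge. The determinant is continuous and
  forgets the basis, so the limits of the eigenvalues are the eigenvalues of the limit, with
  multiplicity.\<close>

lemma charpoly_limit:
  fixes L :: "complex ^ 'n ^ 'n"
  assumes lim: "(\<lambda>n. specmat (v n) (l n)) \<longlonglongrightarrow> L"
    and on: "\<And>n. onfam CARD('n) (v n)"
    and t: "\<And>i. i < CARD('n) \<Longrightarrow> (\<lambda>n. l n i) \<longlonglongrightarrow> t i"
  shows "charpoly L = (\<Prod>i<CARD('n). [:- complex_of_real (t i), 1:])"
proof -
  have "poly (charpoly L) z = poly (\<Prod>i<CARD('n). [:- complex_of_real (t i), 1:]) z" for z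
  proof -
    have "(\<lambda>n. det (mat z - specmat (v n) (l n))) \<longlonglongrightarrow> det (mat z - L)"
      by (intro tendsto_det tendsto_intros lim)
    moreover have "(\<lambda>n. \<Prod>i<CARD('n). z - complex_of_real (l n i)) \<longlonglongrightarrow> (\<Prod>i<CARD('n). z - complex_of_real (t i))"
      by (intro tendsto_intros t) auto
    ultimately have "det (mat z - L) = (\<Prod>i<CARD('n). z - complex_of_real (t i))"
      using on by (simp add: det_mat_minus_specmat LIMSEQ_unique)
    then show ?thesis by (simp add: poly_charpoly poly_prod)
  qed
  then show ?thesis by (simp flip: poly_eq_poly_eq_iff add: fun_eq_iff)
qed

lemma simple_top_exponent:
  fixes L :: "complex ^ 'n ^ 'n"
  assumes cp: "charpoly L = (\<Prod>i<CARD('n). [:- complex_of_real (t i), 1:])"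
    and t0: "t 0 = 1" and t: "\<And>i. 0 < i \<Longrightarrow> i < CARD('n) \<Longrightarrow> t i < 1"
  shows "lyapunov_multiplicity L (top_lyapunov_exponent L) = 1"
proof -
  have d: "0 < CARD('n)" by simp
  have "eigenvalues L = (\<lambda>i. complex_of_real (t i)) ` {..<CARD('n)}"
    by (auto simp: eigenvalues_eq_roots cp poly_prod)
  then have "{r. complex_of_real r \<in> eigenvalues L} = t ` {..<CARD('n)}"
    by auto
  moreover have "Max (t ` {..<CARD('n)}) = 1"
  proof (rule Max_eqI)
    show "y \<le> 1" if "y \<in> t ` {..<CARD('n)}" for y
      using that t t0 by (metis imageE lessThan_iff less_imp_le neq0_conv order_refl)
    show "1 \<in> t ` {..<CARD('n)}" using t0 d by (metis imageI lessThan_iff)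
  qed simp
  \<comment> \<open>The exponent is \<open>ln 1\<close>, so the multiplicity in question is the
    order of the root 1; only the factor with index 0 vanishes there.\<close>
  ultimately have "top_lyapunov_exponent L = 0"
    by (simp add: top_lyapunov_exponent_def zero_ereal_def)
  then have "lyapunov_multiplicity L (top_lyapunov_exponent L) = order 1 (charpoly L)"
    by (simp add: lyapunov_multiplicity_def alg_mult_def)
  also have "charpoly L = (\<Prod>i<CARD('n). [:- complex_of_real (t i), 1:])" by (rule cp)
  also have "{..<CARD('n)} = insert 0 {1..<CARD('n)}" using d by auto
  also have "(\<Prod>i\<in>insert 0 {1..<CARD('n)}. [:- complex_of_real (t i), 1:])
      = [:-1, 1:] * (\<Prod>i\<in>{1..<CARD('n)}. [:- complex_of_real (t i), 1:])" (is "_ = _ * ?q")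
    by (simp add: t0)
  also have "order 1 ([:-1, 1:] * ?q) = order 1 [:-1, 1::complex:] + order 1 ?q"
  proof (rule order_mult)
    have "?q \<noteq> 0" by simp
    then show "[:-1, 1:] * ?q \<noteq> 0" by (simp only: mult_eq_0_iff) simp
  qed
  also have "order 1 [:-1, 1::complex:] = 1" using order_power_n_n[of "1::complex" 1] by simp
  also have "order 1 ?q = 0"
  proof (rule order_0I)
    have "t i \<noteq> 1" if "i \<in> {1..<CARD('n)}" for i using t[of i] that by auto
    then show "poly ?q 1 \<noteq> 0" by (auto simp: poly_prod)
  qed
  finally show ?thesis by simp
qed


section \<open>Convergence of the Lyapunov matrices\<close>

definition projmat :: "(nat \<Rightarrow> complex ^ 'n) \<Rightarrow> nat \<Rightarrow> complex ^ 'n ^ 'n" where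
  "projmat v j = (\<Sum>i<j. ketbra (v i) (v i))"

lemma inner_ketbra: "ketbra a a \<bullet> ketbra b b = (cmod (cinner a b))\<^sup>2"
proof -
  have "ketbra a a \<bullet> ketbra b b =
      (\<Sum>i\<in>UNIV. \<Sum>j\<in>UNIV. Re (cnj (a $ i) * b $ i * cnj (cnj (a $ j) * b $ j)))"
    by (simp add: inner_vec_def ketbra_nth inner_complex_def algebra_simps)
  also have "\<dots> = Re (cinner a b * cnj (cinner a b))"
    by (simp only: cinner_def sum_product cnj_sum Re_sum)
  also have "\<dots> = (cmod (cinner a b))\<^sup>2"
    by (metis Re_complex_of_real complex_norm_square)
  finally show ?thesis .
qed

text \<open>In the Frobenius norm both projections have square norm \<open>j\<close>, and Parseval
  expresses the defect of their inner product through overlaps of leading vectors of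
  \<open>w\<close> with trailing vectors of \<open>u\<close>. These are the overlaps that a gap
  makes small.\<close>

lemma norm_projmat_diff:
  fixes u w :: "nat \<Rightarrow> complex ^ 'n"
  assumes u: "onfam CARD('n) u" and w: "onfam CARD('n) w" and j: "j \<le> CARD('n)"
  shows "(norm (projmat w j - projmat u j))\<^sup>2
    = 2 * (\<Sum>k<j. \<Sum>i\<in>{j..<CARD('n)}. (cmod (cinner (u i) (w k)))\<^sup>2)"
proof -
  have inner: "projmat u j \<bullet> projmat w j = (\<Sum>k<j. \<Sum>i<j. (cmod (cinner (u i) (w k)))\<^sup>2)"
    for u w :: "nat \<Rightarrow> complex ^ 'n"
    unfolding projmat_def by (simp add: inner_sum_left inner_sum_right inner_ketbra)
  have self: "projmat u j \<bullet> projmat u j = j" if "onfam CARD('n) u" for u :: "nat \<Rightarrow> complex ^ 'n"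
  proof -
    have "(\<Sum>i<j. (cmod (cinner (u i) (u k)))\<^sup>2) = 1" if "k < j" for k
    proof -
      have "(\<Sum>i<j. (cmod (cinner (u i) (u k)))\<^sup>2) = (\<Sum>i<j. if i = k then 1 else 0)"
        by (rule sum.cong) (use j that \<open>onfam CARD('n) u\<close> in \<open>auto simp: onfam_def\<close>)
      then show ?thesis using that by simp
    qed
    then show ?thesis by (simp add: inner)
  qed
  have "(\<Sum>i<j. (cmod (cinner (u i) (w k)))\<^sup>2)
      = 1 - (\<Sum>i\<in>{j..<CARD('n)}. (cmod (cinner (u i) (w k)))\<^sup>2)" if "k < j" for k
  proof -
    have "cinner (w k) (w k) = 1" using w j that by (simp add: onfam_def)
    then have "(norm (w k))\<^sup>2 = 1" by (metis cinner_self of_real_eq_1_iff)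
    moreover have "(\<Sum>i<CARD('n). (cmod (cinner (u i) (w k)))\<^sup>2) = (\<Sum>i<j. (cmod (cinner (u i) (w k)))\<^sup>2)
        + (\<Sum>i\<in>{j..<CARD('n)}. (cmod (cinner (u i) (w k)))\<^sup>2)"
      using j by (subst sum.union_disjoint[symmetric]) (auto intro: sum.cong)
    ultimately show ?thesis using onfam_parseval[OF u, of "w k"] by simp
  qed
  then have uw: "projmat u j \<bullet> projmat w j
      = j - (\<Sum>k<j. \<Sum>i\<in>{j..<CARD('n)}. (cmod (cinner (u i) (w k)))\<^sup>2)"
    by (simp add: inner sum_subtractf)
  have "(norm (projmat w j - projmat u j))\<^sup>2
      = projmat w j \<bullet> projmat w j + projmat u j \<bullet> projmat u j - 2 * (projmat u j \<bullet> projmat w j)"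
    by (simp add: power2_norm_eq_inner inner_diff_left inner_diff_right inner_commute)
  then show ?thesis by (simp add: self[OF u] self[OF w] uw)
qed

text \<open>Summation by parts: a projection whose index is not at a gap of \<open>t\<close> gets
  coefficient zero, so its behaviour is irrelevant.\<close>

lemma sum_telescope_projmat:
  "(\<Sum>i<m. t i *\<^sub>R ketbra (v i) (v i)) = (\<Sum>i<m. (t i - t (Suc i)) *\<^sub>R projmat v (Suc i)) + t m *\<^sub>R projmat v m"
  for t :: "nat \<Rightarrow> real"
proof (induction m)
  case (Suc m)
  then show ?case by (simp add: projmat_def algebra_simps)
qed (simp add: projmat_def)

lemma projmat_full:
  fixes v :: "nat \<Rightarrow> complex ^ 'n"
  assumes "onfam CARD('n) v"
  shows "projmat v CARD('n) = mat 1"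
  by (rule matrix_eq_if_vec)
    (simp add: projmat_def sum_matrix_vec_mult ketbra_mult_vec onfam_expand[OF assms])

lemma convergent_if_summable_steps:
  fixes f :: "nat \<Rightarrow> 'a :: banach"
  assumes "summable (\<lambda>n. norm (f (Suc n) - f n))"
  shows "convergent f"
proof -
  have "summable (\<lambda>n. f (Suc n) - f n)" using assms by (rule summable_norm_cancel)
  then have "convergent (\<lambda>n. f n - f 0)"
    by (simp add: summable_iff_convergent sum_lessThan_telescope)
  then have "convergent (\<lambda>n. f n - f 0 + f 0)" by (intro convergent_add convergent_const)
  then show ?thesis by simp
qed

lemma root_double: "n > 0 \<Longrightarrow> root (2 * n) x = root n (sqrt x)"
  by (simp add: sqrt_def real_root_mult_exp mult.commute)

lemma root_less_iff_sqrt_less_power: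
  assumes "n > 0" "0 \<le> s" "0 < b"
  shows "root (2 * n) s < b \<longleftrightarrow> sqrt s < b ^ n"
proof -
  have "root (2 * n) s = root n (sqrt s)" using assms(1) by (rule root_double)
  then have "root (2 * n) s < b \<longleftrightarrow> root n (sqrt s) < root n (b ^ n)" using assms by (simp add: real_root_power_cancel)
  also have "\<dots> \<longleftrightarrow> sqrt s < b ^ n" using assms by (simp add: real_root_less_iff)
  finally show ?thesis .
qed

lemma less_root_iff_power_less_sqrt:
  assumes "n > 0" "0 \<le> s" "0 < b"
  shows "b < root (2 * n) s \<longleftrightarrow> b ^ n < sqrt s"
proof -
  have "root (2 * n) s = root n (sqrt s)" using assms(1) by (rule root_double)
  then have "b < root (2 * n) s \<longleftrightarrow> root n (b ^ n) < root n (sqrt s)" using assms by (simp add: real_root_power_cancel)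
  also have "\<dots> \<longleftrightarrow> b ^ n < sqrt s" using assms by (simp add: real_root_less_iff)
  finally show ?thesis .
qed

text \<open>\<open>sv n i\<close> is the square of a singular value of \<open>\<Phi> n\<close>,
  hence \<open>root (2 * n)\<close> in growth rates. No relation between the bases for different
  \<open>n\<close> is imposed.\<close>

locale singular_decomposition =
  fixes \<Phi> :: "nat \<Rightarrow> complex ^ 'n ^ 'n" and K :: real
    and v :: "nat \<Rightarrow> nat \<Rightarrow> complex ^ 'n" and sv :: "nat \<Rightarrow> nat \<Rightarrow> real"
  assumes step: "\<And>n x. norm (\<Phi> (Suc n) *v x) \<le> K * norm (\<Phi> n *v x)"
    and K_pos: "K > 0"
    and eb: "\<And>n. eigbasis (adjoint_mat (\<Phi> n) ** \<Phi> n) (v n) (sv n)"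
begin

lemma on: "onfam CARD('n) (v n)"
  using eb by (simp add: eigbasis_def)

lemma eigenvector: "i < CARD('n) \<Longrightarrow> adjoint_mat (\<Phi> n) *v (\<Phi> n *v v n i) = complex_of_real (sv n i) *s v n i"
  using eb by (simp add: eigbasis_def matrix_vector_mul_assoc)

lemma decreasing: "i \<le> j \<Longrightarrow> j < CARD('n) \<Longrightarrow> sv n j \<le> sv n i"
  using eb by (simp add: eigbasis_def)

lemma nonneg: "i < CARD('n) \<Longrightarrow> 0 \<le> sv n i"
  using eigbasis_nonneg[OF eb psd_adjoint_mult] .

lemma norm_image: "i < CARD('n) \<Longrightarrow> norm (\<Phi> n *v v n i) = sqrt (sv n i)"
proof -
  assume i: "i < CARD('n)"
  have "complex_of_real ((norm (\<Phi> n *v v n i))\<^sup>2) = cinner (v n i) (adjoint_mat (\<Phi> n) *v (\<Phi> n *v v n i))"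
    by (simp add: cinner_adjoint_right cinner_self)
  also have "\<dots> = complex_of_real (sv n i)" using i on by (simp add: eigenvector onfam_def)
  finally have "(norm (\<Phi> n *v v n i))\<^sup>2 = sv n i" using of_real_eq_iff by blast
  then show ?thesis by (metis norm_ge_zero real_sqrt_unique)
qed

text \<open>Evaluate the form of \<open>\<Phi> (Suc n)\<close> on the two vectors. The eigenvector
  equation gives the overlap times \<open>sv (Suc n) k\<close>; Cauchy--Schwarz gives the product of
  the image norms, and one step enlarges the image of \<open>v n i\<close> by at most
  \<open>K\<close>.\<close>

lemma overlap:
  assumes i: "i < CARD('n)" and k: "k < CARD('n)"
  shows "cmod (cinner (v n i) (v (Suc n) k)) * sqrt (sv (Suc n) k) \<le> K * sqrt (sv n i)"
proof (cases "sv (Suc n) k = 0")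
  case False
  then have pos: "sv (Suc n) k > 0" using nonneg[OF k, of "Suc n"] by simp
  define c where "c = cinner (v n i) (v (Suc n) k)"
  have "cmod c * sv (Suc n) k = cmod (complex_of_real (sv (Suc n) k) * c)"
    using pos by (simp add: norm_mult)
  also have "complex_of_real (sv (Suc n) k) * c
      = cinner (v n i) (adjoint_mat (\<Phi> (Suc n)) *v (\<Phi> (Suc n) *v v (Suc n) k))"
    by (simp add: eigenvector[OF k] c_def)
  also have "\<dots> = cinner (\<Phi> (Suc n) *v v n i) (\<Phi> (Suc n) *v v (Suc n) k)"
    by (rule cinner_adjoint_right)
  also have "cmod \<dots> \<le> norm (\<Phi> (Suc n) *v v n i) * sqrt (sv (Suc n) k)"
    using norm_cinner_le norm_image[OF k] by metis
  also have "\<dots> \<le> (K * sqrt (sv n i)) * sqrt (sv (Suc n) k)"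
    using step[of n "v n i"] nonneg[OF k] norm_image[OF i] by (intro mult_right_mono) auto
  finally have "(cmod c * sqrt (sv (Suc n) k)) * sqrt (sv (Suc n) k) \<le> (K * sqrt (sv n i)) * sqrt (sv (Suc n) k)"
    using pos by (simp add: mult.assoc)
  then show ?thesis using pos unfolding c_def by (simp add: mult_le_cancel_right)
qed (use K_pos nonneg[OF i, of n] in simp)

end

locale singular_growth = singular_decomposition \<Phi> K v sv
  for \<Phi> :: "nat \<Rightarrow> complex ^ 'n ^ 'n" and K v sv +
  fixes t :: "nat \<Rightarrow> real"
  assumes growth: "\<And>i. i < CARD('n) \<Longrightarrow> (\<lambda>n. root (2 * n) (sv n i)) \<longlonglongrightarrow> t i"
begin

lemma t_nonneg: "i < CARD('n) \<Longrightarrow> 0 \<le> t i"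
  by (rule LIMSEQ_le_const[OF growth]) (auto intro!: real_root_ge_zero exI[of _ 0] nonneg)

lemma convergent_projmat:
  assumes j: "Suc j < CARD('n)" and gap: "t (Suc j) < t j"
  shows "convergent (\<lambda>n. projmat (v n) (Suc j))"
proof (rule convergent_if_summable_steps)
  \<comment> \<open>\<open>b\<close> and \<open>a\<close> divide the gap into thirds. They separate
    the two growth rates, and \<open>b\<close> is positive even if the lower rate is zero.\<close>
  define b where "b = (2 * t (Suc j) + t j) / 3"
  define a where "a = (t (Suc j) + 2 * t j) / 3"
  have b: "0 < b" "t (Suc j) < b" "b < a" "a < t j"
    using gap t_nonneg[OF j] by (auto simp: a_def b_def)
  define Q where "Q n = projmat (v n) (Suc j)" for n
  \<comment> \<open>At most \<open>CARD('n)\<^sup>2\<close> overlaps occur, each at most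
    \<open>K / a * (b / a) ^ n\<close>. The extra \<open>1 / a\<close> comes from the large singular
    value being taken at time \<open>Suc n\<close>.\<close>
  define C where "C = sqrt (2 * (CARD('n) * CARD('n) * (K / a)\<^sup>2))"
  have e1: "\<forall>\<^sub>F n in sequentially. root (2 * n) (sv n (Suc j)) < b"
    using order_tendstoD(2)[OF growth b(2)] j by auto
  have e2': "\<forall>\<^sub>F n in sequentially. a < root (2 * n) (sv n j)"
    using order_tendstoD(1)[OF growth b(4)] j by auto
  have e2: "\<forall>\<^sub>F n in sequentially. a < root (2 * Suc n) (sv (Suc n) j)"
    using e2' by (rule eventually_sequentially_Suc[THEN iffD2])
  have "\<forall>\<^sub>F n in sequentially. norm (norm (Q (Suc n) - Q n)) \<le> C * (b / a) ^ n"
    using e1 e2 eventually_gt_at_top[of 0]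
  proof eventually_elim
    case (elim n)
    have s1: "sqrt (sv n i) \<le> b ^ n" if "i \<in> {Suc j..<CARD('n)}" for i
    proof -
      have "sqrt (sv n i) \<le> sqrt (sv n (Suc j))" using decreasing[of "Suc j" i n] that by simp
      also have "\<dots> < b ^ n" using elim b root_less_iff_sqrt_less_power[of n "sv n (Suc j)" b] nonneg[OF j] by simp
      finally show ?thesis by simp
    qed
    have s2: "a ^ Suc n \<le> sqrt (sv (Suc n) k)" if "k < Suc j" for k
    proof -
      have "a ^ Suc n < sqrt (sv (Suc n) j)"
        using elim b less_root_iff_power_less_sqrt[of "Suc n" "sv (Suc n) j" a] nonneg[of j] j by simp
      also have "\<dots> \<le> sqrt (sv (Suc n) k)" using decreasing[of k j "Suc n"] that j by simp
      finally show ?thesis by simp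
    qed
    have ov: "(cmod (cinner (v n i) (v (Suc n) k)))\<^sup>2 \<le> (K / a * (b / a) ^ n)\<^sup>2"
      if "k < Suc j" "i \<in> {Suc j..<CARD('n)}" for i k
    proof (rule power_mono)
      have "cmod (cinner (v n i) (v (Suc n) k)) * a ^ Suc n
          \<le> cmod (cinner (v n i) (v (Suc n) k)) * sqrt (sv (Suc n) k)"
        using s2[OF that(1)] by (intro mult_left_mono) auto
      also have "\<dots> \<le> K * sqrt (sv n i)" by (rule overlap) (use that j in auto)
      also have "\<dots> \<le> K * b ^ n" using s1[OF that(2)] K_pos by (intro mult_left_mono) auto
      finally show "cmod (cinner (v n i) (v (Suc n) k)) \<le> K / a * (b / a) ^ n"
        using b by (simp add: field_simps)
    qed simp
    have "(norm (Q (Suc n) - Q n))\<^sup>2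
        = 2 * (\<Sum>k<Suc j. \<Sum>i\<in>{Suc j..<CARD('n)}. (cmod (cinner (v n i) (v (Suc n) k)))\<^sup>2)"
      unfolding Q_def by (rule norm_projmat_diff) (use on j in auto)
    also have "\<dots> \<le> 2 * (\<Sum>k<Suc j. \<Sum>i\<in>{Suc j..<CARD('n)}. (K / a * (b / a) ^ n)\<^sup>2)"
      by (intro mult_left_mono sum_mono ov) auto
    also have "\<dots> = 2 * (real (Suc j) * (real (CARD('n) - Suc j) * (K / a * (b / a) ^ n)\<^sup>2))" by simp
    also have "\<dots> \<le> 2 * (real CARD('n) * (real CARD('n) * (K / a * (b / a) ^ n)\<^sup>2))"
      by (intro mult_left_mono mult_mono) (use j in auto)
    also have "\<dots> = (C * (b / a) ^ n)\<^sup>2"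
      unfolding power_mult_distrib by (simp add: C_def)
    finally have "norm (Q (Suc n) - Q n) \<le> C * (b / a) ^ n"
      by (rule power2_le_imp_le) (use b K_pos in \<open>simp add: C_def\<close>)
    then show ?case by simp
  qed
  moreover have "summable (\<lambda>n. C * (b / a) ^ n)"
    using b by (intro summable_mult summable_geometric) simp
  ultimately show "summable (\<lambda>n. norm (projmat (v (Suc n)) (Suc j) - projmat (v n) (Suc j)))"
    unfolding Q_def by (rule summable_comparison_test_ev)
qed

lemma lyapunov_seq_eq:
  "n > 0 \<Longrightarrow> lyapunov_seq \<Phi> n = specmat (v n) (\<lambda>i. root (2 * n) (sv n i))"
  unfolding lyapunov_seq_def by (rule psd_root_eq[OF psd_adjoint_mult eb]) simp

lemma convergent_specmat: "convergent (\<lambda>n. specmat (v n) (\<lambda>i. root (2 * n) (sv n i)))"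
proof -
  define d where "d = CARD('n)"
  \<comment> \<open>Extending by zero removes the boundary term of the summation by parts; the last
    weight \<open>s (d - 1)\<close> then multiplies the identity matrix.\<close>
  define s where "s i = (if i < d then t i else 0)" for i
  define P where "P n i = ketbra (v n i) (v n i)" for n i
  have "convergent (\<lambda>n. (s i - s (Suc i)) *\<^sub>R projmat (v n) (Suc i))" if i: "i < d" for i
  proof (cases "Suc i = d")
    case True
    then have "projmat (v n) (Suc i) = mat 1" for n using projmat_full[OF on] by (metis d_def)
    then show ?thesis by (simp add: convergent_const)
  next
    case False
    then have i': "Suc i < CARD('n)" using i by (simp add: d_def)
    have "t (Suc i) \<le> t i"
    proof (rule LIMSEQ_le[OF growth growth])
      show "\<exists>N. \<forall>n\<ge>N. root (2 * n) (sv n (Suc i)) \<le> root (2 * n) (sv n i)"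
        using decreasing[of i "Suc i"] i' by (intro exI[of _ 1]) (auto simp: real_root_le_iff)
    qed (use i' in auto)
    then consider "t (Suc i) < t i" | "t (Suc i) = t i" by linarith
    then show ?thesis
    proof cases
      case 1
      then obtain L where "(\<lambda>n. projmat (v n) (Suc i)) \<longlonglongrightarrow> L"
        using convergent_projmat[OF i'] by (auto simp: convergent_def)
      then have "(\<lambda>n. (s i - s (Suc i)) *\<^sub>R projmat (v n) (Suc i)) \<longlonglongrightarrow> (s i - s (Suc i)) *\<^sub>R L"
        by (intro tendsto_intros)
      then show ?thesis by (auto simp: convergent_def)
    next
      case 2
      then show ?thesis using i' by (simp add: s_def d_def convergent_const)
    qed
  qed
  then have "convergent (\<lambda>n. \<Sum>i<d. (s i - s (Suc i)) *\<^sub>R projmat (v n) (Suc i))"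
    by (intro convergent_sum) auto
  moreover have "(\<Sum>i<d. (s i - s (Suc i)) *\<^sub>R projmat (v n) (Suc i)) = (\<Sum>i<d. s i *\<^sub>R P n i)" for n
    unfolding P_def sum_telescope_projmat[of s] by (simp add: s_def)
  ultimately have c1: "convergent (\<lambda>n. \<Sum>i<d. s i *\<^sub>R P n i)" by simp
  \<comment> \<open>Replacing the eigenvalues by their limits costs a vanishing error, because the
    rank-one projections have norm 1 whether or not they converge.\<close>
  have "(\<lambda>n. \<Sum>i<d. (root (2 * n) (sv n i) - s i) *\<^sub>R P n i) \<longlonglongrightarrow> (\<Sum>i<d. 0)"
  proof (intro tendsto_sum)
    fix i assume "i \<in> {..<d}"
    then have i: "i < CARD('n)" by (simp add: d_def)
    have "P n i \<bullet> P n i = 1" for n using on[of n] i by (simp add: P_def inner_ketbra onfam_def)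
    then have "norm (P n i) = 1" for n by (simp add: norm_eq_1)
    then have nrm: "norm ((root (2 * n) (sv n i) - s i) *\<^sub>R P n i) = \<bar>root (2 * n) (sv n i) - s i\<bar>" for n
      by simp
    have "(\<lambda>n. root (2 * n) (sv n i) - s i) \<longlonglongrightarrow> 0"
      using growth[OF i] i by (simp add: s_def d_def LIM_zero)
    then have "(\<lambda>n. norm ((root (2 * n) (sv n i) - s i) *\<^sub>R P n i)) \<longlonglongrightarrow> 0"
      unfolding nrm by (rule tendsto_rabs_zero)
    then show "(\<lambda>n. (root (2 * n) (sv n i) - s i) *\<^sub>R P n i) \<longlonglongrightarrow> 0"
      by (rule tendsto_norm_zero_cancel)
  qed
  then have c2: "convergent (\<lambda>n. \<Sum>i<d. (root (2 * n) (sv n i) - s i) *\<^sub>R P n i)"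
    by (auto simp: convergent_def)
  have "specmat (v n) (\<lambda>i. root (2 * n) (sv n i))
      = (\<Sum>i<d. s i *\<^sub>R P n i) + (\<Sum>i<d. (root (2 * n) (sv n i) - s i) *\<^sub>R P n i)" for n
    unfolding specmat_def P_def d_def sum.distrib[symmetric] scaleR_left_distrib[symmetric] by simp
  then show ?thesis using convergent_add[OF c1 c2] by simp
qed

theorem lyapunov_limit:
  "convergent (lyapunov_seq \<Phi>)"
  "charpoly (lyapunov_matrix \<Phi>) = (\<Prod>i<CARD('n). [:- complex_of_real (t i), 1:])"
proof -
  obtain L where L: "(\<lambda>n. specmat (v n) (\<lambda>i. root (2 * n) (sv n i))) \<longlonglongrightarrow> L"
    using convergent_specmat by (auto simp: convergent_def)
  moreover have "\<forall>\<^sub>F n in sequentially. specmat (v n) (\<lambda>i. root (2 * n) (sv n i)) = lyapunov_seq \<Phi> n"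
    using eventually_gt_at_top[of 0] by eventually_elim (simp add: lyapunov_seq_eq)
  ultimately have lim: "lyapunov_seq \<Phi> \<longlonglongrightarrow> L" by (rule Lim_transform_eventually)
  then show "convergent (lyapunov_seq \<Phi>)" by (auto simp: convergent_def)
  have "charpoly L = (\<Prod>i<CARD('n). [:- complex_of_real (t i), 1:])"
    by (rule charpoly_limit[OF L on growth])
  then show "charpoly (lyapunov_matrix \<Phi>) = (\<Prod>i<CARD('n). [:- complex_of_real (t i), 1:])"
    using limI[OF lim] by (simp add: lyapunov_matrix_def)
qed

end


section \<open>Minors and products of singular values\<close>

text \<open>Minors with rows and columns selected by index functions, so that the Cauchy--Binet
  formula needs no ordering of the index type.\<close>

definition minor :: "nat \<Rightarrow> complex ^ 'n ^ 'n \<Rightarrow> (nat \<Rightarrow> 'n) \<Rightarrow> (nat \<Rightarrow> 'n) \<Rightarrow> complex" where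
  "minor q T f g = (\<Sum>p | p permutes {..<q}. of_int (sign p) * (\<Prod>i<q. T $ f i $ g (p i)))"

abbreviation idx :: "nat \<Rightarrow> (nat \<Rightarrow> 'n) set" where
  "idx q \<equiv> Pi\<^sub>E {..<q} (\<lambda>_. UNIV)"

lemma finite_idx [simp]: "finite (idx q :: (nat \<Rightarrow> 'n :: finite) set)"
  by (simp add: finite_PiE)

lemma permutes_lessThan_permutation: "p permutes {..<q} \<Longrightarrow> permutation p" for q :: nat
  by (rule permutes_imp_permutation) auto

lemma minor_permute:
  assumes p: "p permutes {..<q}"
  shows "minor q T (f \<circ> p) g = of_int (sign p) * minor q T f g"
proof -
  have ip: "inv p permutes {..<q}" by (rule permutes_inv[OF p])
  have "of_int (sign (r \<circ> p)) * (\<Prod>i<q. T $ (f \<circ> p) i $ g ((r \<circ> p) i))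
      = of_int (sign p) * (of_int (sign r) * (\<Prod>i<q. T $ f i $ g (r i)))"
    if r: "r permutes {..<q}" for r
  proof -
    have "(\<Prod>i<q. T $ (f \<circ> p) i $ g ((r \<circ> p) i)) = (\<Prod>i<q. T $ f i $ g (r i))"
      using prod.reindex_bij_betw[OF permutes_imp_bij[OF p], of "\<lambda>i. T $ f i $ g (r i)"] by simp
    moreover have "sign (r \<circ> p) = sign r * sign p"
      by (rule sign_compose[OF permutes_lessThan_permutation[OF r] permutes_lessThan_permutation[OF p]])
    ultimately show ?thesis by (simp add: mult_ac)
  qed
  then show ?thesis
    unfolding minor_def by (subst sum_permutations_compose_right[OF p]) (simp add: sum_distrib_left)
qed

lemma minor_eq_0:
  assumes "i < q" "j < q" "i \<noteq> j" "f i = f j"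
  shows "minor q T f g = 0"
proof -
  have "Transposition.transpose i j permutes {..<q}" using assms by (simp add: permutes_swap_id)
  moreover have "f \<circ> Transposition.transpose i j = f"
    using assms(4) by (auto simp: fun_eq_iff Transposition.transpose_def)
  ultimately have "minor q T f g = - minor q T f g"
    using minor_permute[of "Transposition.transpose i j" q T f g] assms(3) by (simp add: sign_swap_id)
  then show ?thesis by simp
qed

lemma minor_adjoint: "minor q (adjoint_mat T) f g = cnj (minor q T g f)"
proof -
  have "of_int (sign (inv p)) * (\<Prod>i<q. adjoint_mat T $ f i $ g (inv p i))
      = cnj (of_int (sign p) * (\<Prod>i<q. T $ g i $ f (p i)))" if p: "p permutes {..<q}" for p
  proof -
    have "(\<Prod>i<q. adjoint_mat T $ f i $ g (inv p i)) = (\<Prod>i<q. adjoint_mat T $ f (p i) $ g (inv p (p i)))"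
      by (rule prod.reindex_bij_betw[OF permutes_imp_bij[OF p], symmetric])
    also have "\<dots> = cnj (\<Prod>i<q. T $ g i $ f (p i))"
      by (simp add: adjoint_mat_def permutes_inverses(2)[OF p])
    finally show ?thesis
      using sign_inverse[OF permutes_lessThan_permutation[OF p]] by simp
  qed
  then show ?thesis
    unfolding minor_def by (subst sum_permutations_inverse) simp
qed

lemma minor_mult_expand:
  fixes T S :: "complex ^ 'n ^ 'n"
  shows "minor q (T ** S) f g = (\<Sum>h\<in>idx q. (\<Prod>i<q. T $ f i $ h i) * minor q S h g)"
proof -
  have "(\<Prod>i<q. (T ** S) $ f i $ g (p i)) = (\<Sum>h\<in>idx q. (\<Prod>i<q. T $ f i $ h i * S $ h i $ g (p i)))" for p
    by (simp add: matrix_matrix_mult_def prod_sum_PiE)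
  then have "minor q (T ** S) f g = (\<Sum>p | p permutes {..<q}. \<Sum>h\<in>idx q.
      of_int (sign p) * ((\<Prod>i<q. T $ f i $ h i) * (\<Prod>i<q. S $ h i $ g (p i))))"
    by (simp add: minor_def sum_distrib_left prod.distrib)
  also have "\<dots> = (\<Sum>h\<in>idx q. \<Sum>p | p permutes {..<q}.
      of_int (sign p) * ((\<Prod>i<q. T $ f i $ h i) * (\<Prod>i<q. S $ h i $ g (p i))))"
    by (rule sum.swap)
  also have "\<dots> = (\<Sum>h\<in>idx q. (\<Prod>i<q. T $ f i $ h i) * minor q S h g)"
    by (simp add: minor_def sum_distrib_left mult_ac)
  finally show ?thesis .
qed

text \<open>Summing over all index functions counts each set of \<open>q\<close> intermediate
  indices \<open>q!\<close> times, while repeated indices contribute zero. The proof reorders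
  \<open>h\<close> by each permutation \<open>p\<close>; the signed sum over \<open>p\<close>
  rebuilds the minor of \<open>T\<close>.\<close>

lemma minor_mult:
  fixes T S :: "complex ^ 'n ^ 'n"
  shows "fact q * minor q (T ** S) f g = (\<Sum>h\<in>idx q. minor q T f h * minor q S h g)"
proof -
  have eq: "minor q (T ** S) f g
      = (\<Sum>h\<in>idx q. of_int (sign p) * (\<Prod>i<q. T $ f i $ h (p i)) * minor q S h g)"
    if p: "p permutes {..<q}" for p
  proof -
    have "minor q (T ** S) f g = (\<Sum>h\<in>idx q. (\<Prod>i<q. T $ f i $ (h \<circ> p) i) * minor q S (h \<circ> p) g)"
      unfolding minor_mult_expand
    proof (rule sum.reindex_bij_witness[of _ "\<lambda>h. h \<circ> p" "\<lambda>h. h \<circ> inv p"])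
      have "h \<circ> r \<in> idx q" if "h \<in> idx q" "r permutes {..<q}" for h :: "nat \<Rightarrow> 'n" and r
        using that by (auto simp: PiE_iff extensional_def permutes_def)
      then show "h \<circ> p \<in> idx q" "h \<circ> inv p \<in> idx q" if "h \<in> idx q" for h :: "nat \<Rightarrow> 'n"
        using that p permutes_inv[OF p] by auto
    qed (auto simp: fun_eq_iff permutes_inverses[OF p] o_assoc[symmetric] permutes_inv_o[OF p])
    then show ?thesis
      by (simp add: minor_permute[OF p] mult_ac)
  qed
  have "fact q * minor q (T ** S) f g = (\<Sum>p | p permutes {..<q}. minor q (T ** S) f g)"
    using card_permutations[of "{..<q}" q] by simp
  also have "\<dots> = (\<Sum>p | p permutes {..<q}. \<Sum>h\<in>idx q.
      of_int (sign p) * (\<Prod>i<q. T $ f i $ h (p i)) * minor q S h g)"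
    by (intro sum.cong refl eq) simp
  also have "\<dots> = (\<Sum>h\<in>idx q. \<Sum>p | p permutes {..<q}.
      of_int (sign p) * (\<Prod>i<q. T $ f i $ h (p i)) * minor q S h g)"
    by (rule sum.swap)
  also have "\<dots> = (\<Sum>h\<in>idx q. minor q T f h * minor q S h g)"
    by (simp add: minor_def[of q T] sum_distrib_right)
  finally show ?thesis .
qed

text \<open>Up to constants this is the norm of the \<open>q\<close>-th exterior power of
  \<open>T\<close>. For \<open>q = 0\<close> there is one empty minor, and the value is 1.\<close>

definition minor_sum :: "nat \<Rightarrow> complex ^ 'n ^ 'n \<Rightarrow> real" where
  "minor_sum q T = (\<Sum>f\<in>idx q. \<Sum>g\<in>idx q. cmod (minor q T f g))"

lemma minor_sum_nonneg [simp]: "0 \<le> minor_sum q T"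
  unfolding minor_sum_def by (intro sum_nonneg) simp

lemma minor_row_le_minor_sum:
  assumes "f \<in> idx q"
  shows "(\<Sum>g\<in>idx q. cmod (minor q T f g)) \<le> minor_sum q T"
  unfolding minor_sum_def by (rule member_le_sum[OF assms]) (simp_all add: sum_nonneg)

lemma minor_le_minor_sum:
  assumes "f \<in> idx q" "g \<in> idx q"
  shows "cmod (minor q T f g) \<le> minor_sum q T"
proof -
  have "cmod (minor q T f g) \<le> (\<Sum>g\<in>idx q. cmod (minor q T f g))"
    by (rule member_le_sum[OF assms(2)]) simp_all
  also have "\<dots> \<le> minor_sum q T" by (rule minor_row_le_minor_sum[OF assms(1)])
  finally show ?thesis .
qed

lemma minor_sum_mult: "minor_sum q (T ** S) \<le> minor_sum q T * minor_sum q S"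
proof -
  have 1: "cmod (minor q (T ** S) f g) \<le> (\<Sum>h\<in>idx q. cmod (minor q T f h) * cmod (minor q S h g))" for f g
  proof -
    have "cmod (minor q (T ** S) f g) \<le> fact q * cmod (minor q (T ** S) f g)"
      by (rule mult_right_mono[of 1 "fact q", simplified]) (auto simp: fact_ge_1)
    also have "\<dots> = cmod (fact q * minor q (T ** S) f g)" by (simp add: norm_mult)
    also have "\<dots> \<le> (\<Sum>h\<in>idx q. cmod (minor q T f h) * cmod (minor q S h g))"
      unfolding minor_mult by (rule order.trans[OF norm_sum]) (simp add: norm_mult)
    finally show ?thesis .
  qed
  have "minor_sum q (T ** S) \<le> (\<Sum>f\<in>idx q. \<Sum>g\<in>idx q. \<Sum>h\<in>idx q. cmod (minor q T f h) * cmod (minor q S h g))"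
    unfolding minor_sum_def by (intro sum_mono 1)
  also have "\<dots> = (\<Sum>f\<in>idx q. \<Sum>h\<in>idx q. cmod (minor q T f h) * (\<Sum>g\<in>idx q. cmod (minor q S h g)))"
    unfolding sum_distrib_left by (intro sum.cong refl sum.swap)
  also have "\<dots> \<le> (\<Sum>f\<in>idx q. \<Sum>h\<in>idx q. cmod (minor q T f h) * minor_sum q S)"
    by (intro sum_mono mult_left_mono minor_row_le_minor_sum) simp_all
  also have "\<dots> = minor_sum q T * minor_sum q S"
    by (simp add: minor_sum_def[of q T] sum_distrib_right)
  finally show ?thesis .
qed

lemma minor_sum_adjoint: "minor_sum q (adjoint_mat T) = minor_sum q T"
  unfolding minor_sum_def minor_adjoint complex_mod_cnj by (rule sum.swap)

lemma continuous_minor_sum: "continuous_on UNIV (minor_sum q :: complex ^ 'n ^ 'n \<Rightarrow> real)"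
  unfolding minor_sum_def minor_def by (intro continuous_intros)

lemma minor_sum_bound:
  obtains C where "0 < C" "\<And>T :: complex ^ 'n ^ 'n. norm T \<le> B \<Longrightarrow> minor_sum q T \<le> C"
proof -
  have "compact (minor_sum q ` cball (0 :: complex ^ 'n ^ 'n) B)"
    by (intro compact_continuous_image continuous_on_subset[OF continuous_minor_sum]) auto
  then have "bounded (minor_sum q ` cball (0 :: complex ^ 'n ^ 'n) B)" by (rule compact_imp_bounded)
  then obtain C where "C > 0" "\<And>T :: complex ^ 'n ^ 'n. norm T \<le> B \<Longrightarrow> norm (minor_sum q T) \<le> C"
    unfolding bounded_pos by (auto simp: dist_norm)
  then show ?thesis using that by fastforce
qed

section \<open>Comparison of minor sums with products of singular values\<close>

lemma norm_unitary:
  fixes V :: "complex ^ 'n ^ 'n"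
  assumes "adjoint_mat V ** V = mat 1"
  shows "norm V = sqrt CARD('n)"
proof -
  have "(norm V)\<^sup>2 = (\<Sum>i\<in>UNIV. \<Sum>j\<in>UNIV. (cmod (V $ i $ j))\<^sup>2)"
    by (simp add: norm_vec_def L2_set_def sum_nonneg)
  also have "\<dots> = (\<Sum>j\<in>UNIV. \<Sum>i\<in>UNIV. (cmod (V $ i $ j))\<^sup>2)" by (rule sum.swap)
  also have "complex_of_real \<dots> = (\<Sum>j\<in>UNIV. (adjoint_mat V ** V) $ j $ j)"
    by (simp add: matrix_matrix_mult_def adjoint_mat_def complex_norm_square mult.commute del: of_real_power)
  also have "\<dots> = complex_of_real (real CARD('n))" by (simp add: assms mat_def)
  finally have "(norm V)\<^sup>2 = real CARD('n)" using of_real_eq_iff by blast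
  then show ?thesis by (metis norm_ge_zero real_sqrt_unique)
qed

text \<open>The largest of \<open>Suc q\<close> distinct naturals is at least \<open>q\<close>, so
  its factor is at most \<open>d q\<close>; the others are handled by induction.\<close>

lemma prod_le_prod_lessThan:
  fixes d :: "nat \<Rightarrow> real"
  assumes "card S = q" "S \<subseteq> {..<m}"
    and nn: "\<And>i. i < m \<Longrightarrow> 0 \<le> d i" and dec: "\<And>i j. i \<le> j \<Longrightarrow> j < m \<Longrightarrow> d j \<le> d i"
  shows "prod d S \<le> prod d {..<q}"
  using assms(1,2)
proof (induction q arbitrary: S)
  case 0
  then show ?case using finite_subset by fastforce
next
  case (Suc q)
  have fin: "finite S" using Suc.prems finite_subset by blast
  have ne: "S \<noteq> {}" using Suc.prems(1) by auto
  define a where "a = Max S"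
  have a: "a \<in> S" "a < m" using fin ne Suc.prems(2) by (auto simp: a_def)
  have "S \<subseteq> {..a}" using fin by (auto simp: a_def)
  then have "q \<le> a" using card_mono[of "{..a}" S] Suc.prems(1) by simp
  have "prod d S = prod d (S - {a}) * d a" using a(1) fin by (simp add: prod.remove mult.commute)
  also have "\<dots> \<le> prod d {..<q} * d q"
  proof (rule mult_mono)
    show "prod d (S - {a}) \<le> prod d {..<q}" by (rule Suc.IH) (use Suc.prems a(1) fin in auto)
    show "d a \<le> d q" using dec \<open>q \<le> a\<close> a(2) .
  qed (use nn a \<open>q \<le> a\<close> in \<open>auto intro!: prod_nonneg\<close>)
  finally show ?case by simp
qed

text \<open>Below: the principal minor on the \<open>q\<close> largest diagonal entries is their
  product, since every other permutation meets an off-diagonal zero. Above: a minor with distinct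
  rows is a sum of \<open>q!\<close> terms, each at most a product of \<open>q\<close> distinct
  entries; a repeated row makes it vanish.\<close>

lemma minor_sum_diagmat:
  fixes l :: "nat \<Rightarrow> real" and f :: "'n :: finite \<Rightarrow> nat"
  assumes f: "bij_betw f UNIV {..<CARD('n)}" and q: "q \<le> CARD('n)"
    and nn: "\<And>i. i < CARD('n) \<Longrightarrow> 0 \<le> l i" and dec: "\<And>i j. i \<le> j \<Longrightarrow> j < CARD('n) \<Longrightarrow> l j \<le> l i"
  defines "D \<equiv> diagmat (\<lambda>k. complex_of_real (l (f k)))"
  shows "prod l {..<q} \<le> minor_sum q D"
    and "minor_sum q D \<le> (real (card (idx q :: (nat \<Rightarrow> 'n) set)))\<^sup>2 * fact q * prod l {..<q}"
proof -
  have finj: "f k = f k' \<longleftrightarrow> k = k'" and fless: "f k < CARD('n)" for k k'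
    using f by (auto simp: bij_betw_def inj_on_eq_iff)
  define e :: "nat \<Rightarrow> 'n" where "e = restrict (inv f) {..<q}"
  have fe: "f (e i) = i" if "i < q" for i
    using f that q by (simp add: e_def bij_betw_def f_inv_into_f)
  have "minor q D e e = (\<Sum>p | p permutes {..<q}. if p = id then complex_of_real (prod l {..<q}) else 0)"
    unfolding minor_def
  proof (rule sum.cong[OF refl])
    fix p assume "p \<in> {p. p permutes {..<q}}"
    then have p: "p permutes {..<q}" by simp
    show "of_int (sign p) * (\<Prod>i<q. D $ e i $ e (p i)) = (if p = id then complex_of_real (prod l {..<q}) else 0)"
    proof (cases "p = id")
      case True
      then show ?thesis by (simp add: D_def diagmat_def fe)
    next
      case False
      then obtain i where i: "p i \<noteq> i" by (auto simp: fun_eq_iff)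
      have iq: "i < q" "p i < q" using i p permutes_in_image[OF p] by (auto simp: permutes_def)
      have "e i \<noteq> e (p i)" using fe iq i by metis
      then have "D $ e i $ e (p i) = 0" by (simp add: D_def diagmat_def)
      then show ?thesis using False iq by (auto intro: prod_zero)
    qed
  qed
  also have "\<dots> = complex_of_real (prod l {..<q})"
    by (simp add: finite_permutations permutes_id)
  finally have "cmod (minor q D e e) = prod l {..<q}"
    using nn q by (simp add: abs_prod prod_nonneg flip: of_real_prod)
  then show "prod l {..<q} \<le> minor_sum q D"
    using minor_le_minor_sum[of e q e D] by (simp add: e_def)
  have bd: "cmod (minor q D h g) \<le> fact q * prod l {..<q}" for h g
  proof (cases "inj_on h {..<q}")
    case False
    then obtain i j where "i < q" "j < q" "i \<noteq> j" "h i = h j" by (auto simp: inj_on_def)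
    then show ?thesis using minor_eq_0[of i q j h D g] nn q by (auto intro!: mult_nonneg_nonneg prod_nonneg)
  next
    case True
    have "cmod (of_int (sign p) * (\<Prod>i<q. D $ h i $ g (p i))) \<le> prod l {..<q}" for p
    proof -
      have "cmod (of_int (sign p) * (\<Prod>i<q. D $ h i $ g (p i))) = (\<Prod>i<q. cmod (D $ h i $ g (p i)))"
        by (simp add: norm_mult sign_def prod_norm)
      also have "\<dots> \<le> (\<Prod>i<q. l (f (h i)))"
        using nn fless by (intro prod_mono) (auto simp: D_def diagmat_def)
      also have "\<dots> = prod l ((f \<circ> h) ` {..<q})"
        using True finj by (subst prod.reindex) (auto simp: inj_on_def)
      also have "\<dots> \<le> prod l {..<q}"
      proof (rule prod_le_prod_lessThan[OF _ _ nn dec])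
        show "card ((f \<circ> h) ` {..<q}) = q"
          using True finj by (subst card_image) (auto simp: inj_on_def)
      qed (use fless in auto)
      finally show ?thesis .
    qed
    then have "cmod (minor q D h g) \<le> (\<Sum>p | p permutes {..<q}. prod l {..<q})"
      unfolding minor_def by (intro order.trans[OF norm_sum] sum_mono)
    then show ?thesis using card_permutations[of "{..<q}" q] by simp
  qed
  have "minor_sum q D \<le> (\<Sum>h\<in>(idx q :: (nat \<Rightarrow> 'n) set). \<Sum>g\<in>(idx q :: (nat \<Rightarrow> 'n) set). fact q * prod l {..<q})"
    unfolding minor_sum_def by (intro sum_mono bd)
  then show "minor_sum q D \<le> (real (card (idx q :: (nat \<Rightarrow> 'n) set)))\<^sup>2 * fact q * prod l {..<q}"
    by (simp add: power2_eq_square mult.assoc)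
qed

text \<open>By Cauchy--Binet, \<open>q!\<close> times a diagonal minor of \<open>T* T\<close> is the
  sum of the squared moduli of a column of minors of \<open>T\<close>. Cauchy--Schwarz over the
  \<open>m\<^sup>2\<close> index pairs and the sum over \<open>m\<close> columns give
  \<open>m ^ 3\<close>.\<close>

lemma minor_sum_square_le:
  fixes T :: "complex ^ 'n ^ 'n" and q :: nat
  defines "m \<equiv> real (card (idx q :: (nat \<Rightarrow> 'n) set))"
  shows "(minor_sum q T)\<^sup>2 \<le> m ^ 3 * fact q * minor_sum q (adjoint_mat T ** T)"
proof -
  have col: "(\<Sum>f\<in>idx q. (cmod (minor q T f g))\<^sup>2) \<le> fact q * minor_sum q (adjoint_mat T ** T)"
    if g: "g \<in> idx q" for g
  proof -
    have "complex_of_real (\<Sum>f\<in>idx q. (cmod (minor q T f g))\<^sup>2) = fact q * minor q (adjoint_mat T ** T) g g"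
      by (simp add: minor_mult minor_adjoint complex_norm_square mult.commute del: of_real_power)
    from arg_cong[OF this, of cmod]
    have "\<bar>\<Sum>f\<in>idx q. (cmod (minor q T f g))\<^sup>2\<bar> = cmod (fact q * minor q (adjoint_mat T ** T) g g)"
      unfolding norm_of_real .
    then have "(\<Sum>f\<in>idx q. (cmod (minor q T f g))\<^sup>2) = cmod (fact q * minor q (adjoint_mat T ** T) g g)"
      by (subst (asm) abs_of_nonneg) (auto intro: sum_nonneg)
    also have "\<dots> \<le> fact q * minor_sum q (adjoint_mat T ** T)"
      using minor_le_minor_sum[OF g g] by (simp add: norm_mult)
    finally show ?thesis .
  qed
  have "(minor_sum q T)\<^sup>2 = (\<Sum>x\<in>idx q \<times> idx q. cmod (minor q T (fst x) (snd x)))\<^sup>2"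
    unfolding minor_sum_def sum.cartesian_product case_prod_unfold ..
  also have "\<dots> \<le> (\<Sum>x\<in>idx q \<times> idx q. (cmod (minor q T (fst x) (snd x)))\<^sup>2)
      * real (card (idx q \<times> idx q :: ((nat \<Rightarrow> 'n) \<times> (nat \<Rightarrow> 'n)) set))"
    by (rule sum_squared_le_sum_of_squares)
  also have "real (card (idx q \<times> idx q :: ((nat \<Rightarrow> 'n) \<times> (nat \<Rightarrow> 'n)) set)) = m\<^sup>2"
    by (simp add: m_def card_cartesian_product power2_eq_square)
  also have "(\<Sum>x\<in>idx q \<times> idx q. (cmod (minor q T (fst x) (snd x)))\<^sup>2)
      = (\<Sum>f\<in>idx q. \<Sum>g\<in>idx q. (cmod (minor q T f g))\<^sup>2)"
    unfolding sum.cartesian_product case_prod_unfold ..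
  also have "\<dots> = (\<Sum>g\<in>idx q. \<Sum>f\<in>idx q. (cmod (minor q T f g))\<^sup>2)"
    by (rule sum.swap)
  also have "\<dots> * m\<^sup>2 \<le> (\<Sum>g\<in>(idx q :: (nat \<Rightarrow> 'n) set). fact q * minor_sum q (adjoint_mat T ** T)) * m\<^sup>2"
    by (intro mult_right_mono sum_mono col) auto
  also have "\<dots> = m ^ 3 * fact q * minor_sum q (adjoint_mat T ** T)"
    by (simp add: m_def power2_eq_square power3_eq_cube)
  finally show ?thesis .
qed

lemma minor_sum_singular_values:
  fixes q :: nat
  assumes q: "q \<le> CARD('n)"
  obtains C where "0 < C"
    "\<And>(T :: complex ^ 'n ^ 'n) v l. eigbasis (adjoint_mat T ** T) v l \<Longrightarrow>
      prod l {..<q} \<le> C * (minor_sum q T)\<^sup>2 \<and> (minor_sum q T)\<^sup>2 \<le> C * prod l {..<q}"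
proof -
  \<comment> \<open>All unitary matrices lie in one ball, so \<open>U\<close> bounds their minor
    sums; a unitary change of basis then costs at most \<open>U\<^sup>2\<close>, uniformly in
    \<open>T\<close>.\<close>
  obtain U where U: "0 < U" "\<And>T :: complex ^ 'n ^ 'n. norm T \<le> sqrt CARD('n) \<Longrightarrow> minor_sum q T \<le> U"
    using minor_sum_bound by blast
  define m where "m = real (card (idx q :: (nat \<Rightarrow> 'n) set))"
  define C where "C = U\<^sup>2 + m ^ 3 * fact q * (U\<^sup>2 * (m\<^sup>2 * fact q))"
  have m0: "m \<ge> 0" by (simp add: m_def)
  have "0 < C" unfolding C_def using U(1) m0 by (intro add_pos_nonneg) auto
  moreover have "prod l {..<q} \<le> C * (minor_sum q T)\<^sup>2 \<and> (minor_sum q T)\<^sup>2 \<le> C * prod l {..<q}"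
    if eb: "eigbasis (adjoint_mat T ** T) v l" for T :: "complex ^ 'n ^ 'n" and v l
  proof -
    have nn: "\<And>i. i < CARD('n) \<Longrightarrow> 0 \<le> l i" using eigbasis_nonneg[OF eb psd_adjoint_mult] .
    have dec: "\<And>i j. i \<le> j \<Longrightarrow> j < CARD('n) \<Longrightarrow> l j \<le> l i" using eb by (simp add: eigbasis_def)
    have on: "onfam CARD('n) v" using eb by (simp add: eigbasis_def)
    have l0: "0 \<le> prod l {..<q}" using nn q by (auto intro!: prod_nonneg)
    obtain f :: "'n \<Rightarrow> nat" and V where f: "bij_betw f UNIV {..<CARD('n)}"
      and VV: "adjoint_mat V ** V = mat 1" "V ** adjoint_mat V = mat 1"
      and V: "\<And>l. specmat v l ** V = V ** diagmat (\<lambda>k. complex_of_real (l (f k)))"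
      using onfam_diagonalization[OF on] by metis
    define D where "D = diagmat (\<lambda>k. complex_of_real (l (f k)))"
    define P where "P = adjoint_mat T ** T"
    have PV: "P ** V = V ** D" using V[of l] eigbasis_eq_specmat[OF eb] by (simp add: P_def D_def)
    have D: "D = adjoint_mat V ** P ** V"
      using VV(1) PV by (metis matrix_mul_assoc matrix_mul_lid)
    have P: "P = V ** D ** adjoint_mat V"
      using VV(2) PV by (metis matrix_mul_assoc matrix_mul_rid)
    have UV: "minor_sum q V \<le> U" by (intro U(2)) (simp add: norm_unitary[OF VV(1)])
    note diag = minor_sum_diagmat[where l = l, OF f q nn dec, folded D_def, folded m_def]
    have "prod l {..<q} \<le> minor_sum q D" by (rule diag(1))
    also have "\<dots> \<le> minor_sum q (adjoint_mat V ** P) * minor_sum q V"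
      unfolding D by (rule minor_sum_mult)
    also have "\<dots> \<le> (minor_sum q V * minor_sum q P) * minor_sum q V"
      using minor_sum_mult[of q "adjoint_mat V" P] by (intro mult_right_mono) (auto simp: minor_sum_adjoint)
    also have "\<dots> \<le> (U * (minor_sum q T)\<^sup>2) * U"
      using minor_sum_mult[of q "adjoint_mat T" T] UV U(1)
      by (intro mult_mono) (auto simp: minor_sum_adjoint P_def power2_eq_square)
    also have "\<dots> = U\<^sup>2 * (minor_sum q T)\<^sup>2" by (simp add: power2_eq_square)
    also have "\<dots> \<le> C * (minor_sum q T)\<^sup>2"
      using m0 by (intro mult_right_mono) (auto simp: C_def)
    finally have one: "prod l {..<q} \<le> C * (minor_sum q T)\<^sup>2" .
    have "minor_sum q P \<le> minor_sum q (V ** D) * minor_sum q V"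
      unfolding P using minor_sum_mult[of q "V ** D" "adjoint_mat V"] by (simp add: minor_sum_adjoint)
    also have "\<dots> \<le> (minor_sum q V * minor_sum q D) * minor_sum q V"
      by (intro mult_right_mono minor_sum_mult) auto
    also have "\<dots> \<le> (U * (m\<^sup>2 * fact q * prod l {..<q})) * U"
      using UV U(1) diag(2) l0 m0 by (intro mult_mono) auto
    finally have "minor_sum q P \<le> U\<^sup>2 * (m\<^sup>2 * fact q * prod l {..<q})"
      by (simp add: power2_eq_square mult_ac)
    then have "m ^ 3 * fact q * minor_sum q P \<le> m ^ 3 * fact q * (U\<^sup>2 * (m\<^sup>2 * fact q * prod l {..<q}))"
      using m0 by (intro mult_left_mono) auto
    with minor_sum_square_le[of q T]
    have "(minor_sum q T)\<^sup>2 \<le> m ^ 3 * fact q * (U\<^sup>2 * (m\<^sup>2 * fact q * prod l {..<q}))"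
      by (simp add: P_def m_def)
    also have "\<dots> \<le> C * prod l {..<q}"
      using l0 by (simp add: C_def algebra_simps)
    finally show ?thesis using one by blast
  qed
  ultimately show ?thesis using that by blast
qed


section \<open>Independent sequences and the shift\<close>

text \<open>Paths are indexed from 1 and undefined at 0; the restriction keeps the shifted path in
  the same extensional product space.\<close>

definition shift :: "nat \<Rightarrow> (nat \<Rightarrow> 'w) \<Rightarrow> nat \<Rightarrow> 'w" where
  "shift m w = (\<lambda>i\<in>{1..}. w (i + m))"

definition window :: "nat \<Rightarrow> nat \<Rightarrow> (nat \<Rightarrow> 'w) \<Rightarrow> nat \<Rightarrow> 'w" where
  "window m L w = (\<lambda>i\<in>{1..L}. w (i + m))"

lemma shift_shift: "shift m (shift n w) = shift (m + n) w"
  by (auto simp: shift_def fun_eq_iff add_ac)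

section \<open>Stationarity, frequencies of windows and the zero-one law for independent
  paths\<close>

locale iid_paths = prob_space p for p :: "'w measure"
begin

abbreviation S :: "(nat \<Rightarrow> 'w) measure" where "S \<equiv> path_measure p"

abbreviation windows :: "nat \<Rightarrow> (nat \<Rightarrow> 'w) measure" where
  "windows L \<equiv> Pi\<^sub>M {1..L} (\<lambda>_. p)"

sublocale S: prob_space S
  unfolding path_measure_def by (intro prob_space_PiM prob_space_axioms)

lemma space_S: "space S = {1..} \<rightarrow>\<^sub>E space p"
  by (simp add: path_measure_def space_PiM)

lemma shift_0: "w \<in> space S \<Longrightarrow> shift 0 w = w"
  by (auto simp: shift_def space_S fun_eq_iff PiE_iff extensional_def)

lemma measurable_component_S [measurable]: "i \<ge> 1 \<Longrightarrow> (\<lambda>w. w i) \<in> measurable S p"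
  unfolding path_measure_def by (rule measurable_component_singleton) simp

lemma measurable_shift [measurable]: "shift m \<in> measurable S S"
  unfolding shift_def path_measure_def
  by (intro measurable_restrict measurable_component_singleton) auto

lemma measurable_window [measurable]: "window m L \<in> measurable S (windows L)"
  unfolding window_def path_measure_def
  by (intro measurable_restrict measurable_component_singleton) auto

lemma distr_shift: "distr S S (shift m) = S"
  using distr_PiM_reindex[of "{1..}" "\<lambda>_. p" "\<lambda>i. i + m" "{1..}"] prob_space_axioms
  by (auto simp: path_measure_def shift_def[abs_def])

lemma distr_window: "distr S (windows L) (window m L) = windows L"
  using distr_PiM_reindex[of "{1..}" "\<lambda>_. p" "\<lambda>i. i + m" "{1..L}"] prob_space_axioms
  by (auto simp: path_measure_def window_def[abs_def])

lemma indep_coordinates: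
  assumes "inj_on f I" "f \<in> I \<rightarrow> {1..}" "I \<noteq> {}"
  shows "S.indep_vars (\<lambda>_. p) (\<lambda>i w. w (f i)) I"
proof (subst S.indep_vars_iff_distr_eq_PiM'[OF assms(3)])
  show "S.random_variable p (\<lambda>w. w (f i))" if "i \<in> I" for i
    using assms(2) that by (intro measurable_component_S) auto
  have "distr S p (\<lambda>w. w (f i)) = p" if "i \<in> I" for i
    unfolding path_measure_def
    by (rule distr_PiM_component) (use assms that prob_space_axioms in auto)
  then show "distr S (Pi\<^sub>M I (\<lambda>_. p)) (\<lambda>w. \<lambda>i\<in>I. w (f i)) = (\<Pi>\<^sub>M i\<in>I. distr S p (\<lambda>w. w (f i)))"
    using distr_PiM_reindex[of "{1..}" "\<lambda>_. p" f I] prob_space_axioms assms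
    by (simp add: path_measure_def cong: PiM_cong)
qed

lemma indep_windows:
  assumes L: "L > 0"
  shows "S.indep_vars (\<lambda>_. windows L) (\<lambda>j. window (r + L * j) L) UNIV"
proof -
  define B where "B j = {r + L * j + 1..r + L * j + L}" for j
  have disj: "disjoint_family_on B UNIV"
    unfolding disjoint_family_on_def
  proof (intro ballI impI)
    fix i j :: nat assume "i \<noteq> j"
    then consider "Suc i \<le> j" | "Suc j \<le> i" by linarith
    then show "B i \<inter> B j = {}"
    proof cases
      case 1
      then have "L * Suc i \<le> L * j" by (rule mult_le_mono2)
      then show ?thesis by (auto simp: B_def)
    next
      case 2
      then have "L * Suc j \<le> L * i" by (rule mult_le_mono2)
      then show ?thesis by (auto simp: B_def)
    qed
  qed
  have "S.indep_vars (\<lambda>j. Pi\<^sub>M (B j) (\<lambda>_. p)) (\<lambda>j w. restrict (\<lambda>i. w i) (B j)) UNIV"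
    by (rule S.indep_vars_restrict[OF indep_coordinates[of "\<lambda>i. i" "{1..}"] _ disj]) (auto simp: B_def)
  moreover have "(\<lambda>x. \<lambda>i\<in>{1..L}. x (i + (r + L * j))) \<in> measurable (Pi\<^sub>M (B j) (\<lambda>_. p)) (windows L)" for j
    by (intro measurable_restrict measurable_component_singleton) (auto simp: B_def)
  ultimately have "S.indep_vars (\<lambda>_. windows L)
      (\<lambda>j w. (\<lambda>x. \<lambda>i\<in>{1..L}. x (i + (r + L * j))) (restrict (\<lambda>i. w i) (B j))) UNIV"
    by (rule S.indep_vars_compose2)
  also have "(\<lambda>j w. (\<lambda>x. \<lambda>i\<in>{1..L}. x (i + (r + L * j))) (restrict (\<lambda>i. w i) (B j))) = (\<lambda>j. window (r + L * j) L)"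
    by (auto simp: fun_eq_iff window_def B_def)
  finally show ?thesis .
qed

text \<open>The windows at \<open>r + L * j\<close> for varying \<open>j\<close> are independent.
  Hoeffding bounds the probability of an excess frequency by
  \<open>exp (- 2 * e\<^sup>2) ^ J\<close>, which is summable, and Borel--Cantelli applies. The
  offset \<open>r\<close> allows every residue class modulo \<open>L\<close>.\<close>

lemma eventually_frequency_le:
  assumes L: "L > 0" and A: "A \<in> sets (windows L)" and e: "e > 0"
  shows "AE w in S. \<forall>\<^sub>F J in sequentially.
    real (card {j. j < J \<and> window (r + L * j) L w \<in> A}) \<le> (measure (windows L) A + e) * J"
proof -
  define P where "P = measure (windows L) A"
  define X where "X j w = (indicator A (window (r + L * j) L w) :: real)" for j w
  have [measurable]: "A \<in> sets (windows L)" by (rule A)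
  have X_meas [measurable]: "X j \<in> borel_measurable S" for j
    unfolding X_def by measurable
  have "S.indep_vars (\<lambda>_. borel) (\<lambda>j w. indicator A (window (r + L * j) L w) :: real) UNIV"
    by (rule S.indep_vars_compose2[OF indep_windows[OF L]]) (rule borel_measurable_indicator[OF A])
  then have indep: "S.indep_vars (\<lambda>_. borel) X UNIV" by (simp add: X_def[abs_def])
  have expX: "S.expectation (X j) = P" for j
  proof -
    have "S.expectation (X j) = S.prob (window (r + L * j) L -` A \<inter> space S)"
    proof -
      have "S.expectation (X j) = S.expectation (indicator (window (r + L * j) L -` A \<inter> space S))"
        by (rule Bochner_Integration.integral_cong) (auto simp: X_def indicator_def)
      then show ?thesis by simp
    qed
    also have "\<dots> = P"
      using measure_distr[OF measurable_window A, of "r + L * j"] unfolding P_def distr_window by simp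
    finally show ?thesis .
  qed
  define bad where "bad J = {w \<in> space S. (\<Sum>j<J. X j w) \<ge> (\<Sum>j<J. S.expectation (X j)) + e * J}" for J
  have bad_le: "S.prob (bad J) \<le> exp (- 2 * e\<^sup>2) ^ J" if "J > 0" for J
  proof -
    interpret H: Hoeffding_ineq S "{..<J}" X "\<lambda>_. 0" "\<lambda>_. 1" "\<Sum>j<J. S.expectation (X j)"
    proof unfold_locales
      show "S.indep_vars (\<lambda>_. borel) X {..<J}" by (rule S.indep_vars_subset[OF indep]) auto
    qed (auto simp: X_def indicator_def)
    have "S.prob (bad J) \<le> exp (-2 * (e * J)\<^sup>2 / (\<Sum>i<J. (1 - 0)\<^sup>2))"
      unfolding bad_def by (rule H.Hoeffding_ineq_ge) (use e that in auto)
    also have "-2 * (e * J)\<^sup>2 / (\<Sum>i<J. (1 - 0)\<^sup>2) = real J * (- 2 * e\<^sup>2)"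
      using that by (simp add: power2_eq_square)
    finally show ?thesis by (simp only: exp_of_nat_mult)
  qed
  have "AE w in S. eventually (\<lambda>J. w \<in> space S - bad J) sequentially"
  proof (rule borel_cantelli_AE1)
    show "bad J \<in> sets S" for J unfolding bad_def by measurable
    show "emeasure S (bad J) < \<infinity>" for J by (simp add: S.emeasure_eq_measure)
    have "summable (\<lambda>J. exp (- 2 * e\<^sup>2) ^ J)" using e by (intro summable_geometric) simp
    moreover have "\<forall>\<^sub>F J in sequentially. norm (S.prob (bad J)) \<le> exp (- 2 * e\<^sup>2) ^ J"
      using eventually_gt_at_top[of 0] by eventually_elim (use bad_le in simp)
    ultimately show "summable (\<lambda>J. S.prob (bad J))"
      by (rule summable_comparison_test_ev[rotated])
  qed
  then show ?thesis
  proof (rule AE_mp, intro AE_I2 impI)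
    fix w assume w: "w \<in> space S" and ev: "\<forall>\<^sub>F J in sequentially. w \<in> space S - bad J"
    from ev show "\<forall>\<^sub>F J in sequentially. real (card {j. j < J \<and> window (r + L * j) L w \<in> A})
        \<le> (measure (windows L) A + e) * J"
    proof eventually_elim
      case (elim J)
      have "(\<Sum>j<J. X j w) = real (card {j. j < J \<and> window (r + L * j) L w \<in> A})"
        by (simp add: X_def indicator_def sum.If_cases Int_def)
      then show ?case using elim w by (simp add: bad_def expX P_def algebra_simps)
    qed
  qed
qed

text \<open>One-sided invariance suffices: the preimages of \<open>E\<close> under
  \<open>shift m\<close> decrease and all have the probability of \<open>E\<close>, so their
  intersection has it too, and that intersection is a tail event.\<close>

lemma shift_zero_one_law:
  assumes E: "E \<in> sets S" and from_shift: "\<And>w. w \<in> space S \<Longrightarrow> shift 1 w \<in> E \<Longrightarrow> w \<in> E"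
  shows "S.prob E = 0 \<or> S.prob E = 1"
proof -
  define A where "A i = sigma_sets (space S) {(\<lambda>w. w (Suc i)) -` B \<inter> space S |B. B \<in> sets p}" for i
  define F where "F m = shift m -` E \<inter> space S" for m
  have F_meas: "F m \<in> sets S" for m unfolding F_def using E by measurable
  have "S.prob (F m) = S.prob E" for m
    unfolding F_def using E by (subst (2) distr_shift[of m, symmetric]) (simp add: measure_distr)
  moreover have "decseq F"
  proof (rule decseq_SucI, rule subsetI)
    fix m w assume "w \<in> F (Suc m)"
    then have "shift 1 (shift m w) \<in> E" "w \<in> space S" by (auto simp: F_def shift_shift)
    then show "w \<in> F m" using from_shift[of "shift m w"] measurable_space[OF measurable_shift] by (auto simp: F_def)
  qed
  ultimately have "S.prob E = S.prob (\<Inter>m. F m)"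
    using S.finite_Lim_measure_decseq[of F] F_meas by (simp add: image_subset_iff LIMSEQ_const_iff)
  also have "S.prob (\<Inter>m. F m) = 0 \<or> S.prob (\<Inter>m. F m) = 1"
  proof (rule S.kolmogorov_0_1_law[of A])
    show "sigma_algebra (space S) (A i)" for i
      unfolding A_def by (rule sigma_algebra_sigma_sets) auto
    show "S.indep_sets A UNIV"
      using indep_coordinates[of Suc UNIV] by (auto simp: S.indep_vars_def A_def[abs_def])
    show "(\<Inter>m. F m) \<in> S.tail_events A"
      unfolding S.tail_events_def
    proof (rule INT_I)
      fix n :: nat
      let ?G = "sigma (space S) (\<Union> (A ` {n..}))"
      have sub: "\<Union> (A ` {n..}) \<subseteq> Pow (space S)"
        unfolding A_def by (auto dest: sigma_sets_into_sp[rotated])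
      have "shift m \<in> measurable ?G (Pi\<^sub>M {1..} (\<lambda>_. p))" if "m \<ge> n" for m
      proof (rule measurable_PiM_single')
        show "shift m \<in> space ?G \<rightarrow> {1..} \<rightarrow>\<^sub>E space p"
          unfolding space_measure_of_conv by (auto simp: space_S shift_def PiE_iff extensional_def)
        fix i :: nat assume i: "i \<in> {1..}"
        have "(\<lambda>w. w (i + m)) \<in> measurable ?G p"
        proof (rule measurableI)
          fix B assume "B \<in> sets p"
          then have "(\<lambda>w. w (i + m)) -` B \<inter> space S \<in> A (i + m - 1)"
            using i unfolding A_def by (intro sigma_sets.Basic) auto
          then have "(\<lambda>w. w (i + m)) -` B \<inter> space S \<in> \<Union> (A ` {n..})" using i that by auto
          then show "(\<lambda>w. w (i + m)) -` B \<inter> space ?G \<in> sets ?G" using sub by auto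
        qed (use i in \<open>auto simp: space_measure_of_conv space_S\<close>)
        then show "(\<lambda>w. shift m w i) \<in> measurable ?G p" using i by (simp add: shift_def)
      qed
      then have "shift m \<in> measurable ?G S" if "m \<ge> n" for m
        using that by (simp add: path_measure_def)
      then have "F m \<in> sets ?G" if "m \<ge> n" for m
        using measurable_sets[of "shift m" ?G S E] E that by (simp add: F_def space_measure_of_conv)
      then have "(\<Inter>m\<in>{n..}. F m) \<in> sets ?G" by (intro sets.countable_INT) auto
      \<comment> \<open>Dropping the first \<open>n\<close> sets of a decreasing sequence leaves the
        intersection unchanged, so it depends only on coordinates beyond \<open>n\<close>.\<close>
      also have "(\<Inter>m\<in>{n..}. F m) = (\<Inter>m. F m)"
      proof
        have "F (max m n) \<subseteq> F m" for m using \<open>decseq F\<close> by (simp add: decseq_def)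
        moreover have "(\<Inter>m\<in>{n..}. F m) \<subseteq> F (max m n)" for m by (rule INT_lower) simp
        ultimately show "(\<Inter>m\<in>{n..}. F m) \<subseteq> (\<Inter>m. F m)" by blast
      qed auto
      finally show "(\<Inter>m. F m) \<in> sigma_sets (space S) (\<Union> (A ` {n..}))"
        using sub by simp
    qed
  qed
  finally show ?thesis .
qed

end


section \<open>Growth rates of submultiplicative cocycles\<close>

lemma Phi_cong: "(\<And>i. 1 \<le> i \<Longrightarrow> i \<le> n \<Longrightarrow> w i = w' i) \<Longrightarrow> Phi M n w = Phi M n w'"
  by (induction n) auto

lemma Phi_add: "Phi M (m + n) w = Phi M n (shift m w) ** Phi M m w"
  by (induction n) (simp_all add: shift_def add_ac flip: matrix_mul_assoc)

lemma Phi_window: "n \<le> L \<Longrightarrow> Phi M n (window m L w) = Phi M n (shift m w)"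
  by (rule Phi_cong) (simp add: window_def shift_def)

lemma measurable_Phi:
  fixes M :: "'w \<Rightarrow> complex ^ 'n ^ 'n"
  assumes M: "M \<in> borel_measurable p" and "{1..n} \<subseteq> I"
  shows "Phi M n \<in> borel_measurable (Pi\<^sub>M I (\<lambda>_. p))"
  using assms(2)
proof (induction n)
  case (Suc n)
  have "(\<lambda>w. w (Suc n)) \<in> measurable (Pi\<^sub>M I (\<lambda>_. p)) p"
    using Suc.prems by (intro measurable_component_singleton) auto
  then have "(\<lambda>w. M (w (Suc n))) \<in> borel_measurable (Pi\<^sub>M I (\<lambda>_. p))"
    using M by (rule measurable_compose)
  moreover have "Phi M n \<in> borel_measurable (Pi\<^sub>M I (\<lambda>_. p))"
    using Suc by (metis atLeastatMost_subset_iff le_SucI order_refl order_trans)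
  moreover have "continuous_on UNIV (\<lambda>x :: (complex ^ 'n ^ 'n) \<times> (complex ^ 'n ^ 'n). fst x ** snd x)"
    unfolding matrix_matrix_mult_def by (intro continuous_intros continuous_on_vec_lambda)
  ultimately have "(\<lambda>w. M (w (Suc n)) ** Phi M n w) \<in> borel_measurable (Pi\<^sub>M I (\<lambda>_. p))"
    by (rule borel_measurable_continuous_Pair)
  then show ?case by simp
next
  case 0
  have "Phi M 0 = (\<lambda>w. mat 1)" by (simp add: fun_eq_iff)
  then show ?case by simp
qed

text \<open>Greedy decomposition: cut \<open>[m, m + n)\<close> into blocks of length at most \<open>L\<close> on which \<open>a\<close>
  decays at rate \<open>c\<close>, and single steps at the bad times.\<close>

lemma submultiplicative_greedy:
  fixes a :: "nat \<Rightarrow> nat \<Rightarrow> real"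
  assumes nn: "\<And>m n. 0 \<le> a m n"
    and sub: "\<And>m i j. a m (i + j) \<le> a m i * a (m + i) j"
    and a0: "\<And>m. a m 0 \<le> D" and a1: "\<And>m. a m 1 \<le> c * k"
    and c: "0 < c" and k: "1 \<le> k" and D: "1 \<le> D"
    and good: "\<And>m. m \<notin> B \<Longrightarrow> \<exists>l\<in>{1..L}. a m l \<le> c ^ l"
  shows "a m n \<le> D * c ^ n * k ^ (card (B \<inter> {m..<m + n}) + L)"
proof -
  \<comment> \<open>This bound treats every step as bad. It is applied only to a final piece shorter
    than \<open>L\<close>, whence the additional \<open>L\<close> in the exponent of
    \<open>k\<close>.\<close>
  have crude: "a m n \<le> D * (c * k) ^ n" for m n
  proof (induction n arbitrary: m)
    case (Suc n)
    have "a m (Suc n) \<le> a m 1 * a (m + 1) n" using sub[of m 1 n] by simp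
    also have "\<dots> \<le> (c * k) * (D * (c * k) ^ n)"
      using a1 Suc.IH nn c k by (intro mult_mono) auto
    finally show ?case by (simp add: mult_ac)
  qed (simp add: a0)
  show ?thesis
  proof (induction n arbitrary: m rule: less_induct)
    case (less n)
    consider "n < L" | "n \<ge> L" "m \<notin> B" | "n > 0" "n \<ge> L" "m \<in> B" | "n = 0" "n \<ge> L"
      by (cases "n < L"; cases "m \<in> B"; cases "n = 0") auto
    then show ?case
    proof cases
      case 1
      have "a m n \<le> D * (c ^ n * k ^ n)" using crude[of m n] by (simp add: power_mult_distrib)
      also have "\<dots> \<le> D * (c ^ n * k ^ (card (B \<inter> {m..<m + n}) + L))"
        using 1 c k D by (intro mult_left_mono power_increasing) auto
      finally show ?thesis by (simp add: mult_ac)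
    next
      case 2
      then obtain l where l: "1 \<le> l" "l \<le> L" "a m l \<le> c ^ l" using good by fastforce
      have "a m n \<le> a m l * a (m + l) (n - l)" using sub[of m l "n - l"] l 2 by simp
      also have "\<dots> \<le> c ^ l * (D * c ^ (n - l) * k ^ (card (B \<inter> {m + l..<m + l + (n - l)}) + L))"
        using l nn c less.IH[of "n - l" "m + l"] 2 by (intro mult_mono) auto
      also have "\<dots> \<le> c ^ l * (D * c ^ (n - l) * k ^ (card (B \<inter> {m..<m + n}) + L))"
        using c k D l 2 by (intro mult_left_mono power_increasing add_right_mono card_mono) auto
      also have "\<dots> = D * (c ^ l * c ^ (n - l)) * k ^ (card (B \<inter> {m..<m + n}) + L)" by (simp add: mult_ac)
      also have "c ^ l * c ^ (n - l) = c ^ n" using l 2 by (simp flip: power_add)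
      finally show ?thesis .
    next
      case 3
      have "a m n \<le> a m 1 * a (m + 1) (n - 1)" using sub[of m 1 "n - 1"] 3 by simp
      also have "\<dots> \<le> (c * k) * (D * c ^ (n - 1) * k ^ (card (B \<inter> {m + 1..<m + 1 + (n - 1)}) + L))"
        using a1 nn c k less.IH[of "n - 1" "m + 1"] 3 by (intro mult_mono) auto
      also have "\<dots> = D * (c * c ^ (n - 1)) * k ^ (Suc (card (B \<inter> {m + 1..<m + n})) + L)"
        using 3 by (simp add: mult_ac)
      also have "c * c ^ (n - 1) = c ^ n" using 3 by (simp flip: power_Suc)
      also have "Suc (card (B \<inter> {m + 1..<m + n})) = card (B \<inter> {m..<m + n})"
      proof -
        have "B \<inter> {m..<m + n} = insert m (B \<inter> {m + 1..<m + n})" using 3 by auto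
        then show ?thesis by simp
      qed
      finally show ?thesis .
    next
      case 4
      then show ?thesis using a0[of m] D by simp
    qed
  qed
qed

text \<open>\<open>l\<close> is the upper limit, as infimum of the positive eventual upper bounds. A
  \<open>b\<close> below \<open>l\<close> is no such bound, so \<open>alt\<close> forces the
  sequence eventually above any smaller positive \<open>a\<close>.\<close>

lemma convergent_if_no_oscillation:
  fixes z :: "nat \<Rightarrow> real"
  assumes nn: "\<And>n. 0 \<le> z n" and bd: "\<forall>\<^sub>F n in sequentially. z n \<le> K"
    and alt: "\<And>a b. 0 < a \<Longrightarrow> a < b \<Longrightarrow>
      (\<forall>\<^sub>F n in sequentially. a \<le> z n) \<or> (\<forall>\<^sub>F n in sequentially. z n \<le> b)"
  shows "convergent z"
proof -
  define U where "U = {b. 0 < b \<and> (\<forall>\<^sub>F n in sequentially. z n \<le> b)}"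
  define l where "l = Inf U"
  have "max K 1 \<in> U" using bd by (auto simp: U_def elim: eventually_mono)
  moreover have bdd: "bdd_below U" by (rule bdd_belowI[of _ 0]) (simp add: U_def)
  ultimately have l0: "0 \<le> l" unfolding l_def by (intro cInf_greatest) (auto simp: U_def)
  have "z \<longlonglongrightarrow> l"
  proof (rule order_tendstoI)
    fix x assume "x < l"
    show "\<forall>\<^sub>F n in sequentially. x < z n"
    proof (cases "x < 0")
      case True
      then show ?thesis using nn by (intro always_eventually) (metis less_le_trans)
    next
      case False
      define a where "a = (2 * x + l) / 3"
      define b where "b = (x + 2 * l) / 3"
      have ab: "x < a" "0 < a" "a < b" "b < l" using \<open>x < l\<close> False l0 by (auto simp: a_def b_def)
      then have "b \<notin> U" using cInf_lower[OF _ bdd] by (force simp: l_def)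
      then have "\<forall>\<^sub>F n in sequentially. a \<le> z n" using alt[of a b] ab by (auto simp: U_def)
      then show ?thesis by eventually_elim (use ab in simp)
    qed
  next
    fix x assume "l < x"
    then have "\<exists>b\<in>U. b < x"
      using \<open>max K 1 \<in> U\<close> by (subst cInf_less_iff[symmetric, OF _ bdd]) (auto simp: l_def)
    then obtain b where "b \<in> U" "b < x" by blast
    then show "\<forall>\<^sub>F n in sequentially. z n < x"
      by (auto simp: U_def elim!: eventually_mono)
  qed
  then show ?thesis by (auto simp: convergent_def)
qed

text \<open>\<open>F\<close> is bounded above along the factors but may vanish on them, so its
  logarithm need not be finite.\<close>

locale submultiplicative_cocycle = iid_paths p
  for p :: "'w measure" +
  fixes M :: "'w \<Rightarrow> complex ^ 'n ^ 'n" and F :: "complex ^ 'n ^ 'n \<Rightarrow> real" and K :: real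
  assumes M_meas [measurable]: "M \<in> borel_measurable p"
    and F_meas [measurable]: "F \<in> borel_measurable borel"
    and F_nonneg: "\<And>A. 0 \<le> F A"
    and F_mult: "\<And>A B. F (A ** B) \<le> F A * F B"
    and F_bound: "\<And>w. w \<in> space p \<Longrightarrow> F (M w) \<le> K"
    and K_pos: "K > 0"
begin

lemma Phi_meas [measurable]: "Phi M n \<in> borel_measurable S"
  unfolding path_measure_def by (rule measurable_Phi[OF M_meas]) auto

lemma Phi_window_meas: "n \<le> L \<Longrightarrow> Phi M n \<in> borel_measurable (windows L)"
  by (rule measurable_Phi[OF M_meas]) auto

text \<open>Rational rates make this a countable union of measurable sets. Their being strictly
  below \<open>c\<close> leaves room to absorb a constant factor.\<close>

definition decaying :: "real \<Rightarrow> (nat \<Rightarrow> 'w) set" where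
  "decaying c = {w \<in> space S. \<exists>q\<in>\<rat>. 0 < q \<and> q < c \<and> (\<exists>\<^sub>F n in sequentially. F (Phi M n w) < q ^ n)}"

lemma decaying_meas: "decaying c \<in> sets S"
proof -
  have "decaying c = (\<Union>q\<in>{q\<in>\<rat>. 0 < q \<and> q < c}.
      {w \<in> space S. \<forall>N. \<exists>n\<ge>N. F (Phi M n w) < q ^ n})"
    by (auto simp: decaying_def frequently_sequentially)
  also have "\<dots> \<in> sets S"
    by (intro sets.countable_UN' countable_subset[OF _ countable_rat]) (auto intro: sets.sets_Collect_countable_All)
  finally show ?thesis .
qed

text \<open>Prepending one factor costs at most \<open>K\<close>; passing from \<open>q\<close> to a
  rational \<open>r\<close> between \<open>q\<close> and \<open>c\<close> outweighs it for large
  \<open>n\<close>.\<close>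

lemma decaying_shift:
  assumes w: "w \<in> space S" and sh: "shift 1 w \<in> decaying c"
  shows "w \<in> decaying c"
proof -
  obtain q where q: "q \<in> \<rat>" "0 < q" "q < c" "\<exists>\<^sub>F n in sequentially. F (Phi M n (shift 1 w)) < q ^ n"
    using sh by (auto simp: decaying_def)
  obtain r where r: "r \<in> \<rat>" "q < r" "r < c" using Rats_dense_in_real[OF q(3)] by auto
  have "(\<lambda>n. K / r * (q / r) ^ n) \<longlonglongrightarrow> K / r * 0"
    by (intro tendsto_intros LIMSEQ_power_zero) (use q r in auto)
  then have "\<forall>\<^sub>F n in sequentially. K / r * (q / r) ^ n < 1" by (rule order_tendstoD) simp
  with q(4) have "\<exists>\<^sub>F n in sequentially. K / r * (q / r) ^ n < 1 \<and> F (Phi M n (shift 1 w)) < q ^ n"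
    by (rule frequently_eventually_conj)
  then have "\<exists>\<^sub>F n in sequentially. F (Phi M (Suc n) w) < r ^ Suc n"
  proof (rule frequently_elim1)
    fix n assume n: "K / r * (q / r) ^ n < 1 \<and> F (Phi M n (shift 1 w)) < q ^ n"
    have "F (Phi M (Suc n) w) \<le> F (Phi M n (shift 1 w)) * F (Phi M 1 w)"
      using Phi_add[of M 1 n w] F_mult by simp
    also have "\<dots> \<le> q ^ n * K"
    proof (rule mult_mono)
      have "w 1 \<in> space p" using w by (auto simp: space_S)
      then show "F (Phi M 1 w) \<le> K" using F_bound by simp
    qed (use n q F_nonneg in auto)
    also have "\<dots> < r ^ Suc n" using n r q by (simp add: field_simps)
    finally show "F (Phi M (Suc n) w) < r ^ Suc n" .
  qed
  then have "\<exists>\<^sub>F n in sequentially. F (Phi M n w) < r ^ n"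
    using eventually_sequentially_Suc[of "\<lambda>n. \<not> F (Phi M n w) < r ^ n"]
    unfolding frequently_def by blast
  then show ?thesis using w q r by (auto simp: decaying_def intro!: bexI[of _ r])
qed

lemma decaying_zero_one: "S.prob (decaying c) = 0 \<or> S.prob (decaying c) = 1"
  by (rule shift_zero_one_law[OF decaying_meas decaying_shift])

text \<open>No block of length at most \<open>L\<close> with decay rate \<open>c\<close> starts at
  the beginning of such a window.\<close>

definition bad_windows :: "real \<Rightarrow> nat \<Rightarrow> (nat \<Rightarrow> 'w) set" where
  "bad_windows c L = {w \<in> space (windows L). \<forall>n\<in>{1..L}. c ^ n \<le> F (Phi M n w)}"

lemma bad_windows_meas: "bad_windows c L \<in> sets (windows L)"
proof -
  have "{w \<in> space (windows L). c ^ n \<le> F (Phi M n w)} \<in> sets (windows L)"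
    if "n \<in> {1..L}" for n
  proof -
    have "Phi M n \<in> borel_measurable (windows L)" using that by (intro Phi_window_meas) simp
    then have "(\<lambda>w. F (Phi M n w)) \<in> borel_measurable (windows L)"
      using F_meas by (rule measurable_compose)
    then show ?thesis by simp
  qed
  then show ?thesis unfolding bad_windows_def by (intro sets.sets_Collect_finite_All) auto
qed

lemma window_in_bad_windows_iff:
  assumes "w \<in> space S"
  shows "window m L w \<in> bad_windows c L \<longleftrightarrow> (\<forall>n\<in>{1..L}. c ^ n \<le> F (Phi M n (shift m w)))"
  using measurable_space[OF measurable_window assms] by (simp add: bad_windows_def Phi_window)

text \<open>As \<open>L\<close> grows the bad events decrease to a set of paths outside
  \<open>decaying c\<close>, which is null.\<close>

lemma bad_windows_rare:
  assumes c: "S.prob (decaying c) = 1" and \<delta>: "\<delta> > 0"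
  obtains L where "L > 0" "measure (windows L) (bad_windows c L) < \<delta>"
proof -
  define B where "B L = window 0 L -` bad_windows c L \<inter> space S" for L
  have B: "w \<in> B L \<longleftrightarrow> w \<in> space S \<and> (\<forall>n\<in>{1..L}. c ^ n \<le> F (Phi M n w))" for w L
    by (auto simp: B_def window_in_bad_windows_iff shift_0)
  have B_meas: "B L \<in> sets S" for L
    unfolding B_def by (rule measurable_sets[OF measurable_window bad_windows_meas])
  have "(\<lambda>L. S.prob (B L)) \<longlonglongrightarrow> S.prob (\<Inter>L. B L)"
    by (rule S.finite_Lim_measure_decseq) (auto simp: B_meas decseq_def B)
  also have "S.prob (\<Inter>L. B L) = 0"
  proof -
    have "(\<Inter>L. B L) \<subseteq> space S - decaying c"
    proof
      fix w assume w: "w \<in> (\<Inter>L. B L)"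
      have ge: "c ^ n \<le> F (Phi M n w)" if "n \<ge> 1" for n using w that B[of w n] by auto
      have "w \<notin> decaying c"
      proof
        assume "w \<in> decaying c"
        then obtain q where q: "0 < q" "q < c" and fr: "\<exists>\<^sub>F n in sequentially. F (Phi M n w) < q ^ n"
          by (auto simp: decaying_def)
        from fr obtain n where n: "n \<ge> 1" "F (Phi M n w) < q ^ n"
          unfolding frequently_sequentially by blast
        have "q ^ n \<le> c ^ n" using q by (intro power_mono) auto
        then show False using ge[OF n(1)] n(2) by simp
      qed
      then show "w \<in> space S - decaying c" using w B by auto
    qed
    moreover have "S.prob (space S - decaying c) = 0"
      using c by (simp add: S.prob_compl[OF decaying_meas])
    ultimately show ?thesis
      using S.finite_measure_mono[of "\<Inter>L. B L" "space S - decaying c"] decaying_meas by (simp add: measure_le_0_iff)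
  qed
  finally have "\<forall>\<^sub>F L in sequentially. S.prob (B L) < \<delta>" using \<delta> by (rule order_tendstoD)
  then have "\<forall>\<^sub>F L in sequentially. S.prob (B L) < \<delta> \<and> L > 0"
    using eventually_gt_at_top by (rule eventually_conj)
  then obtain L where "S.prob (B L) < \<delta>" "L > 0" by (auto simp: eventually_sequentially)
  moreover have "S.prob (B L) = measure (windows L) (bad_windows c L)"
    using measure_distr[OF measurable_window[of 0 L] bad_windows_meas[of c L]] unfolding distr_window B_def by simp
  ultimately show ?thesis using that by simp
qed

lemma eventually_le_if_slow:
  assumes c: "0 < c" "c < c'" and decaying: "S.prob (decaying c) = 1"
  shows "AE w in S. \<forall>\<^sub>F n in sequentially. F (Phi M n w) \<le> c' ^ n"
proof -
  \<comment> \<open>\<open>k\<close> is the price of a bad time: a single step is bounded by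
    \<open>K\<close>, at most \<open>k\<close> times the desired factor \<open>c\<close>.\<close>
  define k where "k = max 1 (K / c)"
  \<comment> \<open>The empty block contributes \<open>F (mat 1)\<close>, which may exceed
    1.\<close>
  define D where "D = max 1 (F (mat 1))"
  define \<theta> where "\<theta> = c' / c"
  \<comment> \<open>Bad times of density \<delta> cost a factor \<open>k powr \<delta>\<close> per
    step, which must stay below \<theta>. The summand 1 keeps the denominator positive when
    \<open>k = 1\<close>.\<close>
  define \<delta> where "\<delta> = ln \<theta> / (2 * (ln k + 1))"
  have k: "1 \<le> k" "K \<le> c * k" using c by (auto simp: k_def field_simps max_def)
  have \<theta>: "1 < \<theta>" using c by (simp add: \<theta>_def)
  have \<delta>: "0 < \<delta>" using \<theta> k by (auto simp: \<delta>_def intro!: divide_pos_pos add_nonneg_pos)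
  have "\<delta> * ln k < ln \<theta>"
  proof -
    have "ln k / (2 * (ln k + 1)) < 1"
    proof -
      have ln: "0 \<le> ln k" using ln_ge_zero[OF k(1)] .
      then have "0 < 2 * (ln k + 1)" by simp
      then show ?thesis using ln by (simp only: divide_less_eq_1_pos) simp
    qed
    then have "ln \<theta> * (ln k / (2 * (ln k + 1))) < ln \<theta> * 1"
      using \<theta> by (intro mult_strict_left_mono) auto
    then show ?thesis by (simp add: \<delta>_def)
  qed
  then have k\<theta>: "k powr \<delta> < \<theta>"
    using k \<theta> by (subst ln_less_cancel_iff[symmetric]) (auto simp: ln_powr)
  obtain L where L: "L > 0" and rare: "measure (windows L) (bad_windows c L) < \<delta> / 2"
    using bad_windows_rare[OF decaying, of "\<delta> / 2"] \<delta> by auto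
  have "AE w in S. \<forall>\<^sub>F J in sequentially.
      real (card {j. j < J \<and> window (r + L * j) L w \<in> bad_windows c L}) \<le> \<delta> * J" for r
    using eventually_frequency_le[OF L bad_windows_meas[of c L] half_gt_zero[OF \<delta>], of r]
    by (rule eventually_mono)
      (use rare in \<open>auto elim!: eventually_mono order.trans intro!: mult_right_mono\<close>)
  \<comment> \<open>Overlapping windows are dependent, so bad times are counted separately in each
    residue class modulo \<open>L\<close>.\<close>
  then have "AE w in S. \<forall>r<L. \<forall>\<^sub>F J in sequentially.
      real (card {j. j < J \<and> window (r + L * j) L w \<in> bad_windows c L}) \<le> \<delta> * J"
    by (simp add: AE_all_countable)
  then show ?thesis
  proof (rule AE_mp, intro AE_I2 impI)
    fix w assume w: "w \<in> space S"
      and freq: "\<forall>r<L. \<forall>\<^sub>F J in sequentially.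
        real (card {j. j < J \<and> window (r + L * j) L w \<in> bad_windows c L}) \<le> \<delta> * J"
    define B where "B = {m. window m L w \<in> bad_windows c L}"
    have greedy: "F (Phi M n w) \<le> D * c ^ n * k ^ (card (B \<inter> {..<n}) + L)" for n
    proof -
      have "F (Phi M n (shift 0 w)) \<le> D * c ^ n * k ^ (card (B \<inter> {0..<0 + n}) + L)"
      proof (rule submultiplicative_greedy[where a = "\<lambda>m n. F (Phi M n (shift m w))"])
        show "F (Phi M (i + j) (shift m w)) \<le> F (Phi M i (shift m w)) * F (Phi M j (shift (m + i) w))" for m i j
          using F_mult[of "Phi M j (shift i (shift m w))" "Phi M i (shift m w)"]
          by (simp add: Phi_add shift_shift mult.commute add.commute)
        show "F (Phi M 1 (shift m w)) \<le> c * k" for m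
        proof -
          have "shift m w 1 \<in> space p" using w by (auto simp: shift_def space_S)
          then show ?thesis using F_bound[of "shift m w 1"] k(2) by simp
        qed
        show "\<exists>l\<in>{1..L}. F (Phi M l (shift m w)) \<le> c ^ l" if "m \<notin> B" for m
          using that window_in_bad_windows_iff[OF w, of m L c] by (force simp: B_def)
      qed (use F_nonneg c k in \<open>auto simp: D_def\<close>)
      then show ?thesis using w by (simp add: shift_0 lessThan_atLeast0)
    qed
    have count: "\<forall>\<^sub>F J in sequentially. \<forall>r<L. real (card {j. j < J \<and> r + L * j \<in> B}) \<le> \<delta> * J"
      using eventually_ball_finite[of "{..<L}" "\<lambda>J r. real (card {j. j < J \<and> r + L * j \<in> B}) \<le> \<delta> * J"] freq
      by (simp add: B_def Ball_def)
    have "filterlim (\<lambda>n. Suc (n div L)) sequentially sequentially"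
      unfolding filterlim_at_top
    proof
      fix Z
      show "\<forall>\<^sub>F n in sequentially. Z \<le> Suc (n div L)"
        using eventually_ge_at_top[of "L * Z"]
      proof eventually_elim
        case (elim n)
        then have "L * Z div L \<le> n div L" by (rule div_le_mono)
        then show ?case using L by simp
      qed
    qed
    then have "\<forall>\<^sub>F n in sequentially. \<forall>r<L. real (card {j. j < Suc (n div L) \<and> r + L * j \<in> B}) \<le> \<delta> * Suc (n div L)"
      using count by (rule eventually_compose_filterlim[rotated])
    then have cardB: "\<forall>\<^sub>F n in sequentially. real (card (B \<inter> {..<n})) \<le> \<delta> * (n + L)"
    proof eventually_elim
      case (elim n)
      define J where "J = Suc (n div L)"
      have "B \<inter> {..<n} \<subseteq> (\<Union>r\<in>{..<L}. (\<lambda>j. r + L * j) ` {j. j < J \<and> r + L * j \<in> B})"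
      proof
        fix m assume m: "m \<in> B \<inter> {..<n}"
        have "m div L < J" using m by (simp add: J_def div_le_mono less_Suc_eq_le)
        moreover have "m = m mod L + L * (m div L)" by simp
        ultimately show "m \<in> (\<Union>r\<in>{..<L}. (\<lambda>j. r + L * j) ` {j. j < J \<and> r + L * j \<in> B})"
          using m L by (intro UN_I[of "m mod L"] image_eqI[of _ _ "m div L"]) auto
      qed
      then have "card (B \<inter> {..<n}) \<le> card (\<Union>r\<in>{..<L}. (\<lambda>j. r + L * j) ` {j. j < J \<and> r + L * j \<in> B})"
        by (intro card_mono) auto
      also have "\<dots> \<le> (\<Sum>r<L. card ((\<lambda>j. r + L * j) ` {j. j < J \<and> r + L * j \<in> B}))"
        by (rule card_UN_le) simp
      also have "\<dots> \<le> (\<Sum>r<L. card {j. j < J \<and> r + L * j \<in> B})"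
        by (intro sum_mono card_image_le) auto
      finally have "real (card (B \<inter> {..<n})) \<le> (\<Sum>r<L. real (card {j. j < J \<and> r + L * j \<in> B}))"
        by (simp flip: of_nat_sum)
      also have "\<dots> \<le> (\<Sum>r<L. \<delta> * J)" using elim by (intro sum_mono) (auto simp: J_def)
      also have "\<dots> = \<delta> * real (L * J)" by simp
      also have "\<dots> \<le> \<delta> * real (n + L)"
      proof (intro mult_left_mono)
        have "L * (n div L) \<le> n" by simp
        then show "real (L * J) \<le> real (n + L)" unfolding of_nat_le_iff J_def by simp
      qed (use \<delta> in simp)
      finally show ?case by simp
    qed
    \<comment> \<open>The part of \<open>k powr (\<delta> * (n + L) + L)\<close> that does not grow
      with \<open>n\<close>, together with \<open>D\<close>; the slack between
      \<open>k powr \<delta>\<close> and \<theta> eventually absorbs it.\<close>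
    define C where "C = D * k powr (\<delta> * L + L)"
    have "(\<lambda>n. C * (k powr \<delta> / \<theta>) ^ n) \<longlonglongrightarrow> C * 0"
      by (intro tendsto_intros LIMSEQ_power_zero) (use \<theta> k\<theta> in auto)
    then have "\<forall>\<^sub>F n in sequentially. C * (k powr \<delta> / \<theta>) ^ n < 1" by (rule order_tendstoD) simp
    with cardB show "\<forall>\<^sub>F n in sequentially. F (Phi M n w) \<le> c' ^ n"
    proof eventually_elim
      case (elim n)
      have "F (Phi M n w) \<le> D * c ^ n * k powr (real (card (B \<inter> {..<n}) + L))"
        using greedy[of n] k by (subst powr_realpow) auto
      also have "\<dots> \<le> D * c ^ n * k powr (\<delta> * (n + L) + L)"
        using elim k c by (intro mult_left_mono powr_mono) (auto simp: D_def)
      also have "k powr (\<delta> * (n + L) + L) = k powr (\<delta> * L + L) * (k powr \<delta>) ^ n"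
        using k by (simp add: powr_powr powr_add[symmetric] powr_realpow[symmetric] algebra_simps)
      also have "D * c ^ n * (k powr (\<delta> * L + L) * (k powr \<delta>) ^ n)
          = (c * \<theta>) ^ n * (C * (k powr \<delta> / \<theta>) ^ n)"
        using \<theta> by (simp add: C_def power_mult_distrib power_divide)
      also have "\<dots> \<le> (c * \<theta>) ^ n * 1" using elim(2) c \<theta> by (intro mult_left_mono) auto
      also have "c * \<theta> = c'" using c by (simp add: \<theta>_def)
      finally show ?case by simp
    qed
  qed
qed

text \<open>For each level \<open>c\<close> the zero-one law leaves two cases: eventual bounds by
  every larger rational rate, or no smaller rational rate attained infinitely often. Countably many
  rational levels then exclude oscillation.\<close>

theorem convergent_growth: "AE w in S. convergent (\<lambda>n. root n (F (Phi M n w)))"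
proof -
  define bounded where "bounded c w \<longleftrightarrow>
    (\<forall>c'\<in>\<rat>. c < c' \<longrightarrow> (\<forall>\<^sub>F n in sequentially. F (Phi M n w) \<le> c' ^ n))" for c w
  have dich: "AE w in S. bounded c w \<or> w \<notin> decaying c"
    if "c > 0" for c
    using decaying_zero_one[of c]
  proof
    assume "S.prob (decaying c) = 0"
    then have "AE w in S. w \<notin> decaying c"
      using decaying_meas by (simp add: AE_iff_measurable[OF decaying_meas] S.emeasure_eq_measure AE_not_in null_setsI)
    then show ?thesis by eventually_elim simp
  next
    assume "S.prob (decaying c) = 1"
    then have "AE w in S. \<forall>\<^sub>F n in sequentially. F (Phi M n w) \<le> c' ^ n" if "c < c'" for c'
      using eventually_le_if_slow that \<open>c > 0\<close> by blast
    then have "AE w in S. bounded c w"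
      unfolding bounded_def by (subst AE_ball_countable[OF countable_rat]) auto
    then show ?thesis by eventually_elim simp
  qed
  have "AE w in S. \<forall>c\<in>{c\<in>\<rat>. c > 0}. bounded c w \<or> w \<notin> decaying c"
    by (subst AE_ball_countable) (use dich countable_rat in \<open>auto intro: countable_subset[OF _ countable_rat]\<close>)
  then show ?thesis
  proof (rule AE_mp, intro AE_I2 impI)
    fix w assume w: "w \<in> space S" and D: "\<forall>c\<in>{c\<in>\<rat>. c > 0}. bounded c w \<or> w \<notin> decaying c"
    define y where "y n = F (Phi M n w)" for n
    have y0: "0 \<le> y n" for n by (simp add: y_def F_nonneg)
    have up: "root n (y n) \<le> b" if "n > 0" "y n \<le> b ^ n" "0 \<le> b" for n b
      using real_root_le_mono[OF that(1,2)] that by (simp add: real_root_power_cancel)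
    have lo: "a \<le> root n (y n)" if "n > 0" "a ^ n \<le> y n" "0 \<le> a" for n a
      using real_root_le_mono[OF that(1,2)] that by (simp add: real_root_power_cancel)
    have yK: "y n \<le> K ^ n" if "n > 0" for n
      using that unfolding y_def
    proof (induction n rule: nat_induct_non_zero)
      case 1
      have "w 1 \<in> space p" using w by (auto simp: space_S)
      then show ?case using F_bound by simp
    next
      case (Suc n)
      have "w (Suc n) \<in> space p" using w by (auto simp: space_S)
      then have "F (M (w (Suc n))) * F (Phi M n w) \<le> K * K ^ n"
        using F_bound Suc.IH K_pos F_nonneg by (intro mult_mono) auto
      then show ?case using F_mult[of "M (w (Suc n))" "Phi M n w"] by simp
    qed
    have "convergent (\<lambda>n. root n (y n))"
    proof (rule convergent_if_no_oscillation[where K = K])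
      show "0 \<le> root n (y n)" for n using y0 by (cases "n = 0") (auto simp: real_root_ge_zero)
      show "\<forall>\<^sub>F n in sequentially. root n (y n) \<le> K"
        using eventually_gt_at_top[of 0] by eventually_elim (use yK up K_pos in auto)
      fix a b :: real assume ab: "0 < a" "a < b"
      \<comment> \<open>The order is \<open>a < q < c < c' < b\<close>: one alternative at level
        \<open>c\<close> bounds by \<open>c'\<close> from above, the other by \<open>q\<close> from
        below.\<close>
      obtain c where c: "c \<in> \<rat>" "a < c" "c < b" using Rats_dense_in_real[OF ab(2)] by auto
      obtain c' where c': "c' \<in> \<rat>" "c < c'" "c' < b" using Rats_dense_in_real[OF c(3)] by auto
      obtain q where q: "q \<in> \<rat>" "a < q" "q < c" using Rats_dense_in_real[OF c(2)] by auto
      have "(\<forall>\<^sub>F n in sequentially. y n \<le> c' ^ n) \<or> w \<notin> decaying c"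
        using D c c' ab by (auto simp: y_def bounded_def)
      then show "(\<forall>\<^sub>F n in sequentially. a \<le> root n (y n)) \<or> (\<forall>\<^sub>F n in sequentially. root n (y n) \<le> b)"
      proof
        assume "\<forall>\<^sub>F n in sequentially. y n \<le> c' ^ n"
        then have "\<forall>\<^sub>F n in sequentially. root n (y n) \<le> b"
          using eventually_gt_at_top[of 0]
          proof eventually_elim
            case (elim n)
            have "root n (y n) \<le> c'" by (rule up) (use elim c c' ab in linarith)+
            then show ?case using c' by linarith
          qed
        then show ?thesis ..
      next
        assume "w \<notin> decaying c"
        then have "\<not> (\<exists>\<^sub>F n in sequentially. y n < q ^ n)"
          using w q ab by (auto simp: decaying_def y_def)
        then have "\<forall>\<^sub>F n in sequentially. q ^ n \<le> y n"
          by (simp add: frequently_def not_less)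
        then have "\<forall>\<^sub>F n in sequentially. a \<le> root n (y n)"
          using eventually_gt_at_top[of 0]
          proof eventually_elim
            case (elim n)
            have "q \<le> root n (y n)" by (rule lo) (use elim q ab in linarith)+
            then show ?case using q by linarith
          qed
        then show ?thesis ..
      qed
    qed
    then show "convergent (\<lambda>n. root n (F (Phi M n w)))" by (simp add: y_def)
  qed
qed

end


section \<open>Powers of matrices and spectral conditions\<close>

lemma is_norm_equiv:
  fixes N :: "complex ^ 'n \<Rightarrow> real"
  assumes N: "is_norm N"
  obtains a b where "0 < a" "0 < b" "\<And>x. a * norm x \<le> N x" "\<And>x. N x \<le> b * norm x"
proof -
  have tri: "N (x + y) \<le> N x + N y" and hom: "N (c *s x) = cmod c * N x"
    and zero: "N x = 0 \<longleftrightarrow> x = 0" for x y c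
    using N by (auto simp: is_norm_def)
  have neg: "N (- x) = N x" for x using hom[of "-1" x] by simp
  have nonneg: "0 \<le> N x" for x
    using tri[of x "- x"] by (simp add: neg zero[THEN iffD2])
  have sum: "N (\<Sum>i\<in>I. f i) \<le> (\<Sum>i\<in>I. N (f i))" for I :: "'n set" and f
  proof (induction I rule: infinite_finite_induct)
    case (insert i I)
    then show ?case using tri[of "f i" "\<Sum>i\<in>I. f i"] by simp
  qed (simp_all add: zero[THEN iffD2])
  define b where "b = 1 + (\<Sum>i\<in>UNIV. N (axis i 1))"
  have b: "b > 0" by (simp add: b_def add_pos_nonneg sum_nonneg nonneg)
  have upper: "N x \<le> b * norm x" for x
  proof -
    have "x = (\<Sum>i\<in>UNIV. x $ i *s axis i 1)"
      by (simp add: vec_eq_iff axis_def if_distrib[where f="\<lambda>t. _ * t"] cong: if_cong)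
    then have "N x \<le> (\<Sum>i\<in>UNIV. N (x $ i *s axis i 1))" using sum by metis
    also have "\<dots> \<le> (\<Sum>i\<in>UNIV. norm x * N (axis i 1))"
      unfolding hom by (intro sum_mono mult_right_mono nonneg Finite_Cartesian_Product.norm_nth_le)
    also have "\<dots> \<le> b * norm x"
      by (simp add: b_def sum_distrib_left[symmetric] algebra_simps)
    finally show ?thesis .
  qed
  have "\<bar>N x - N y\<bar> \<le> b * norm (x - y)" for x y
    using tri[of "x - y" y] tri[of "y - x" x] upper[of "x - y"] upper[of "y - x"]
    by (simp add: norm_minus_commute)
  then have "continuous_on UNIV N"
    by (intro lipschitz_on_continuous_on[of b] lipschitz_onI) (use b in \<open>auto simp: dist_norm\<close>)
  then have cont: "continuous_on (sphere 0 1) N" by (rule continuous_on_subset) simp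
  obtain u where u: "u \<in> sphere 0 1" "\<And>y. y \<in> sphere 0 1 \<Longrightarrow> N u \<le> N y"
    using continuous_attains_inf[OF compact_sphere _ cont] by auto
  have a: "N u > 0" using u(1) nonneg[of u] zero[of u] by fastforce
  have "N u * norm x \<le> N x" for x
  proof (cases "x = 0")
    case False
    define y where "y = complex_of_real (1 / norm x) *s x"
    have "y \<in> sphere 0 1" using False by (simp add: y_def norm_vector_smult norm_divide)
    then have "N u \<le> N y" by (rule u(2))
    also have "N y = N x / norm x" by (simp add: y_def hom norm_divide)
    finally show ?thesis using False by (simp add: field_simps)
  qed (use nonneg in simp)
  with a b upper that show ?thesis by blast
qed

section \<open>Powers of a matrix whose eigenvalues lie in the open unit disc\<close>

lemma exists_linear_relation:
  fixes f :: "nat \<Rightarrow> 'a :: euclidean_space"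
  assumes "DIM('a) \<le> m"
  obtains c :: "nat \<Rightarrow> real" where "\<exists>i\<le>m. c i \<noteq> 0" "(\<Sum>i\<le>m. c i *\<^sub>R f i) = 0"
proof (cases "inj_on f {..m}")
  case True
  have "card (f ` {..m}) > DIM('a)" using assms True by (simp add: card_image)
  then have "dependent (f ` {..m})" using independent_bound by fastforce
  then obtain u where u: "\<exists>v\<in>f ` {..m}. u v \<noteq> 0" "(\<Sum>v\<in>f ` {..m}. u v *\<^sub>R v) = 0"
    by (subst (asm) dependent_finite) auto
  show ?thesis
    by (rule that[of "u \<circ> f"]) (use u True in \<open>auto simp: sum.reindex\<close>)
next
  case False
  then obtain i j where ij: "i \<le> m" "j \<le> m" "i \<noteq> j" "f i = f j" by (auto simp: inj_on_def)
  define c where "c k = (if k = i then 1 else if k = j then -1 else 0 :: real)" for k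
  have "(\<Sum>k\<le>m. c k *\<^sub>R f k) = (\<Sum>k\<le>m. (if k = i then f i else 0) - (if k = j then f i else 0))"
    by (rule sum.cong) (use ij in \<open>auto simp: c_def\<close>)
  also have "\<dots> = 0" using ij by (simp add: sum_subtractf)
  finally show ?thesis by (intro that[of c]) (use ij in \<open>auto simp: c_def\<close>)
qed

lemma tendsto_zero_if_contracting_recursion:
  fixes z e :: "nat \<Rightarrow> complex ^ 'n"
  assumes rec: "\<And>k. z (Suc k) = l *s z k + e k" and l: "cmod l < 1" and e: "e \<longlonglongrightarrow> 0"
  shows "z \<longlonglongrightarrow> 0"
proof (rule tendstoI)
  fix \<epsilon> :: real assume \<epsilon>: "\<epsilon> > 0"
  \<comment> \<open>With errors below this size, \<epsilon>/2 is a fixed point of the majorizing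
    recursion, so the initial value alone enters the decaying term.\<close>
  have "0 < (1 - cmod l) * (\<epsilon> / 2)" using l \<epsilon> by simp
  from tendstoD[OF e this] obtain k0 where k0: "\<And>k. k \<ge> k0 \<Longrightarrow> norm (e k) < (1 - cmod l) * (\<epsilon> / 2)"
    by (auto simp: eventually_sequentially)
  have bd: "norm (z (j + k0)) \<le> cmod l ^ j * norm (z k0) + \<epsilon> / 2" for j
  proof (induction j)
    case (Suc j)
    have "norm (z (Suc j + k0)) \<le> cmod l * norm (z (j + k0)) + norm (e (j + k0))"
      by (simp add: rec norm_vector_smult[symmetric] norm_triangle_ineq)
    also have "\<dots> \<le> cmod l * (cmod l ^ j * norm (z k0) + \<epsilon> / 2) + (1 - cmod l) * (\<epsilon> / 2)"
      using Suc.IH k0[of "j + k0"] by (intro add_mono mult_left_mono) auto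
    finally show ?case by (simp add: field_simps)
  qed (use \<epsilon> in simp)
  have "(\<lambda>j. cmod l ^ j * norm (z k0)) \<longlonglongrightarrow> 0 * norm (z k0)"
    by (intro tendsto_intros LIMSEQ_power_zero) (use l in simp)
  then have "\<forall>\<^sub>F j in sequentially. cmod l ^ j * norm (z k0) < \<epsilon> / 2"
    by (rule order_tendstoD) (use \<epsilon> in simp)
  then have "\<forall>\<^sub>F j in sequentially. dist (z (j + k0)) 0 < \<epsilon>"
  proof eventually_elim
    case (elim j)
    then show ?case using bd[of j] by simp
  qed
  then show "\<forall>\<^sub>F k in sequentially. dist (z k) 0 < \<epsilon>"
    by (rule eventually_sequentially_seg[THEN iffD1])
qed

lemma mat_power_vec_Suc: "mat_power B k *v (B *v x) = mat_power B (Suc k) *v x"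
proof (induction k)
  case 0
  then show ?case by (simp add: mat_power_def)
next
  case (Suc k)
  then show ?case by (simp add: mat_power_Suc flip: matrix_vector_mul_assoc)
qed

text \<open>An annihilating polynomial of \<open>x\<close> splits into linear factors \<open>B - l\<close>; factors with \<open>l\<close>
  outside the spectrum are invertible, and the others have \<open>|l| < 1\<close>.\<close>

lemma mat_power_vec_tendsto_0:
  fixes B :: "complex ^ 'n ^ 'n"
  assumes spec: "\<And>l. l \<in> eigenvalues B \<Longrightarrow> cmod l < 1"
  shows "(\<lambda>k. mat_power B k *v x) \<longlonglongrightarrow> 0"
proof -
  have claim: "(\<lambda>k. mat_power B k *v x) \<longlonglongrightarrow> 0"
    if "p \<noteq> 0" "(\<Sum>i\<le>degree p. coeff p i *s (mat_power B i *v x)) = 0" for p x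
    using that
  proof (induction "degree p" arbitrary: p x)
    case 0
    then have "coeff p 0 \<noteq> 0" using leading_coeff_0_iff[of p] by simp
    then have "x = 0" using 0 by (simp add: mat_power_def)
    then show ?case by simp
  next
    case (Suc m)
    have "\<not> constant (poly p)" using Suc.hyps(2) by (simp add: constant_degree)
    then obtain l where "poly p l = 0" using fundamental_theorem_of_algebra by blast
    then obtain q where q: "p = [:- l, 1:] * q" by (metis poly_eq_0_iff_dvd dvdE)
    have q0: "q \<noteq> 0" using q Suc.prems(1) by auto
    have "degree p = degree [:- l, 1:] + degree q" unfolding q by (rule degree_mult_eq) (use q0 in auto)
    then have m: "m = degree q" using Suc.hyps(2) by simp
    \<comment> \<open>\<open>y\<close> is annihilated by the cofactor \<open>q\<close>, of smaller
      degree, so its orbit tends to 0 by induction; the orbit of \<open>x\<close> is then recovered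
      by solving for \<open>B - l\<close>.\<close>
    define y where "y = B *v x - l *s x"
    have coeff_p: "coeff p i = (case i of 0 \<Rightarrow> 0 | Suc j \<Rightarrow> coeff q j) - l * coeff q i" for i
      by (cases i) (simp_all add: q)
    have My: "mat_power B k *v y = mat_power B (Suc k) *v x - l *s (mat_power B k *v x)" for k
      by (simp add: y_def matrix_vector_mult_diff_distrib mat_power_vec_Suc vec.scale)
    have "(\<Sum>i\<le>degree q. coeff q i *s (mat_power B i *v y))
        = (\<Sum>i\<le>m. coeff q i *s (mat_power B (Suc i) *v x)) - (\<Sum>i\<le>m. (l * coeff q i) *s (mat_power B i *v x))"
      unfolding m by (simp add: My vec.scale_right_diff_distrib sum_subtractf mult.commute)
    also have "(\<Sum>i\<le>m. coeff q i *s (mat_power B (Suc i) *v x))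
        = (\<Sum>i\<le>Suc m. (case i of 0 \<Rightarrow> 0 | Suc j \<Rightarrow> coeff q j) *s (mat_power B i *v x))"
      by (subst sum.atMost_Suc_shift) simp
    also have "(\<Sum>i\<le>m. (l * coeff q i) *s (mat_power B i *v x))
        = (\<Sum>i\<le>Suc m. (l * coeff q i) *s (mat_power B i *v x))"
      using m by (simp add: coeff_eq_0)
    also have "(\<Sum>i\<le>Suc m. (case i of 0 \<Rightarrow> 0 | Suc j \<Rightarrow> coeff q j) *s (mat_power B i *v x))
        - (\<Sum>i\<le>Suc m. (l * coeff q i) *s (mat_power B i *v x))
        = (\<Sum>i\<le>degree p. coeff p i *s (mat_power B i *v x))"
      unfolding Suc.hyps(2)[symmetric] coeff_p by (simp only: sum_subtractf[symmetric] vec.scale_left_diff_distrib)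
    finally have "(\<Sum>i\<le>degree q. coeff q i *s (mat_power B i *v y)) = 0" using Suc.prems(2) by simp
    then have y0: "(\<lambda>k. mat_power B k *v y) \<longlonglongrightarrow> 0" by (rule Suc.hyps(1)[OF m q0])
    show ?case
    proof (cases "l \<in> eigenvalues B")
      case True
      then have l: "cmod l < 1" by (rule spec)
      show ?thesis
        by (rule tendsto_zero_if_contracting_recursion[OF _ l y0]) (simp add: My)
    next
      case False
      have "\<forall>x. (B - mat l) *v x = 0 \<longrightarrow> x = 0"
      proof (intro allI impI)
        fix x assume "(B - mat l) *v x = 0"
        then have "B *v x = l *s x" by (simp add: matrix_vector_mult_diff_rdistrib mat_mult_vec)
        then show "x = 0" using False by (auto simp: eigenvalues_def)
      qed
      then obtain C where C: "C ** (B - mat l) = mat 1" using matrix_left_invertible_ker by blast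
      have "mat_power B k *v x = C *v (mat_power B k *v y)" for k
      proof -
        have "mat_power B k *v y = (B - mat l) *v (mat_power B k *v x)"
          by (simp add: My matrix_vector_mult_diff_rdistrib mat_mult_vec mat_power_Suc
              flip: matrix_vector_mul_assoc)
        then show ?thesis by (metis C matrix_vector_mul_assoc matrix_vector_mul_lid)
      qed
      moreover have "(\<lambda>k. C *v (mat_power B k *v y)) \<longlonglongrightarrow> C *v 0"
        by (rule bounded_linear.tendsto[OF bounded_linear_matrix_vec y0])
      ultimately show ?thesis by simp
    qed
  qed
  obtain c :: "nat \<Rightarrow> real" where c: "\<exists>i\<le>DIM(complex ^ 'n). c i \<noteq> 0"
    "(\<Sum>i\<le>DIM(complex ^ 'n). c i *\<^sub>R (mat_power B i *v x)) = 0"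
    by (rule exists_linear_relation[OF order_refl])
  define p where "p = (\<Sum>i\<le>DIM(complex ^ 'n). monom (complex_of_real (c i)) i)"
  have coeff_p: "coeff p i = (if i \<le> DIM(complex ^ 'n) then complex_of_real (c i) else 0)" for i
    by (simp add: p_def coeff_sum)
  have "p \<noteq> 0" using c(1) coeff_p by (metis coeff_0 of_real_eq_0_iff)
  moreover have "(\<Sum>i\<le>degree p. coeff p i *s (mat_power B i *v x)) = 0"
  proof -
    have "degree p \<le> DIM(complex ^ 'n)" using coeff_p by (intro degree_le) simp
    then have "(\<Sum>i\<le>degree p. coeff p i *s (mat_power B i *v x))
        = (\<Sum>i\<le>DIM(complex ^ 'n). coeff p i *s (mat_power B i *v x))"
      by (intro sum.mono_neutral_left) (auto simp: coeff_eq_0)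
    also have "\<dots> = (\<Sum>i\<le>DIM(complex ^ 'n). c i *\<^sub>R (mat_power B i *v x))"
      by (rule sum.cong) (simp_all add: coeff_p scaleR_eq_vector_smult)
    finally show ?thesis using c(2) by simp
  qed
  ultimately show ?thesis by (rule claim)
qed

lemma mat_power_tendsto_0:
  fixes B :: "complex ^ 'n ^ 'n"
  assumes "\<And>l. l \<in> eigenvalues B \<Longrightarrow> cmod l < 1"
  shows "mat_power B \<longlonglongrightarrow> 0"
proof (intro vec_tendstoI)
  fix i j
  have "(\<lambda>k. (mat_power B k *v axis j 1) $ i) \<longlonglongrightarrow> 0 $ i"
    by (intro tendsto_vec_nth mat_power_vec_tendsto_0 assms)
  then show "(\<lambda>k. mat_power B k $ i $ j) \<longlonglongrightarrow> 0 $ i $ j" by (simp add: matrix_vec_axis_nth)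
qed

text \<open>Every eigenvalue has modulus at most \<open>norm A\<close>, so \<open>norm A + 1\<close>
  is not a root.\<close>

lemma charpoly_nonzero: "charpoly A \<noteq> 0"
proof
  assume "charpoly A = 0"
  then have "complex_of_real (norm A + 1) \<in> eigenvalues A" by (simp add: eigenvalues_eq_roots)
  then obtain x where "x \<noteq> 0" "A *v x = complex_of_real (norm A + 1) *s x"
    by (auto simp: eigenvalues_def)
  moreover have "cmod (complex_of_real (norm A + 1)) = norm A + 1"
    unfolding norm_of_real by simp
  ultimately have "(norm A + 1) * norm x \<le> norm A * norm x" "norm x > 0"
    using norm_matrix_vec_le[of A x] norm_vector_smult[of "complex_of_real (norm A + 1)" x] by simp_all
  then show False by (simp add: algebra_simps)
qed

text \<open>If \<open>A x = x + c \<psi>\<close> for some \<open>x\<close> orthogonal to \<open>\<psi>\<close>, then \<open>(z - 1)\<^sup>2\<close> divides the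
  characteristic polynomial.\<close>

lemma alg_mult_1_imp_no_generalized_eigenvector:
  fixes A :: "complex ^ 'n ^ 'n"
  assumes mult: "alg_mult A 1 = 1" and A\<psi>: "A *v \<psi> = \<psi>" and \<psi>: "norm \<psi> = 1"
    and x: "norm x = 1" "cinner \<psi> x = 0"
  shows "A *v x \<noteq> x + c *s \<psi>"
proof
  assume Ax: "A *v x = x + c *s \<psi>"
  define v :: "nat \<Rightarrow> complex ^ 'n" where "v i = (if i = 0 then \<psi> else x)" for i
  have "cinner x \<psi> = 0" using x(2) by (subst cinner_commute) simp
  then have onv: "onfam 2 v" using \<psi> x by (auto simp: onfam_def v_def cinner_self less_2_cases_iff)
  have d2: "2 \<le> CARD('n)"
  proof (rule ccontr)
    assume "\<not> 2 \<le> CARD('n)"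
    moreover have "0 < CARD('n)" by simp
    ultimately have d1: "CARD('n) = 1" by linarith
    then have "onfam CARD('n) (\<lambda>_. \<psi>)" using \<psi> by (simp add: onfam_def cinner_self)
    then have "(\<Sum>i<CARD('n). cinner \<psi> x *s \<psi>) = x" by (rule onfam_expand)
    then show False using x by simp
  qed
  obtain u where on: "onfam CARD('n) u" and uv: "\<And>i. i < 2 \<Longrightarrow> u i = v i"
    using onfam_extend[OF onv d2] by blast
  obtain f :: "'n \<Rightarrow> nat" and V where f: "bij_betw f UNIV {..<CARD('n)}"
    and VV: "adjoint_mat V ** V = mat 1" and col: "\<And>k. column k V = u (f k)"
    using onfam_unitary[OF on] by metis
  have "f ` UNIV = {..<CARD('n)}" using f by (simp add: bij_betw_def)
  then have "0 \<in> f ` UNIV" "1 \<in> f ` UNIV" using d2 by auto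
  then obtain k0 k1 where k: "f k0 = 0" "f k1 = 1" by (elim imageE) (rule that, simp_all)
  have k01: "k1 \<noteq> k0" using k by auto
  have dV: "det V \<noteq> 0" using VV by (metis det_I det_mul mult_zero_right zero_neq_one)
  \<comment> \<open>The transpose turns the images of the basis vectors into rows, to which the
    determinant rules for row operations apply.\<close>
  define W where "W z = transpose ((mat z - A) ** V)" for z
  have row_W: "row k (W z) = z *s u (f k) - A *v u (f k)" for k z
  proof -
    have "row k (W z) = (mat z - A) *v column k V"
      by (simp add: W_def vec_eq_iff row_def transpose_def matrix_matrix_mult_def
          matrix_vector_mult_def column_def)
    then show ?thesis by (simp add: col matrix_vector_mult_diff_rdistrib mat_mult_vec)
  qed
  have W0: "row k0 (W z) = (z - 1) *s \<psi>" for z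
    using uv[of 0] by (simp add: row_W k v_def A\<psi> vec.scale_left_diff_distrib)
  have W1: "row k1 (W z) = (z - 1) *s x - c *s \<psi>" for z
    using uv[of 1] by (simp add: row_W k v_def Ax vec.scale_left_diff_distrib)
  define G where "G z = (\<chi> k. if k = k0 then \<psi> else if k = k1 then x else row k (W z))" for z
  have det_W: "det (W z) = (z - 1)\<^sup>2 * det (G z)" for z
  proof -
    define W' where "W' = (\<chi> k. if k = k0 then \<psi> else row k (W z))"
    have "W z = (\<chi> k. if k = k0 then (z - 1) *s \<psi> else row k (W z))"
      using W0[of z] by (simp add: vec_eq_iff row_def)
    then have "det (W z) = det (\<chi> k. if k = k0 then (z - 1) *s \<psi> else row k (W z))"
      by (rule arg_cong)
    also have "\<dots> = (z - 1) * det W'" unfolding W'_def by (rule det_row_mul)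
    \<comment> \<open>Row \<open>k0\<close> is already \<psi>, freed of its factor
      \<open>z - 1\<close>. Adding \<open>c\<close> times it turns row \<open>k1\<close> into
      \<open>(z - 1) *s x\<close>, which releases the second factor.\<close>
    also have "det W' = det (\<chi> k. if k = k1 then row k1 W' + c *s row k0 W' else row k W')"
      by (rule det_row_operation[OF k01, symmetric])
    also have "(\<chi> k. if k = k1 then row k1 W' + c *s row k0 W' else row k W')
        = (\<chi> k. if k = k1 then (z - 1) *s x else row k (G z))"
      using k01 W1[of z] by (auto simp: vec_eq_iff row_def W'_def G_def)
    also have "det \<dots> = (z - 1) * det (\<chi> k. if k = k1 then x else row k (G z))"
      by (rule det_row_mul)
    also have "(\<chi> k. if k = k1 then x else row k (G z)) = G z"
      using k01 by (auto simp: vec_eq_iff row_def G_def)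
    finally show ?thesis by (simp add: power2_eq_square)
  qed
  have factor: "poly (charpoly A) z * det V = (z - 1)\<^sup>2 * det (G z)" for z
    using det_W[of z] by (simp add: W_def poly_charpoly det_mul)
  have cp0: "charpoly A \<noteq> 0" by (rule charpoly_nonzero)
  obtain q where q: "charpoly A = [:-1, 1:] * q" "\<not> [:-1, 1:] dvd q"
    using order_decomp[OF cp0, of 1] mult by (auto simp: alg_mult_def)
  have q1: "poly q 1 \<noteq> 0" using q(2) by (simp add: poly_eq_0_iff_dvd)
  \<comment> \<open>A sequence tending to 1 but avoiding it: one factor \<open>z - 1\<close> can be
    cancelled along it, and the other makes the limit vanish. For \<open>det (G z)\<close>
    continuity at 1 is enough.\<close>
  define y where "y n = 1 + complex_of_real (inverse (real (Suc n)))" for n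
  have y: "y \<longlonglongrightarrow> 1 + complex_of_real 0"
    unfolding y_def by (intro tendsto_intros LIMSEQ_inverse_real_of_nat)
  have ne: "y n \<noteq> 1" for n unfolding y_def by (simp del: of_nat_Suc)
  have "poly q (y n) * det V = (y n - 1) * det (G (y n))" for n
  proof -
    have "(y n - 1) * (poly q (y n) * det V) = (y n - 1) * ((y n - 1) * det (G (y n)))"
      using factor[of "y n"] by (simp add: q power2_eq_square algebra_simps)
    then show ?thesis using ne by simp
  qed
  moreover have "(\<lambda>n. poly q (y n) * det V) \<longlonglongrightarrow> poly q 1 * det V"
    using y by (intro tendsto_intros) simp
  ultimately have "(\<lambda>n. (y n - 1) * det (G (y n))) \<longlonglongrightarrow> poly q 1 * det V" by simp
  moreover have "(\<lambda>n. (y n - 1) * det (G (y n))) \<longlonglongrightarrow> (1 - 1) * det (G 1)"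
  proof (intro tendsto_mult tendsto_diff tendsto_const tendsto_det)
    show "y \<longlonglongrightarrow> 1" using y by simp
    show "(\<lambda>n. G (y n)) \<longlonglongrightarrow> G 1"
    proof (intro vec_tendstoI)
      fix i j
      show "(\<lambda>n. G (y n) $ i $ j) \<longlonglongrightarrow> G 1 $ i $ j"
        using tendsto_mult[OF y tendsto_const[of "u (f i) $ j"]]
        unfolding G_def row_W by (auto intro!: tendsto_diff tendsto_const)
    qed
  qed
  ultimately have "poly q 1 * det V = (1 - 1) * det (G 1)" by (rule LIMSEQ_unique)
  then show False using q1 dV by simp
qed


section \<open>Reduced dynamics modulo the invariant vector\<close>

text \<open>Otherwise every value in \<open>X\<close> would have a null neighbourhood; by Lindelof
  countably many of these would cover all such values and make the event null.\<close>

lemma exists_in_support: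
  fixes f :: "'a \<Rightarrow> 'b :: second_countable_topology"
  assumes f: "f \<in> borel_measurable m" and X: "emeasure m {w \<in> space m. f w \<in> X} \<noteq> 0"
    and fin: "{w \<in> space m. f w \<in> X} \<in> sets m"
  obtains (witness) w where "w \<in> space m" "f w \<in> X"
    "\<And>U. open U \<Longrightarrow> f w \<in> U \<Longrightarrow> emeasure m {w \<in> space m. f w \<in> U} \<noteq> 0"
proof (rule ccontr)
  assume "\<not> thesis"
  have ex: "\<exists>U. open U \<and> f w \<in> U \<and> emeasure m {w \<in> space m. f w \<in> U} = 0"
    if w: "w \<in> space m" "f w \<in> X" for w
  proof (rule ccontr)
    assume "\<not> ?thesis"
    then have "\<And>U. open U \<Longrightarrow> f w \<in> U \<Longrightarrow> emeasure m {w \<in> space m. f w \<in> U} \<noteq> 0" by blast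
    then have thesis by (rule witness[OF w])
    with \<open>\<not> thesis\<close> show False ..
  qed
  define \<F> where "\<F> = {U. open U \<and> emeasure m {w \<in> space m. f w \<in> U} = 0}"
  obtain \<F>' where F': "\<F>' \<subseteq> \<F>" "countable \<F>'" "\<Union>\<F>' = \<Union>\<F>"
    using Lindelof[of \<F>] by (auto simp: \<F>_def)
  have "{w \<in> space m. f w \<in> U} \<in> null_sets m" if "U \<in> \<F>'" for U
  proof -
    have "open U" using F'(1) that by (auto simp: \<F>_def)
    then have "f -` U \<inter> space m \<in> sets m" by (intro measurable_sets[OF f]) simp
    moreover have "f -` U \<inter> space m = {w \<in> space m. f w \<in> U}" by auto
    ultimately show ?thesis using F'(1) that by (auto simp: \<F>_def)
  qed
  then have null: "(\<Union>U\<in>\<F>'. {w \<in> space m. f w \<in> U}) \<in> null_sets m"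
    by (rule null_sets_UN'[OF F'(2)])
  have "{w \<in> space m. f w \<in> X} \<subseteq> (\<Union>U\<in>\<F>'. {w \<in> space m. f w \<in> U})"
  proof
    fix w assume w: "w \<in> {w \<in> space m. f w \<in> X}"
    then obtain U where "U \<in> \<F>" "f w \<in> U" using ex[of w] by (auto simp: \<F>_def)
    then have "f w \<in> \<Union>\<F>'" unfolding F'(3) by blast
    then show "w \<in> (\<Union>U\<in>\<F>'. {w \<in> space m. f w \<in> U})" using w by auto
  qed
  then have "{w \<in> space m. f w \<in> X} \<in> null_sets m" by (rule null_sets_subset[OF null fin])
  then show False using X by (simp add: null_setsD1)
qed

lemma Phi_near_mat_power:
  fixes A :: "complex ^ 'n ^ 'n"
  assumes "e > 0"
  shows "\<exists>\<epsilon>>0. \<forall>w. (\<forall>i\<in>{1..k}. dist (M (w i)) A < \<epsilon>) \<longrightarrow> dist (Phi M k w) (mat_power A k) < e"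
  using assms
proof (induction k arbitrary: e)
  case 0
  then show ?case by (auto simp: mat_power_def intro: exI[of _ 1])
next
  case (Suc k)
  have "continuous_on UNIV (\<lambda>x :: (complex ^ 'n ^ 'n) \<times> (complex ^ 'n ^ 'n). fst x ** snd x)"
    unfolding matrix_matrix_mult_def by (intro continuous_intros continuous_on_vec_lambda)
  then obtain d where d: "d > 0"
    "\<And>x. dist x (A, mat_power A k) < d \<Longrightarrow> dist (fst x ** snd x) (A ** mat_power A k) < e"
    using Suc.prems unfolding continuous_on_iff by (metis UNIV_I fst_conv snd_conv)
  obtain \<epsilon> where \<epsilon>: "\<epsilon> > 0"
    "\<And>w. (\<forall>i\<in>{1..k}. dist (M (w i)) A < \<epsilon>) \<Longrightarrow> dist (Phi M k w) (mat_power A k) < d / 2"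
    using Suc.IH[of "d / 2"] d(1) by auto
  show ?case
  proof (intro exI[of _ "min \<epsilon> (d / 2)"] conjI allI impI)
    fix w assume w: "\<forall>i\<in>{1..Suc k}. dist (M (w i)) A < min \<epsilon> (d / 2)"
    have "dist (M (w (Suc k)), Phi M k w) (A, mat_power A k)
        \<le> dist (M (w (Suc k))) A + dist (Phi M k w) (mat_power A k)"
      unfolding dist_Pair_Pair by (intro sqrt_sum_squares_le_sum) auto
    also have "\<dots> < d / 2 + d / 2"
      using w \<epsilon>(2)[of w] by (intro add_strict_mono) auto
    finally show "dist (Phi M (Suc k) w) (mat_power A (Suc k)) < e"
      using d(2)[of "(M (w (Suc k)), Phi M k w)"] by (simp add: mat_power_Suc)
  qed (use \<epsilon> d in auto)
qed

locale reduced_dynamics = iid_paths p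
  for p :: "'w measure" +
  fixes N :: "complex ^ 'n \<Rightarrow> real" and \<psi> :: "complex ^ 'n" and M :: "'w \<Rightarrow> complex ^ 'n ^ 'n"
    and a b :: real
  assumes M_meas [measurable]: "M \<in> borel_measurable p"
    and norm_N: "is_norm N"
    and a: "0 < a" "\<And>x. a * norm x \<le> N x"
    and b: "0 < b" "\<And>x. N x \<le> b * norm x"
    and contraction: "\<And>w x. w \<in> space p \<Longrightarrow> N (M w *v x) \<le> N x"
    and norm_\<psi>: "norm \<psi> = 1"
    and invariant: "\<And>w. w \<in> space p \<Longrightarrow> M w *v \<psi> = \<psi>"
begin

text \<open>The orthogonal complement of \<psi> serves as a model of the quotient space, with
  \<open>proj\<close> as the quotient map.\<close>

definition proj :: "complex ^ 'n ^ 'n" where "proj = mat 1 - ketbra \<psi> \<psi>"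

lemma proj_vec: "proj *v x = x - cinner \<psi> x *s \<psi>"
  by (simp add: proj_def matrix_vector_mult_diff_rdistrib ketbra_mult_vec)

lemma cinner_\<psi>\<psi>: "cinner \<psi> \<psi> = 1"
  by (simp add: cinner_self norm_\<psi>)

lemma cinner_proj: "cinner \<psi> (proj *v x) = 0"
  by (simp add: proj_vec cinner_diff_right cinner_\<psi>\<psi>)

lemma proj_add_\<psi>: "proj *v (x + c *s \<psi>) = proj *v x"
  by (simp add: proj_vec cinner_add_right cinner_\<psi>\<psi> vec.scale_left_distrib)

lemma norm_proj_le: "norm (proj *v x) \<le> norm x"
proof -
  define c where "c = cinner \<psi> x"
  have "x = proj *v x + c *s \<psi>" by (simp add: proj_vec c_def)
  moreover have "orthogonal (proj *v x) (c *s \<psi>)"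
    using cinner_proj[of x] cinner_commute[of \<psi> "proj *v x"]
    by (simp add: orthogonal_def flip: Re_cinner)
  ultimately have "(norm x)\<^sup>2 = (norm (proj *v x))\<^sup>2 + (norm (c *s \<psi>))\<^sup>2"
    by (metis norm_add_Pythagorean)
  then have "(norm (proj *v x))\<^sup>2 \<le> (norm x)\<^sup>2" by simp
  then show ?thesis by (rule power2_le_imp_le) simp
qed

lemma proj_mult_proj:
  assumes "A *v \<psi> = \<psi>"
  shows "proj *v (A *v (proj *v x)) = proj *v (A *v x)"
proof -
  have "A *v x = A *v (proj *v x) + cinner \<psi> x *s \<psi>"
    using assms by (simp add: proj_vec matrix_vector_mult_diff_distrib vec.scale)
  then show ?thesis by (metis proj_add_\<psi>)
qed

lemma norm_le_if_N_le: "N x \<le> N y \<Longrightarrow> norm x \<le> b / a * norm y"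
  using a(2)[of x] b(2)[of y] a(1) by (simp add: field_simps)

lemma shift_in_space: "w \<in> space S \<Longrightarrow> shift m w \<in> space S"
  using measurable_space[OF measurable_shift] .

lemma component_in_space: "w \<in> space S \<Longrightarrow> i \<ge> 1 \<Longrightarrow> w i \<in> space p"
  by (auto simp: space_S)

lemma Phi_invariant: "w \<in> space S \<Longrightarrow> Phi M n w *v \<psi> = \<psi>"
  by (induction n) (simp_all add: invariant component_in_space flip: matrix_vector_mul_assoc)

lemma Phi_contraction: "w \<in> space S \<Longrightarrow> N (Phi M n w *v x) \<le> N x"
proof (induction n)
  case (Suc n)
  then show ?case
    using contraction[OF component_in_space[of w "Suc n"], of "Phi M n w *v x"]
    by (simp flip: matrix_vector_mul_assoc)
qed simp

text \<open>In the Euclidean norm a product of factors is controlled only up to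
  \<open>b / a\<close>, which would accumulate over blocks; the quotient of \<open>N\<close> is
  contracted with constant exactly 1.\<close>

definition quot_norm :: "complex ^ 'n \<Rightarrow> real" where
  "quot_norm x = (INF c. N (x + c *s \<psi>))"

lemma quot_norm_le: "quot_norm x \<le> N (x + c *s \<psi>)"
proof -
  have "0 \<le> N x" for x using a(2)[of x] a(1) by (smt (verit) mult_nonneg_nonneg norm_ge_zero)
  then show ?thesis unfolding quot_norm_def by (intro cINF_lower bdd_belowI2[of _ 0]) auto
qed

lemma quot_norm_contraction:
  assumes "\<And>x. N (A *v x) \<le> N x" "A *v \<psi> = \<psi>"
  shows "quot_norm (A *v x) \<le> quot_norm x"
  unfolding quot_norm_def[of x]
proof (rule cINF_greatest)
  fix c
  have "quot_norm (A *v x) \<le> N (A *v x + c *s \<psi>)" by (rule quot_norm_le)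
  also have "A *v x + c *s \<psi> = A *v (x + c *s \<psi>)"
    by (simp add: matrix_vector_right_distrib vec.scale assms(2))
  also have "N \<dots> \<le> N (x + c *s \<psi>)" by (rule assms(1))
  finally show "quot_norm (A *v x) \<le> N (x + c *s \<psi>)" .
qed simp

lemma quot_norm_ge: "a * norm (proj *v x) \<le> quot_norm x"
  unfolding quot_norm_def
proof (rule cINF_greatest)
  fix c
  have "norm (proj *v x) \<le> norm (x + c *s \<psi>)" using norm_proj_le[of "x + c *s \<psi>"] by (simp add: proj_add_\<psi>)
  then have "a * norm (proj *v x) \<le> a * norm (x + c *s \<psi>)" using a(1) by simp
  also have "\<dots> \<le> N (x + c *s \<psi>)" by (rule a(2))
  finally show "a * norm (proj *v x) \<le> N (x + c *s \<psi>)" .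
qed simp

lemma quot_norm_le_proj: "quot_norm x \<le> b * norm (proj *v x)"
  using quot_norm_le[of x "- cinner \<psi> x"] b(2)[of "proj *v x"] by (simp add: proj_vec)

text \<open>An eigenvalue of the quotient map other than 1 lifts to an eigenvalue of
  \<open>A\<close>, so contractivity and the condition on the unit circle apply. Eigenvalue 1 on the
  quotient would contradict simplicity.\<close>

lemma eigenvalues_proj_M_E:
  assumes A: "A \<in> M_E N \<psi>" and contr: "\<And>x. N (A *v x) \<le> N x" and l: "l \<in> eigenvalues (proj ** A)"
  shows "cmod l < 1"
proof (rule ccontr)
  assume "\<not> cmod l < 1"
  then have l1: "1 \<le> cmod l" "l \<noteq> 0" by auto
  have A\<psi>: "A *v \<psi> = \<psi>" and simple: "alg_mult A 1 = 1"
    and circle: "eigenvalues A \<inter> {z. cmod z = 1} = {1}" using A by (auto simp: M_E_def)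
  obtain y where y: "y \<noteq> 0" "proj *v (A *v y) = l *s y"
    using l by (auto simp: eigenvalues_def matrix_vector_mul_assoc)
  have "l * cinner \<psi> y = 0" using cinner_proj[of "A *v y"] y(2) by simp
  then have \<psi>y: "cinner \<psi> y = 0" using l1 by simp
  define s where "s = cinner \<psi> (A *v y)"
  have Ay: "A *v y = l *s y + s *s \<psi>" using y(2) by (simp add: proj_vec s_def algebra_simps)
  show False
  proof (cases "l = 1")
    case True
    define x where "x = complex_of_real (1 / norm y) *s y"
    have "norm x = 1" "cinner \<psi> x = 0"
      using y(1) \<psi>y by (simp_all add: x_def norm_vector_smult norm_divide)
    moreover have "A *v x = x + (complex_of_real (1 / norm y) * s) *s \<psi>"
      using True Ay by (simp add: x_def vec.scale vec.scale_right_distrib)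
    ultimately show False using alg_mult_1_imp_no_generalized_eigenvector[OF simple A\<psi> norm_\<psi>] by blast
  next
    case False
    \<comment> \<open>The multiple of \<psi> solves \<open>A u = l u\<close>; division by
      \<open>l - 1\<close> is what fails at \<open>l = 1\<close>.\<close>
    define u where "u = y + (s / (l - 1)) *s \<psi>"
    have "cinner \<psi> u = s / (l - 1)" by (simp add: u_def cinner_add_right \<psi>y cinner_\<psi>\<psi>)
    then have u0: "u \<noteq> 0" using y(1) by (auto simp: u_def)
    have "s + s / (l - 1) = l * (s / (l - 1))" using False by (simp add: field_simps)
    moreover have "A *v u = l *s y + (s + s / (l - 1)) *s \<psi>"
      by (simp add: u_def matrix_vector_right_distrib vec.scale Ay A\<psi> vec.scale_left_distrib)
    ultimately have Au: "A *v u = l *s u"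
      by (simp add: u_def vec.scale_right_distrib)
    have "0 < N u" using a(2)[of u] a(1) u0 by (smt (verit) mult_pos_pos zero_less_norm_iff)
    moreover have "cmod l * N u \<le> N u" using contr[of u] norm_N by (simp add: Au is_norm_def)
    ultimately have "cmod l \<le> 1" by simp
    then have "l \<in> eigenvalues A \<inter> {z. cmod z = 1}"
      using l1 Au u0 by (auto simp: eigenvalues_def)
    then show False using circle False by blast
  qed
qed

lemma proj_mat_power:
  assumes "A *v \<psi> = \<psi>"
  shows "proj ** mat_power A k = mat_power (proj ** A) k ** proj"
proof (rule matrix_eq_if_vec)
  fix x
  show "(proj ** mat_power A k) *v x = (mat_power (proj ** A) k ** proj) *v x"
  proof (induction k)
    case 0
    then show ?case by (simp add: mat_power_def)
  next
    case (Suc k)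
    have "proj *v (A *v (mat_power A k *v x)) = proj *v (A *v (proj *v (mat_power A k *v x)))"
      by (simp add: proj_mult_proj[OF assms])
    then show ?case using Suc by (simp add: mat_power_Suc flip: matrix_vector_mul_assoc)
  qed
qed

text \<open>For the support point \<open>A\<close> some power is small modulo \<psi>. By continuity
  so are all products of \<open>k\<close> factors from a ball around \<open>A\<close>, and
  independence gives such products probability at least \<open>measure p B ^ k\<close>.\<close>

lemma strict_contraction_positive_probability:
  assumes pos: "measure p {w \<in> space p. M w \<in> M_E N \<psi>} > 0" and \<theta>: "\<theta> > 0"
  obtains k where "k > 0"
    "measure (windows k) {w \<in> space (windows k). norm (proj ** Phi M k w) < \<theta>} > 0"
proof -
  have sets_M_E: "{w \<in> space p. M w \<in> M_E N \<psi>} \<in> sets p" using pos measure_notin_sets by fastforce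
  have pos': "emeasure p {w \<in> space p. M w \<in> M_E N \<psi>} \<noteq> 0" using pos by (auto simp: measure_def)
  obtain w0 where w0: "w0 \<in> space p" "M w0 \<in> M_E N \<psi>"
    and supp: "\<And>U. open U \<Longrightarrow> M w0 \<in> U \<Longrightarrow> emeasure p {w \<in> space p. M w \<in> U} \<noteq> 0"
    by (rule exists_in_support[OF M_meas pos' sets_M_E]) blast
  define A where "A = M w0"
  have A\<psi>: "A *v \<psi> = \<psi>" using invariant w0 by (simp add: A_def)
  have mm: "continuous_on UNIV (\<lambda>X :: complex ^ 'n ^ 'n. X ** proj)" "continuous_on UNIV (\<lambda>X :: complex ^ 'n ^ 'n. proj ** X)"
    unfolding matrix_matrix_mult_def by (intro continuous_intros continuous_on_vec_lambda)+
  have "mat_power (proj ** A) \<longlonglongrightarrow> 0"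
    by (rule mat_power_tendsto_0) (use eigenvalues_proj_M_E[of A] w0 contraction in \<open>auto simp: A_def\<close>)
  then have "(\<lambda>k. mat_power (proj ** A) k ** proj) \<longlonglongrightarrow> 0 ** proj"
    by (intro continuous_on_tendsto_compose[OF mm(1)]) auto
  then have "(\<lambda>k. proj ** mat_power A k) \<longlonglongrightarrow> 0" 
  proof -
    have "0 ** proj = 0" by (simp add: vec_eq_iff matrix_matrix_mult_def)
    then show ?thesis using \<open>(\<lambda>k. mat_power (proj ** A) k ** proj) \<longlonglongrightarrow> 0 ** proj\<close>
      by (simp add: proj_mat_power[OF A\<psi>])
  qed
  then have "\<forall>\<^sub>F k in sequentially. norm (proj ** mat_power A k) < \<theta>"
    using tendstoD[OF _ \<theta>] by fastforce
  then have "\<forall>\<^sub>F k in sequentially. norm (proj ** mat_power A k) < \<theta> \<and> k > 0"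
    using eventually_gt_at_top by (rule eventually_conj)
  then obtain k where k: "norm (proj ** mat_power A k) < \<theta>" "k > 0" by (auto simp: eventually_sequentially)
  have "open {X :: complex ^ 'n ^ 'n. norm (proj ** X) < \<theta>}"
    by (intro open_Collect_less continuous_intros mm(2))
  then obtain e where e: "e > 0" "\<And>X. dist X (mat_power A k) < e \<Longrightarrow> norm (proj ** X) < \<theta>"
    using k(1) unfolding open_dist by (metis mem_Collect_eq)
  obtain \<epsilon> where \<epsilon>: "\<epsilon> > 0"
    "\<And>w. (\<forall>i\<in>{1..k}. dist (M (w i)) A < \<epsilon>) \<Longrightarrow> dist (Phi M k w) (mat_power A k) < e"
    using Phi_near_mat_power[OF e(1), of k M A] by blast
  define B where "B = {w \<in> space p. M w \<in> ball A \<epsilon>}"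
  have B: "B \<in> sets p"
    using measurable_sets[OF M_meas, of "ball A \<epsilon>"] by (simp add: B_def vimage_def Int_def conj_commute)
  have "emeasure p B \<noteq> 0" unfolding B_def by (rule supp) (use \<epsilon>(1) in \<open>auto simp: A_def\<close>)
  then have B0: "measure p B > 0" by (simp add: emeasure_eq_measure zero_less_measure_iff)
  let ?P = "windows k"
  interpret P: finite_product_prob_space "\<lambda>_. p" "{1..k}"
    by unfold_locales auto
  have "0 < measure p B ^ k" using B0 by simp
  also have "\<dots> = measure ?P (Pi\<^sub>E {1..k} (\<lambda>_. B))" using P.prob_times[of "\<lambda>_. B"] B by simp
  also have "\<dots> \<le> measure ?P {w \<in> space ?P. norm (proj ** Phi M k w) < \<theta>}"
  proof (rule P.finite_measure_mono)
    show "Pi\<^sub>E {1..k} (\<lambda>_. B) \<subseteq> {w \<in> space ?P. norm (proj ** Phi M k w) < \<theta>}"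
    proof
      fix w assume w: "w \<in> Pi\<^sub>E {1..k} (\<lambda>_. B)"
      then have "\<forall>i\<in>{1..k}. dist (M (w i)) A < \<epsilon>" by (auto simp: B_def dist_commute PiE_iff)
      then have "norm (proj ** Phi M k w) < \<theta>" using \<epsilon>(2) e(2) by blast
      moreover have "w \<in> space ?P" using w by (auto simp: space_PiM B_def PiE_iff)
      ultimately show "w \<in> {w \<in> space ?P. norm (proj ** Phi M k w) < \<theta>}" by simp
    qed
    have "Phi M k \<in> borel_measurable ?P" by (rule measurable_Phi[OF M_meas]) simp
    then have "(\<lambda>w. proj ** Phi M k w) \<in> borel_measurable ?P"
      by (rule borel_measurable_continuous_on[OF mm(2)])
    then show "{w \<in> space ?P. norm (proj ** Phi M k w) < \<theta>} \<in> P.events" by measurable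
  qed
  finally show ?thesis using that k(2) by blast
qed

end


section \<open>Exponential decay\<close>

lemma geometric_steps_limit:
  fixes f :: "nat \<Rightarrow> 'a :: banach"
  assumes step: "\<And>n. norm (f (Suc n) - f n) \<le> C * r ^ n" and r: "0 \<le> r" "r < 1" and C: "0 \<le> C"
  shows "convergent f" "norm (f n - lim f) \<le> C / (1 - r) * r ^ n"
proof -
  have "summable (\<lambda>n. C * r ^ n)" using r by (intro summable_mult summable_geometric) simp
  then have "summable (\<lambda>n. norm (f (Suc n) - f n))"
    by (rule summable_comparison_test'[where N = 0]) (use step in simp)
  then show conv: "convergent f" by (rule convergent_if_summable_steps)
  have "norm (f n - f (n + m)) \<le> C / (1 - r) * r ^ n" for m
  proof -
    \<comment> \<open>The factor \<open>1 - r ^ m\<close> of the exact geometric sum is what closes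
      the induction.\<close>
    have "norm (f n - f (n + m)) \<le> C / (1 - r) * r ^ n * (1 - r ^ m)"
    proof (induction m)
      case (Suc m)
      have "norm (f n - f (n + Suc m)) \<le> norm (f n - f (n + m)) + norm (f (Suc (n + m)) - f (n + m))"
        using norm_triangle_ineq4[of "f n - f (n + m)" "f (Suc (n + m)) - f (n + m)"] by simp
      also have "\<dots> \<le> C / (1 - r) * r ^ n * (1 - r ^ m) + C * r ^ (n + m)"
        using Suc.IH step by (intro add_mono) auto
      also have "\<dots> = C / (1 - r) * r ^ n * (1 - r ^ Suc m)"
        using r by (simp add: field_simps power_add)
      finally show ?case .
    qed simp
    also have "\<dots> \<le> C / (1 - r) * r ^ n * 1"
      using r C by (intro mult_left_mono) auto
    finally show ?thesis by simp
  qed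
  moreover have "(\<lambda>m. norm (f n - f (n + m))) \<longlonglongrightarrow> norm (f n - lim f)"
  proof (intro tendsto_intros)
    have "f \<longlonglongrightarrow> lim f" using conv by (simp add: convergent_LIMSEQ_iff)
    from LIMSEQ_ignore_initial_segment[OF this, of n] show "(\<lambda>m. f (n + m)) \<longlonglongrightarrow> lim f"
      by (simp add: add.commute)
  qed
  ultimately show "norm (f n - lim f) \<le> C / (1 - r) * r ^ n"
    by (intro LIMSEQ_le_const2) auto
qed

context reduced_dynamics
begin

text \<open>The threshold \<open>a / (2 * b)\<close> pays for comparing the quotient norm with the
  Euclidean one: \<open>b\<close> on the way in and \<open>1 / a\<close> on the way out leave
  1/2.\<close>

lemma quot_norm_decay:
  assumes w: "w \<in> space S"
  shows "quot_norm (Phi M (k * J) w *v x) \<le>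
    (1 / 2) ^ card {j. j < J \<and> norm (proj ** Phi M k (shift (k * j) w)) < a / (2 * b)} * quot_norm x"
proof (induction J)
  case (Suc J)
  define A where "A = Phi M k (shift (k * J) w)"
  define y where "y = Phi M (k * J) w *v x"
  define G where "G J = {j. j < J \<and> norm (proj ** Phi M k (shift (k * j) w)) < a / (2 * b)}" for J
  have A\<psi>: "A *v \<psi> = \<psi>" and A_contr: "N (A *v z) \<le> N z" for z
    unfolding A_def by (auto intro: Phi_invariant Phi_contraction shift_in_space w)
  have Phi_eq: "Phi M (k * Suc J) w *v x = A *v y"
    using Phi_add[of M "k * J" k w] by (simp add: A_def y_def add.commute matrix_vector_mul_assoc)
  show ?case
  proof (cases "norm (proj ** A) < a / (2 * b)")
    case True
    have "G (Suc J) = insert J (G J)" using True by (auto simp: G_def A_def less_Suc_eq)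
    then have card: "card (G (Suc J)) = Suc (card (G J))" by (simp add: G_def)
    have "quot_norm (A *v y) \<le> b * norm (proj *v (A *v y))" by (rule quot_norm_le_proj)
    also have "proj *v (A *v y) = (proj ** A) *v (proj *v y)"
      by (simp add: proj_mult_proj[OF A\<psi>] flip: matrix_vector_mul_assoc)
    also have "b * norm \<dots> \<le> b * (norm (proj ** A) * norm (proj *v y))"
      using b(1) norm_matrix_vec_le by (intro mult_left_mono) auto
    also have "\<dots> \<le> b * (a / (2 * b) * norm (proj *v y))"
      using b(1) True by (intro mult_left_mono mult_right_mono) auto
    also have "\<dots> = (1 / 2) * (a * norm (proj *v y))" using b(1) by simp
    also have "\<dots> \<le> (1 / 2) * quot_norm y"
      using quot_norm_ge by (intro mult_left_mono) auto
    also have "\<dots> \<le> (1 / 2) * ((1 / 2) ^ card (G J) * quot_norm x)"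
      using Suc.IH by (simp add: y_def G_def)
    finally show ?thesis unfolding Phi_eq using card by (simp add: G_def)
  next
    case False
    then have "G (Suc J) = G J" by (auto simp: G_def A_def less_Suc_eq)
    moreover have "quot_norm (A *v y) \<le> quot_norm y" by (rule quot_norm_contraction[OF A_contr A\<psi>])
    ultimately show ?thesis unfolding Phi_eq using Suc.IH by (simp add: G_def y_def)
  qed
qed simp

definition decays :: "real \<Rightarrow> (nat \<Rightarrow> 'w) \<Rightarrow> bool" where
  "decays \<alpha> w \<longleftrightarrow> (\<exists>C>0. \<forall>n x. norm (proj *v (Phi M n w *v x)) \<le> C * exp (- \<alpha> * n) * norm x)"

lemma transversal_decay:
  assumes pos: "measure p {w \<in> space p. M w \<in> M_E N \<psi>} > 0"
  obtains \<alpha> where "\<alpha> > 0"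
    "AE w in S. decays \<alpha> w"
proof -
  obtain k where k: "k > 0"
    and good_pos: "measure (windows k)
      {w \<in> space (windows k). norm (proj ** Phi M k w) < a / (2 * b)} > 0"
    using strict_contraction_positive_probability[OF pos, of "a / (2 * b)"] a b by auto
  let ?P = "windows k"
  define G where "G = {w \<in> space ?P. norm (proj ** Phi M k w) < a / (2 * b)}"
  interpret P: prob_space ?P by (intro prob_space_PiM prob_space_axioms)
  have G: "G \<in> sets ?P" using good_pos measure_notin_sets unfolding G_def by fastforce
  define g where "g = measure ?P G"
  have g: "g > 0" using good_pos by (simp add: g_def G_def)
  have bad: "measure ?P (space ?P - G) = 1 - g" using P.prob_compl[OF G] by (simp add: g_def)
  \<comment> \<open>Blocks have length \<open>k\<close>, and eventually a fraction at least
    \<open>g / 2\<close> of them halves the quotient norm; the other half of \<open>g\<close> is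
    spent on the deviation allowed below.\<close>
  define \<alpha> where "\<alpha> = ln 2 * (g / 2) / k"
  have \<alpha>: "\<alpha> > 0" using g k by (simp add: \<alpha>_def)
  have "AE w in S. \<forall>\<^sub>F J in sequentially.
      real (card {j. j < J \<and> window (0 + k * j) k w \<in> space ?P - G}) \<le> (measure ?P (space ?P - G) + g / 2) * J"
    by (rule eventually_frequency_le) (use k G g in auto)
  then have "AE w in S. decays \<alpha> w"
  proof (rule AE_mp, intro AE_I2 impI)
    fix w assume w: "w \<in> space S" and freq: "\<forall>\<^sub>F J in sequentially.
      real (card {j. j < J \<and> window (0 + k * j) k w \<in> space ?P - G}) \<le> (measure ?P (space ?P - G) + g / 2) * J"
    define good where "good J = {j. j < J \<and> norm (proj ** Phi M k (shift (k * j) w)) < a / (2 * b)}" for J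
    from freq have "\<forall>\<^sub>F J in sequentially. g / 2 * J \<le> real (card (good J))"
    proof eventually_elim
      case (elim J)
      have "window (0 + k * j) k w \<in> space ?P - G \<longleftrightarrow> \<not> norm (proj ** Phi M k (shift (k * j) w)) < a / (2 * b)" for j
        using measurable_space[OF measurable_window w] by (simp add: G_def Phi_window)
      then have "{j. j < J \<and> window (0 + k * j) k w \<in> space ?P - G} = {..<J} - good J"
        by (auto simp: good_def)
      with elim have "real (card ({..<J} - good J)) \<le> (1 - g + g / 2) * J" unfolding bad by simp
      moreover have "card ({..<J} - good J) = J - card (good J)" "card (good J) \<le> J"
        using card_mono[of "{..<J}" "good J"] by (auto simp: good_def intro: card_Diff_subset[THEN trans])
      ultimately show ?case by (simp add: of_nat_diff algebra_simps)
    qed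
    then obtain J0 where J0: "\<And>J. J \<ge> J0 \<Longrightarrow> g / 2 * J \<le> real (card (good J))"
      by (auto simp: eventually_sequentially)
    define n0 where "n0 = k * J0"
    have crude: "norm (proj *v (Phi M n w *v x)) \<le> b / a * ((1 / 2) ^ card (good (n div k)) * norm x)" for n x
    proof -
      have n: "n = k * (n div k) + n mod k" by simp
      have split: "Phi M n w *v x = Phi M (n mod k) (shift (k * (n div k)) w) *v (Phi M (k * (n div k)) w *v x)"
        by (subst n, subst Phi_add) (simp add: matrix_vector_mul_assoc)
      have "a * norm (proj *v (Phi M n w *v x)) \<le> quot_norm (Phi M n w *v x)"
        by (rule quot_norm_ge)
      also have "\<dots> \<le> quot_norm (Phi M (k * (n div k)) w *v x)"
        unfolding split by (intro quot_norm_contraction Phi_contraction Phi_invariant shift_in_space w)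
      also have "\<dots> \<le> (1 / 2) ^ card (good (n div k)) * quot_norm x"
        unfolding good_def by (rule quot_norm_decay[OF w])
      also have "\<dots> \<le> (1 / 2) ^ card (good (n div k)) * (b * norm x)"
        using quot_norm_le[of x 0] b(2)[of x] by (intro mult_left_mono) auto
      finally show ?thesis using a(1) by (simp add: field_simps)
    qed
    \<comment> \<open>\<open>exp (\<alpha> * n0)\<close> covers times before the frequency bound
      sets in, and \<open>exp (\<alpha> * k)\<close> the incomplete last block. \<open>n0\<close>
      depends on the path.\<close>
    define C where "C = b / a * exp (\<alpha> * (n0 + k))"
    have C: "C > 0" using a b by (simp add: C_def)
    have "norm (proj *v (Phi M n w *v x)) \<le> C * exp (- \<alpha> * n) * norm x" for n x
    proof -
      have "(1 / 2) ^ card (good (n div k)) \<le> exp (\<alpha> * (n0 + k) - \<alpha> * n)"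
      proof (cases "n \<ge> n0")
        case True
        have "n0 div k \<le> n div k" using True by (rule div_le_mono)
        then have "J0 \<le> n div k" using k by (simp add: n0_def)
        then have ge: "g / 2 * (n div k) \<le> real (card (good (n div k)))" by (rule J0)
        have "n < k * (n div k) + k" using k by (metis add_strict_left_mono mod_less_divisor mult_div_mod_eq)
        then have "real n \<le> k * real (n div k) + k" by (metis less_imp_le of_nat_add of_nat_le_iff of_nat_mult)
        then have "\<alpha> * real n \<le> \<alpha> * (k * real (n div k) + k)" using \<alpha> by (intro mult_left_mono) auto
        also have "\<dots> = ln 2 * (g / 2 * real (n div k)) + \<alpha> * k" using k by (simp add: \<alpha>_def field_simps)
        also have "\<dots> \<le> ln 2 * real (card (good (n div k))) + \<alpha> * k" using ge \<alpha> by (intro add_mono mult_left_mono) auto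
        finally have "\<alpha> * n \<le> ln 2 * real (card (good (n div k))) + \<alpha> * k" .
        moreover have "0 \<le> \<alpha> * n0" using \<alpha> by simp
        ultimately have "- (ln 2 * real (card (good (n div k)))) \<le> \<alpha> * (n0 + k) - \<alpha> * n"
          by (simp add: algebra_simps)
        moreover have "(1 / 2 :: real) ^ card (good (n div k)) = exp (- (ln 2 * real (card (good (n div k)))))"
          by (simp add: exp_minus power_one_over inverse_eq_divide mult.commute[of "ln 2"] exp_of_nat_mult)
        ultimately show ?thesis by simp
      next
        case False
        have "(1 / 2 :: real) ^ card (good (n div k)) \<le> 1" by (simp add: power_le_one)
        also have "1 \<le> exp (\<alpha> * (n0 + k) - \<alpha> * n)"
          using False \<alpha> by (simp add: mult_left_mono algebra_simps add_increasing)
        finally show ?thesis .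
      qed
      then have "b / a * ((1 / 2) ^ card (good (n div k)) * norm x)
          \<le> b / a * (exp (\<alpha> * (n0 + k) - \<alpha> * n) * norm x)"
        using a b by (intro mult_left_mono mult_right_mono) auto
      with crude[of n x] show ?thesis by (simp add: C_def exp_diff exp_minus field_simps)
    qed
    then show "decays \<alpha> w"
      unfolding decays_def using C by blast
  qed
  with \<alpha> that show ?thesis by blast
qed

section \<open>Convergence of the dual vectors and the rank-one approximation\<close>

definition dual :: "nat \<Rightarrow> (nat \<Rightarrow> 'w) \<Rightarrow> complex ^ 'n" where
  "dual n w = adjoint_mat (Phi M n w) *v \<psi>"

definition dual_limit :: "(nat \<Rightarrow> 'w) \<Rightarrow> complex ^ 'n" where
  "dual_limit w = lim (\<lambda>n. dual n w)"

lemma Phi_measurable: "Phi M n \<in> borel_measurable S"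
  unfolding path_measure_def by (rule measurable_Phi[OF M_meas]) auto

lemma dual_limit_measurable: "dual_limit \<in> borel_measurable S"
  unfolding dual_limit_def
proof (rule borel_measurable_lim_metric)
  fix n
  have "continuous_on UNIV (\<lambda>A :: complex ^ 'n ^ 'n. adjoint_mat A *v \<psi>)"
    unfolding matrix_vector_mult_def adjoint_mat_def by (intro continuous_intros continuous_on_vec_lambda)
  then show "dual n \<in> borel_measurable S"
    unfolding dual_def[abs_def] using Phi_measurable by (rule borel_measurable_continuous_on)
qed

lemma cinner_dual: "cinner (dual n w) x = cinner \<psi> (Phi M n w *v x)"
  by (simp add: dual_def cinner_adjoint)

lemma Phi_approx:
  assumes w: "w \<in> space S" and \<alpha>: "\<alpha> > 0" and "decays \<alpha> w"
  obtains D where "D > 0"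
    "\<And>n x. norm ((Phi M n w - ketbra \<psi> (dual_limit w)) *v x) \<le> D * exp (- \<alpha> * n) * norm x"
proof -
  obtain C where C: "C > 0"
    and decay: "\<And>n x. norm (proj *v (Phi M n w *v x)) \<le> C * exp (- \<alpha> * n) * norm x"
    using assms(3) by (auto simp: decays_def)
  define K where "K = b / a + 1"
  have K: "K > 0" using a b by (simp add: K_def add_pos_pos)
  define r where "r = exp (- \<alpha>)"
  have r: "0 \<le> r" "r < 1" using \<alpha> by (simp_all add: r_def)
  have rn: "r ^ n = exp (- \<alpha> * n)" for n by (simp add: r_def exp_of_nat_mult[symmetric] mult.commute)
  have step: "norm (dual (Suc n) w - dual n w) \<le> K * C * r ^ n" for n
  proof -
    define A where "A = M (w (Suc n))"
    define z where "z = dual (Suc n) w - dual n w"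
    \<comment> \<open>The increment \<open>z\<close> is tested against itself. The next factor fixes
      the \<psi>-component of \<open>Phi M n w *v z\<close>, so only its transversal part
      \<open>y\<close> contributes, and that part decays.\<close>
    define y where "y = proj *v (Phi M n w *v z)"
    have wp: "w (Suc n) \<in> space p" using w by (intro component_in_space) auto
    have A\<psi>: "A *v \<psi> = \<psi>" unfolding A_def by (rule invariant[OF wp])
    have "norm (A *v y) \<le> b / a * norm y"
      unfolding A_def by (rule norm_le_if_N_le[OF contraction[OF wp]])
    then have Ay: "norm (A *v y - y) \<le> K * norm y"
      using norm_triangle_ineq4[of "A *v y" y] by (simp add: K_def algebra_simps)
    define s where "s = cinner \<psi> (Phi M n w *v z)"
    have Pz: "Phi M n w *v z = y + s *s \<psi>" by (simp add: y_def proj_vec s_def)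
    have "Phi M (Suc n) w *v z = A *v (Phi M n w *v z)"
      by (simp add: A_def matrix_vector_mul_assoc)
    also have "\<dots> = A *v y + s *s \<psi>"
      unfolding Pz by (simp add: matrix_vector_right_distrib vec.scale A\<psi>)
    finally have diff: "Phi M (Suc n) w *v z - Phi M n w *v z = A *v y - y" using Pz by simp
    have "(norm z)\<^sup>2 = cmod (cinner z z)" by (simp add: cinner_self del: of_real_power)
    also have "cinner z z = cinner \<psi> (Phi M (Suc n) w *v z - Phi M n w *v z)"
      by (subst (1) z_def) (simp only: cinner_diff_left cinner_diff_right cinner_dual)
    also have "cmod \<dots> \<le> norm \<psi> * norm (A *v y - y)" unfolding diff by (rule norm_cinner_le)
    also have "\<dots> \<le> K * norm y" using Ay by (simp add: norm_\<psi>)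
    also have "\<dots> \<le> K * (C * exp (- \<alpha> * n) * norm z)"
      using K decay[of n z] by (intro mult_left_mono) (auto simp: y_def)
    finally have "norm z * norm z \<le> (K * C * r ^ n) * norm z" by (simp add: power2_eq_square rn mult_ac)
    then have "norm z \<le> K * C * r ^ n"
      using K C r by (cases "norm z = 0") (auto simp: mult_le_cancel_right)
    then show ?thesis by (simp add: z_def)
  qed
  note lim = geometric_steps_limit(2)[where f = "\<lambda>n. dual n w", OF step r, folded dual_limit_def]
  define D where "D = C + K * C / (1 - r)"
  have D: "D > 0" using C K r by (simp add: D_def add_pos_pos)
  have "norm ((Phi M n w - ketbra \<psi> (dual_limit w)) *v x) \<le> D * exp (- \<alpha> * n) * norm x" for n x
  proof -
    have "(Phi M n w - ketbra \<psi> (dual_limit w)) *v x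
        = proj *v (Phi M n w *v x) + cinner (dual n w - dual_limit w) x *s \<psi>"
      by (simp add: matrix_vector_mult_diff_rdistrib ketbra_mult_vec proj_vec cinner_diff_left
          cinner_dual vec.scale_left_diff_distrib)
    also have "norm \<dots> \<le> norm (proj *v (Phi M n w *v x)) + norm (cinner (dual n w - dual_limit w) x *s \<psi>)"
      by (rule norm_triangle_ineq)
    also have "\<dots> \<le> C * exp (- \<alpha> * n) * norm x + K * C / (1 - r) * r ^ n * norm x"
    proof (rule add_mono[OF decay])
      have "norm (cinner (dual n w - dual_limit w) x *s \<psi>) \<le> norm (dual n w - dual_limit w) * norm x"
        using norm_cinner_le by (simp add: norm_vector_smult norm_\<psi>)
      also have "\<dots> \<le> K * C / (1 - r) * r ^ n * norm x"
        using lim[of n] K C by (intro mult_right_mono) auto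
      finally show "norm (cinner (dual n w - dual_limit w) x *s \<psi>) \<le> K * C / (1 - r) * r ^ n * norm x" .
    qed
    also have "\<dots> = D * exp (- \<alpha> * n) * norm x" by (simp add: D_def rn algebra_simps)
    finally show ?thesis .
  qed
  with D that show ?thesis by blast
qed

end


section \<open>Lyapunov exponents\<close>

lemma convergent_root_comparable:
  fixes x y :: "nat \<Rightarrow> real"
  assumes conv: "convergent (\<lambda>n. root n (y n))" and C: "C > 0"
    and xy: "\<And>n. x n \<le> C * y n \<and> y n \<le> C * x n"
  shows "convergent (\<lambda>n. root n (x n))"
proof -
  obtain L where L: "(\<lambda>n. root n (y n)) \<longlonglongrightarrow> L" using conv by (auto simp: convergent_def)
  have "(\<lambda>n. root n (x n)) \<longlonglongrightarrow> L"
  proof (rule tendsto_sandwich)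
    show "\<forall>\<^sub>F n in sequentially. root n (1 / C) * root n (y n) \<le> root n (x n)"
      using eventually_gt_at_top[of 0]
    proof eventually_elim
      case (elim n)
      have "1 / C * y n \<le> x n" using xy[of n] C by (simp add: field_simps)
      then show ?case using elim by (simp flip: real_root_mult)
    qed
    show "\<forall>\<^sub>F n in sequentially. root n (x n) \<le> root n C * root n (y n)"
      using eventually_gt_at_top[of 0]
    proof eventually_elim
      case (elim n)
      then show ?case using xy[of n] by (simp flip: real_root_mult)
    qed
    show "(\<lambda>n. root n (1 / C) * root n (y n)) \<longlonglongrightarrow> L"
      using tendsto_mult[OF LIMSEQ_root_const[of "1 / C"] L] C by simp
    show "(\<lambda>n. root n C * root n (y n)) \<longlonglongrightarrow> L"
      using tendsto_mult[OF LIMSEQ_root_const[OF C] L] by simp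
  qed
  then show ?thesis by (auto simp: convergent_def)
qed

text \<open>Here \<tau> comes from the next singular value and \<open>z\<close> from the product of
  the first \<open>q\<close>. If \<open>z\<close> tends to 0 no quotient can be formed; the next
  value being at most each previous one then forces \<tau> to 0.\<close>

lemma convergent_factor:
  fixes z \<tau> :: "nat \<Rightarrow> real" and q :: nat
  assumes z: "convergent z" and prod: "convergent (\<lambda>n. z n * \<tau> n)"
    and \<tau>: "\<And>n. 0 \<le> \<tau> n" "\<And>n. \<tau> n ^ q \<le> z n" and q: "q > 0"
  shows "convergent \<tau>"
proof -
  obtain L L' where L: "z \<longlonglongrightarrow> L" "(\<lambda>n. z n * \<tau> n) \<longlonglongrightarrow> L'"
    using z prod by (auto simp: convergent_def)
  show ?thesis
  proof (cases "L = 0")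
    case True
    have "(\<lambda>n. root q (z n)) \<longlonglongrightarrow> root q 0" using L(1) True by (intro tendsto_real_root) simp
    moreover have "\<tau> n \<le> root q (z n)" for n
      using \<tau> q by (metis real_root_le_iff real_root_power_cancel)
    ultimately have "\<tau> \<longlonglongrightarrow> 0"
      using \<tau>(1) by (intro tendsto_sandwich[of "\<lambda>_. 0" \<tau> _ "\<lambda>n. root q (z n)" 0]) auto
    then show ?thesis by (auto simp: convergent_def)
  next
    case False
    have "(\<lambda>n. z n * \<tau> n / z n) \<longlonglongrightarrow> L' / L" using L False by (intro tendsto_divide)
    moreover have "\<forall>\<^sub>F n in sequentially. z n * \<tau> n / z n = \<tau> n"
      using tendsto_imp_eventually_ne[OF L(1) False] by eventually_elim simp
    ultimately have "\<tau> \<longlonglongrightarrow> L' / L" by (rule Lim_transform_eventually)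
    then show ?thesis by (auto simp: convergent_def)
  qed
qed

context singular_decomposition
begin

lemma norm_Phi_square:
  "(norm (\<Phi> n *v x))\<^sup>2 = (\<Sum>i<CARD('n). sv n i * (cmod (cinner (v n i) x))\<^sup>2)"
proof -
  have "complex_of_real ((norm (\<Phi> n *v x))\<^sup>2) = cinner x ((adjoint_mat (\<Phi> n) ** \<Phi> n) *v x)"
    by (simp add: cinner_adjoint_right cinner_self flip: matrix_vector_mul_assoc)
  also have "\<dots> = complex_of_real (\<Sum>i<CARD('n). sv n i * (cmod (cinner (v n i) x))\<^sup>2)"
    by (subst eigbasis_eq_specmat[OF eb]) (rule cinner_specmat)
  finally show ?thesis using of_real_eq_iff by blast
qed

lemma norm_Phi_le: "(norm (\<Phi> n *v x))\<^sup>2 \<le> sv n 0 * (norm x)\<^sup>2"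
proof -
  have "(norm (\<Phi> n *v x))\<^sup>2 \<le> (\<Sum>i<CARD('n). sv n 0 * (cmod (cinner (v n i) x))\<^sup>2)"
    unfolding norm_Phi_square using decreasing by (intro sum_mono mult_right_mono) auto
  then show ?thesis by (simp add: onfam_parseval[OF on] flip: sum_distrib_left)
qed

text \<open>Courant--Fischer in codimension one: the span of \<open>v n 0\<close> and
  \<open>v n 1\<close> contains a nonzero vector orthogonal to \<eta>, and \<open>\<Phi> n\<close>
  stretches every vector of that span by at least \<open>sqrt (sv n 1)\<close>.\<close>

lemma second_singular_value_le:
  assumes "1 < CARD('n)" and B: "\<And>x. cinner \<eta> x = 0 \<Longrightarrow> norm (\<Phi> n *v x) \<le> B * norm x"
  shows "sqrt (sv n 1) \<le> B"
proof -
  \<comment> \<open>Exchanging the two inner products, with one sign, makes the combination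
    orthogonal to \<eta>. If both vanish any nonzero coefficients do.\<close>
  define c where "c i = (if cinner \<eta> (v n 0) = 0 \<and> cinner \<eta> (v n 1) = 0 then 1
    else if i = 0 then cinner \<eta> (v n 1) else - cinner \<eta> (v n 0))" for i :: nat
  define x where "x = c 0 *s v n 0 + c 1 *s v n 1"
  have orth: "cinner \<eta> x = 0" by (simp add: x_def c_def cinner_add_right)
  have coord: "cinner (v n i) x = (if i = 0 then c 0 else if i = 1 then c 1 else 0)" if "i < CARD('n)" for i
    using on[of n] that assms(1) by (auto simp: x_def cinner_add_right onfam_def)
  have x0: "x \<noteq> 0"
  proof
    assume "x = 0"
    then have "c 0 = 0" "c 1 = 0" using coord[of 0] coord[of 1] assms(1) by auto
    then show False by (auto simp: c_def split: if_splits)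
  qed
  have "sv n 1 * (norm x)\<^sup>2 = (\<Sum>i<CARD('n). sv n 1 * (cmod (cinner (v n i) x))\<^sup>2)"
    by (simp add: onfam_parseval[OF on] flip: sum_distrib_left)
  also have "\<dots> \<le> (\<Sum>i<CARD('n). sv n i * (cmod (cinner (v n i) x))\<^sup>2)"
    using decreasing[of _ 1] assms(1) by (intro sum_mono) (auto simp: coord intro!: mult_right_mono)
  also have "\<dots> = (norm (\<Phi> n *v x))\<^sup>2" by (rule norm_Phi_square[symmetric])
  finally have "sqrt (sv n 1 * (norm x)\<^sup>2) \<le> sqrt ((norm (\<Phi> n *v x))\<^sup>2)" by (rule real_sqrt_le_mono)
  then have "sqrt (sv n 1) * norm x \<le> norm (\<Phi> n *v x)" by (simp add: real_sqrt_mult)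
  also have "\<dots> \<le> B * norm x" by (rule B[OF orth])
  finally show ?thesis using x0 by simp
qed

lemma growth_exists:
  assumes conv: "\<And>q. q \<le> CARD('n) \<Longrightarrow> convergent (\<lambda>n. root n (minor_sum q (\<Phi> n)))"
  obtains t where "\<And>i. i < CARD('n) \<Longrightarrow> (\<lambda>n. root (2 * n) (sv n i)) \<longlonglongrightarrow> t i"
proof -
  define z where "z q n = root (2 * n) (prod (sv n) {..<q})" for q n
  have z_conv: "convergent (z q)" if q: "q \<le> CARD('n)" for q
  proof -
    obtain C where C: "0 < C" and cmp: "\<And>(T :: complex ^ 'n ^ 'n) v l. eigbasis (adjoint_mat T ** T) v l \<Longrightarrow>
        prod l {..<q} \<le> C * (minor_sum q T)\<^sup>2 \<and> (minor_sum q T)\<^sup>2 \<le> C * prod l {..<q}"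
      using minor_sum_singular_values[OF q] by metis
    have "convergent (\<lambda>n. root n (sqrt (prod (sv n) {..<q})))"
    proof (rule convergent_root_comparable[OF conv[OF q]])
      fix n
      have "sqrt (prod (sv n) {..<q}) \<le> sqrt C * minor_sum q (\<Phi> n)"
        using real_sqrt_le_mono[OF cmp[OF eb, THEN conjunct1]] by (simp add: real_sqrt_mult)
      moreover have "minor_sum q (\<Phi> n) \<le> sqrt C * sqrt (prod (sv n) {..<q})"
        using real_sqrt_le_mono[OF cmp[OF eb, THEN conjunct2]] by (simp add: real_sqrt_mult)
      ultimately show "sqrt (prod (sv n) {..<q}) \<le> sqrt C * minor_sum q (\<Phi> n) \<and>
          minor_sum q (\<Phi> n) \<le> sqrt C * sqrt (prod (sv n) {..<q})" ..
    qed (use C in simp)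
    moreover have "\<forall>\<^sub>F n in sequentially. root n (sqrt (prod (sv n) {..<q})) = z q n"
      using eventually_gt_at_top[of 0] by eventually_elim (simp add: z_def root_double)
    ultimately show ?thesis unfolding convergent_def using Lim_transform_eventually by blast
  qed
  have "convergent (\<lambda>n. root (2 * n) (sv n q))" if q: "q < CARD('n)" for q
  proof (cases "q = 0")
    case True
    then show ?thesis using z_conv[of 1] q unfolding z_def[abs_def] by simp
  next
    case False
    show ?thesis
    proof (rule convergent_factor[OF z_conv[of q]])
      have "z q n * root (2 * n) (sv n q) = z (Suc q) n" for n
        by (simp add: z_def real_root_mult)
      then show "convergent (\<lambda>n. z q n * root (2 * n) (sv n q))" using z_conv[of "Suc q"] q by simp
      fix n
      show "0 \<le> root (2 * n) (sv n q)" using nonneg[OF q] by (cases "n = 0") (auto simp: real_root_ge_zero)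
      show "root (2 * n) (sv n q) ^ q \<le> z q n"
      \<comment> \<open>\<open>root 0\<close> is identically zero, so at \<open>n = 0\<close> both
        sides vanish because \<open>q\<close> is positive.\<close>
      proof (cases "n = 0")
        case False
        have "sv n q ^ q = (\<Prod>i<q. sv n q)" by simp
        also have "\<dots> \<le> prod (sv n) {..<q}" using decreasing nonneg q by (intro prod_mono) auto
        finally show ?thesis using False by (simp add: z_def real_root_power[symmetric])
      qed (use \<open>q \<noteq> 0\<close> in \<open>simp add: z_def power_0_left\<close>)
    qed (use q False in auto)
  qed
  then have "\<forall>i<CARD('n). \<exists>t. (\<lambda>n. root (2 * n) (sv n i)) \<longlonglongrightarrow> t" by (simp add: convergent_def)
  then show ?thesis using that by metis
qed

end

context reduced_dynamics
begin

lemma AE_convergent_minors: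
  "AE w in S. \<forall>q. convergent (\<lambda>n. root n (minor_sum q (Phi M n w)))"
proof -
  \<comment> \<open>Contractivity for \<open>N\<close> bounds each matrix entry by
    \<open>b / a\<close>, so all \<open>M w\<close> lie in one ball, on which
    \<open>minor_sum q\<close> is bounded.\<close>
  define B where "B = real CARD('n) * (real CARD('n) * (b / a))"
  have M_bound: "norm (M w) \<le> B" if "w \<in> space p" for w
  proof -
    have entry: "cmod (M w $ i $ j) \<le> b / a" for i j
    proof -
      have "cmod (M w $ i $ j) \<le> norm (M w *v axis j 1)"
        by (metis Finite_Cartesian_Product.norm_nth_le matrix_vec_axis_nth)
      moreover have "norm (M w *v axis j 1) \<le> b / a * norm (axis j 1 :: complex ^ 'n)"
        by (rule norm_le_if_N_le[OF contraction[OF that]])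
      moreover have "norm (axis j 1 :: complex ^ 'n) = 1"
        by (rule norm_eq_1_if_cinner) (simp add: cinner_def axis_def if_distrib[where f="\<lambda>t. _ * t"] cong: if_cong)
      ultimately show ?thesis by simp
    qed
    have "norm (M w) \<le> (\<Sum>i\<in>UNIV. norm (M w $ i))"
      unfolding norm_vec_def[of "M w"] by (rule L2_set_le_sum) simp
    also have "\<dots> \<le> (\<Sum>i\<in>(UNIV :: 'n set). \<Sum>j\<in>(UNIV :: 'n set). b / a)"
    proof (rule sum_mono)
      fix i
      have "norm (M w $ i) \<le> (\<Sum>j\<in>UNIV. cmod (M w $ i $ j))"
        unfolding norm_vec_def[of "M w $ i"] by (rule L2_set_le_sum) simp
      also have "\<dots> \<le> (\<Sum>j\<in>(UNIV :: 'n set). b / a)" by (intro sum_mono entry)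
      finally show "norm (M w $ i) \<le> (\<Sum>j\<in>(UNIV :: 'n set). b / a)" .
    qed
    finally show ?thesis by (simp add: B_def)
  qed
  have "AE w in S. convergent (\<lambda>n. root n (minor_sum q (Phi M n w)))" for q
  proof -
    obtain K where K: "0 < K" "\<And>T :: complex ^ 'n ^ 'n. norm T \<le> B \<Longrightarrow> minor_sum q T \<le> K"
      using minor_sum_bound by blast
    interpret submultiplicative_cocycle p M "minor_sum q" K
    proof unfold_locales
      show "minor_sum q \<in> borel_measurable (borel :: (complex ^ 'n ^ 'n) measure)"
        by (rule borel_measurable_continuous_onI[OF continuous_minor_sum])
    qed (use K M_bound minor_sum_mult in auto)
    show ?thesis by (rule convergent_growth)
  qed
  then show ?thesis by (simp add: AE_all_countable)
qed

lemma lyapunov_simple_top: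
  assumes w: "w \<in> space S" and \<alpha>: "\<alpha> > 0" and D: "D > 0"
    and approx: "\<And>n x. norm ((Phi M n w - ketbra \<psi> \<eta>) *v x) \<le> D * exp (- \<alpha> * n) * norm x"
    and conv: "\<And>q. convergent (\<lambda>n. root n (minor_sum q (Phi M n w)))"
  defines "L \<equiv> lyapunov_matrix (\<lambda>n. Phi M n w)"
  shows "convergent (lyapunov_seq (\<lambda>n. Phi M n w))"
    and "lyapunov_multiplicity L (top_lyapunov_exponent L) = 1"
proof -
  define K where "K = b / a"
  have K: "K > 0" using a b by (simp add: K_def)
  have N_K: "norm x \<le> K * norm y" if "N x \<le> N y" for x y
    using norm_le_if_N_le[OF that] by (simp add: K_def)
  have "\<exists>v l. eigbasis (adjoint_mat (Phi M n w) ** Phi M n w) v l" for n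
    using eigbasis_exists[of "adjoint_mat (Phi M n w) ** Phi M n w"] by (metis adjoint_adjoint adjoint_mult)
  then obtain v sv where eb: "\<And>n. eigbasis (adjoint_mat (Phi M n w) ** Phi M n w) (v n) (sv n)"
    by metis
  interpret sd: singular_decomposition "\<lambda>n. Phi M n w" K v sv
  proof
    show "norm (Phi M (Suc n) w *v x) \<le> K * norm (Phi M n w *v x)" for n x
      using contraction[OF component_in_space[OF w], of "Suc n" "Phi M n w *v x"]
      by (intro N_K) (simp flip: matrix_vector_mul_assoc)
  qed (use K eb in auto)
  obtain t where t: "\<And>i. i < CARD('n) \<Longrightarrow> (\<lambda>n. root (2 * n) (sv n i)) \<longlonglongrightarrow> t i"
    using sd.growth_exists conv by metis
  interpret sg: singular_growth "\<lambda>n. Phi M n w" K v sv t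
    by unfold_locales (rule t)
  have d: "0 < CARD('n)" by simp
  \<comment> \<open>The fixed unit vector \<psi> keeps the largest singular value at least 1;
    contractivity for \<open>N\<close> keeps it at most \<open>K\<close>, whose \<open>n\<close>-th
    root tends to 1.\<close>
  have "t 0 = 1"
  proof (rule LIMSEQ_unique[OF t[OF d]])
    show "(\<lambda>n. root (2 * n) (sv n 0)) \<longlonglongrightarrow> 1"
    proof (rule tendsto_sandwich[of "\<lambda>_. 1" _ _ "\<lambda>n. root n K"])
      show "\<forall>\<^sub>F n in sequentially. 1 \<le> root (2 * n) (sv n 0)"
        using eventually_gt_at_top[of 0]
      proof eventually_elim
        case (elim n)
        have "1 \<le> sv n 0" using sd.norm_Phi_le[of n \<psi>] by (simp add: Phi_invariant[OF w] norm_\<psi>)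
        then show ?case using elim by simp
      qed
      show "\<forall>\<^sub>F n in sequentially. root (2 * n) (sv n 0) \<le> root n K"
        using eventually_gt_at_top[of 0]
      proof eventually_elim
        case (elim n)
        have "cinner (v n 0) (v n 0) = 1" using sd.on[of n] d by (simp add: onfam_def)
        then have "norm (v n 0) = 1" by (rule norm_eq_1_if_cinner)
        then have "sqrt (sv n 0) \<le> K"
          using N_K[OF Phi_contraction[OF w], of n "v n 0"] sd.norm_image[OF d, of n] by simp
        then show ?case using elim by (simp add: root_double)
      qed
    qed (use K in \<open>auto intro: LIMSEQ_root_const\<close>)
  qed
  moreover have "t i < 1" if i: "0 < i" "i < CARD('n)" for i
  proof -
    have le: "sqrt (sv n i) \<le> D * exp (- \<alpha> * n)" for n
    proof -
      have "sqrt (sv n i) \<le> sqrt (sv n 1)" using sd.decreasing[of 1 i n] i by simp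
      also have "\<dots> \<le> D * exp (- \<alpha> * n)"
      \<comment> \<open>On the orthogonal complement of \<eta> the rank-one term vanishes, so
        \<open>Phi M n w\<close> is there as small as the approximation error.\<close>
      proof (rule sd.second_singular_value_le)
        fix x assume "cinner \<eta> x = 0"
        then show "norm (Phi M n w *v x) \<le> D * exp (- \<alpha> * n) * norm x"
          using approx[of n x] by (simp add: matrix_vector_mult_diff_rdistrib ketbra_mult_vec)
      qed (use i in simp)
      finally show ?thesis .
    qed
    have "t i \<le> 1 * exp (- \<alpha>)"
    proof (rule LIMSEQ_le[OF t[OF i(2)]])
      show "(\<lambda>n. root n D * exp (- \<alpha>)) \<longlonglongrightarrow> 1 * exp (- \<alpha>)"
        by (intro tendsto_intros LIMSEQ_root_const D)
      have "root (2 * n) (sv n i) \<le> root n D * exp (- \<alpha>)" if "n > 0" for n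
      proof -
        have "exp (- \<alpha> * n) = exp (- \<alpha>) ^ n" by (simp add: exp_of_nat_mult[symmetric] mult.commute)
        then have "sqrt (sv n i) \<le> D * exp (- \<alpha>) ^ n" using le[of n] by metis
        then have "root n (sqrt (sv n i)) \<le> root n (D * exp (- \<alpha>) ^ n)" using that by simp
        then show ?thesis using that by (simp add: root_double real_root_mult real_root_power_cancel)
      qed
      then show "\<exists>n0. \<forall>n\<ge>n0. root (2 * n) (sv n i) \<le> root n D * exp (- \<alpha>)" by (intro exI[of _ 1]) auto
    qed
    also have "\<dots> < 1" using \<alpha> by simp
    finally show ?thesis .
  qed
  ultimately show "lyapunov_multiplicity L (top_lyapunov_exponent L) = 1"
    unfolding L_def by (intro simple_top_exponent[OF sg.lyapunov_limit(2)]) auto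
  show "convergent (lyapunov_seq (\<lambda>n. Phi M n w))" by (rule sg.lyapunov_limit(1))
qed

end

theorem theorem6:
  fixes p :: "'w measure"
    and N :: "complex ^ 'n \<Rightarrow> real"
    and \<psi> :: "complex ^ 'n"
    and M :: "'w \<Rightarrow> complex ^ 'n ^ 'n"
  assumes "rrdo p N \<psi> M"
    and "measure p {w \<in> space p. M w \<in> M_E N \<psi>} > 0"
  shows "\<exists>\<alpha>>0. \<exists>\<eta> \<in> borel_measurable (path_measure p).
    \<exists>\<Omega>\<^sub>0 \<in> sets (path_measure p). measure (path_measure p) \<Omega>\<^sub>0 = 1 \<and>
    (\<forall>w\<in>\<Omega>\<^sub>0.
       (\<exists>C::real. \<forall>n\<ge>1. op_norm (Phi M n w - ketbra \<psi> (\<eta> w)) \<le> C * exp (- \<alpha> * real n)) \<and>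
       convergent (lyapunov_seq (\<lambda>n. Phi M n w)) \<and>
       (let L = lyapunov_matrix (\<lambda>n. Phi M n w)
        in lyapunov_multiplicity L (top_lyapunov_exponent L) = 1))"
proof -
  interpret prob_space p using assms(1) by (simp add: rrdo_def)
  have "is_norm N" using assms(1) by (simp add: rrdo_def)
  then obtain a b where "0 < a" "0 < b" "\<And>x. a * norm x \<le> N x" "\<And>x. N x \<le> b * norm x"
    using is_norm_equiv by blast
  then interpret reduced_dynamics p N \<psi> M a b
    by unfold_locales (use assms(1) in \<open>auto simp: rrdo_def\<close>)
  obtain \<alpha> where \<alpha>: "\<alpha> > 0" and decay: "AE w in S. decays \<alpha> w"
    using transversal_decay[OF assms(2)] by blast
  define P where "P w \<longleftrightarrow> decays \<alpha> w \<and> (\<forall>q. convergent (\<lambda>n. root n (minor_sum q (Phi M n w))))" for w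
  have "AE w in S. P w" using decay AE_convergent_minors by (simp add: P_def)
  \<comment> \<open>The paths failing \<open>P\<close> are enclosed in a measurable null set
    \<open>E\<close>, so that its complement is a measurable set of full probability.\<close>
  then obtain E where E: "{w \<in> space S. \<not> P w} \<subseteq> E" "emeasure S E = 0" "E \<in> sets S"
    by (rule AE_E)
  show ?thesis
  proof (rule exI[of _ \<alpha>], intro conjI bexI[of _ dual_limit] bexI[of _ "space S - E"] ballI)
    show "measure S (space S - E) = 1"
      using S.prob_compl[OF E(3)] E(2) by (simp add: measure_def)
    fix w assume "w \<in> space S - E"
    then have w: "w \<in> space S" and "P w" using E(1) by auto
    then have "decays \<alpha> w" and conv: "\<And>q. convergent (\<lambda>n. root n (minor_sum q (Phi M n w)))"
      by (auto simp: P_def)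
    then obtain D where D: "D > 0"
      "\<And>n x. norm ((Phi M n w - ketbra \<psi> (dual_limit w)) *v x) \<le> D * exp (- \<alpha> * n) * norm x"
      using Phi_approx[OF w \<alpha>] by blast
    show "\<exists>C. \<forall>n\<ge>1. op_norm (Phi M n w - ketbra \<psi> (dual_limit w)) \<le> C * exp (- \<alpha> * real n)"
      by (intro exI[of _ D] allI impI op_norm_le D(2))
    note lyapunov_simple_top[OF w \<alpha> D conv]
    then show "convergent (lyapunov_seq (\<lambda>n. Phi M n w))"
      "let L = lyapunov_matrix (\<lambda>n. Phi M n w) in lyapunov_multiplicity L (top_lyapunov_exponent L) = 1"
      by (simp_all add: Let_def)
  qed (use \<alpha> E(3) dual_limit_measurable in auto)
qed

end
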